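(* Let $(\mathcal{E},\mathcal{L},\mathcal{B})$ be a normal labelled space, $R$ a unital commutative ring, $B$ an $R$-algebra and $\phi:L_R(\mathcal{E},\mathcal{L},\mathcal{B})\to B$ an $R$-algebra homomorphism. Then $\phi$ is injective if and only if its restriction to the abelian core $M(L_R(\mathcal{E},\mathcal{L},\mathcal{B}))$ is injective.
   Context: A graph $\mathcal{E}=(\mathcal{E}^0,\mathcal{E}^1,r,s)$ consists of a set of vertices $\mathcal{E}^0$, a set of edges $\mathcal{E}^1$ and maps $r,s:\mathcal{E}^1\to\mathcal{E}^0$. A finite path is a sequence $\lambda=\lambda_1\cdots\lambda_n$ of edges with $r(\lambda_i)=s(\lambda_{i+1})$, with $s(\lambda)=s(\lambda_1)$, $r(\lambda)=r(\lambda_n)$. A labelled graph $(\mathcal{E},\mathcal{L})$ is a graph with a surjective map $\mathcal{L}:\mathcal{E}^1\to\mathcal{A}$ onto a set $\mathcal{A}$ (the alphabet), extended to paths by $\mathcal{L}(\lambda)=\mathcal{L}(\lambda_1)\cdots\mathcal{L}(\lambda_n)$. $\mathcal{L}^*(\mathcal{E})$ denotes the set of words $\mathcal{L}(\lambda)$ for finite paths $\lambda$ of positive length, together with the empty word $\omega$; $|\alpha|$ is the length of a word and $\alpha_{1,k}$ its prefix of length $k$. For $A\subseteq\mathcal{E}^0$ and $\alpha\in\mathcal{L}^*(\mathcal{E})$, $r(A,\alpha)=\{r(\lambda)\mid \mathcal{L}(\lambda)=\alpha,\ s(\lambda)\in A\}$ if $\alpha\neq\omega$ and $r(A,\omega)=A$;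 $r(\alpha)=r(\mathcal{E}^0,\alpha)$; $\mathcal{L}(A\mathcal{E}^1)=\{a\in\mathcal{A}\mid r(A,a)\neq\emptyset\}$. A labelled space $(\mathcal{E},\mathcal{L},\mathcal{B})$ is a labelled graph with a family $\mathcal{B}$ of subsets of $\mathcal{E}^0$ closed under finite intersections and finite unions, containing $r(\alpha)$ for all non-empty $\alpha\in\mathcal{L}^*(\mathcal{E})$, and with $r(A,\alpha)\in\mathcal{B}$ for all $A\in\mathcal{B}$, $\alpha\in\mathcal{L}^*(\mathcal{E})$. It is normal if additionally $r(A\cap B,\alpha)=r(A,\alpha)\cap r(B,\alpha)$ for all $A,B\in\mathcal{B}$ and non-empty $\alpha$, and $\mathcal{B}$ is closed under relative complements. A non-empty $A\in\mathcal{B}$ is regular if $0<|\mathcal{L}(B\mathcal{E}^1)|<\infty$ for every non-empty $B\in\mathcal{B}$ with $B\subseteq A$; $\mathcal{B}_{reg}$ is the set of regular sets together with $\emptyset$. For $\alpha\in\mathcal{L}^*(\mathcal{E})$, $\mathcal{B}_\alpha=\{A\in\mathcal{B}\mid A\subseteq r(\alpha)\}$. The Leavitt labelled path algebra $L_R(\mathcal{E},\mathcal{L},\mathcal{B})$ is the universal $R$-algebra generated by $\{p_A\mid A\in\mathcal{B}\}\cup\{s_a,s_a^*\mid a\in\mathcal{A}\}$ subject to: (i) $p_{A\cap B}=p_Ap_B$, $p_{A\cup B}=p_A+p_B-p_{A\cap B}$, $p_\emptyset=0$; (ii) $p_As_a=s_ap_{r(A,a)}$ and $s_a^*p_A=p_{r(A,a)}s_a^*$;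 (iii) $s_a^*s_a=p_{r(a)}$ and $s_b^*s_a=0$ for $b\neq a$; (iv) $s_as_a^*s_a=s_a$, $s_a^*s_as_a^*=s_a^*$; (v) $p_A=\sum_{a\in\mathcal{L}(A\mathcal{E}^1)}s_ap_{r(A,a)}s_a^*$ for every $A\in\mathcal{B}_{reg}$. For $\alpha=a_1\cdots a_n$ put $s_\alpha=s_{a_1}\cdots s_{a_n}$, $s_\alpha^*=s_{a_n}^*\cdots s_{a_1}^*$, and $s_\omega$, $s_\omega^*$ are omitted in products. A pair $(\gamma,C)$ with $\gamma\in\mathcal{L}^*(\mathcal{E})$ non-empty and $C\in\mathcal{B}_\gamma$ is a cycle if $r(B,\gamma)=B$ for every $B\in\mathcal{B}_\gamma$ with $B\subseteq C$. A cycle has an exit if there exist $0\le k\le|\gamma|$ and non-empty $B\in\mathcal{B}$ with $B\subseteq r(C,\gamma_{1,k})$ and $\mathcal{L}(B\mathcal{E}^1)\neq\{\gamma_{k+1}\}$ (where $\gamma_{|\gamma|+1}=\gamma_1$). The abelian core $M(L_R(\mathcal{E},\mathcal{L},\mathcal{B}))$ is the $R$-subalgebra spanned by the elements $s_\alpha p_As_\alpha^*$, $s_\alpha p_Cs_\gamma^*s_\alpha^*$ and $s_\alpha s_\gamma p_Cs_\alpha^*$, where $\alpha\in\mathcal{L}^*(\mathcal{E})$, $A\in\mathcal{B}_\alpha$, and $(\gamma,C)$ is a cycle without exits. *)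

theory Defs
  imports Main
begin

text \<open>A labelled graph is given by range/source maps rg sg on an edge type 'e
 with vertex type 'v, and a labelling lab onto the alphabet range lab.
 BB is the family of vertex sets.\<close>

definition lpath :: "('e \<Rightarrow> 'v) \<Rightarrow> ('e \<Rightarrow> 'v) \<Rightarrow> 'e list \<Rightarrow> bool" where
  "lpath rg sg es \<longleftrightarrow> es \<noteq> [] \<and> (\<forall>i. Suc i < length es \<longrightarrow> rg (es ! i) = sg (es ! Suc i))"

definition words :: "('e \<Rightarrow> 'v) \<Rightarrow> ('e \<Rightarrow> 'v) \<Rightarrow> ('e \<Rightarrow> 'a) \<Rightarrow> 'a list set" where
  "words rg sg lab = {map lab es | es. lpath rg sg es} \<union> {[]}"

definition rset :: "('e \<Rightarrow> 'v) \<Rightarrow> ('e \<Rightarrow> 'v) \<Rightarrow> ('e \<Rightarrow> 'a) \<Rightarrow> 'v set \<Rightarrow> 'a list \<Rightarrow> 'v set" where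
  "rset rg sg lab A \<alpha> = (if \<alpha> = [] then A else
     {rg (last es) | es. lpath rg sg es \<and> map lab es = \<alpha> \<and> sg (hd es) \<in> A})"

definition rword :: "('e \<Rightarrow> 'v) \<Rightarrow> ('e \<Rightarrow> 'v) \<Rightarrow> ('e \<Rightarrow> 'a) \<Rightarrow> 'a list \<Rightarrow> 'v set" where
  "rword rg sg lab \<alpha> = rset rg sg lab UNIV \<alpha>"

definition out_labels :: "('e \<Rightarrow> 'v) \<Rightarrow> ('e \<Rightarrow> 'v) \<Rightarrow> ('e \<Rightarrow> 'a) \<Rightarrow> 'v set \<Rightarrow> 'a set" where
  "out_labels rg sg lab A = {a. rset rg sg lab A [a] \<noteq> {}}"

definition labelled_space :: "('e \<Rightarrow> 'v) \<Rightarrow> ('e \<Rightarrow> 'v) \<Rightarrow> ('e \<Rightarrow> 'a) \<Rightarrow> 'v set set \<Rightarrow> bool" where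
  "labelled_space rg sg lab BB \<longleftrightarrow>
     {} \<in> BB \<and>
     (\<forall>A\<in>BB. \<forall>B\<in>BB. A \<inter> B \<in> BB \<and> A \<union> B \<in> BB) \<and>
     (\<forall>\<alpha>\<in>words rg sg lab. \<alpha> \<noteq> [] \<longrightarrow> rword rg sg lab \<alpha> \<in> BB) \<and>
     (\<forall>A\<in>BB. \<forall>\<alpha>\<in>words rg sg lab. rset rg sg lab A \<alpha> \<in> BB)"

definition normal_labelled_space :: "('e \<Rightarrow> 'v) \<Rightarrow> ('e \<Rightarrow> 'v) \<Rightarrow> ('e \<Rightarrow> 'a) \<Rightarrow> 'v set set \<Rightarrow> bool" where
  "normal_labelled_space rg sg lab BB \<longleftrightarrow>
     labelled_space rg sg lab BB \<and>
     (\<forall>A\<in>BB. \<forall>B\<in>BB. \<forall>\<alpha>\<in>words rg sg lab. \<alpha> \<noteq> [] \<longrightarrow>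
         rset rg sg lab (A \<inter> B) \<alpha> = rset rg sg lab A \<alpha> \<inter> rset rg sg lab B \<alpha>) \<and>
     (\<forall>A\<in>BB. \<forall>B\<in>BB. A - B \<in> BB)"

definition regular_set :: "('e \<Rightarrow> 'v) \<Rightarrow> ('e \<Rightarrow> 'v) \<Rightarrow> ('e \<Rightarrow> 'a) \<Rightarrow> 'v set set \<Rightarrow> 'v set \<Rightarrow> bool" where
  "regular_set rg sg lab BB A \<longleftrightarrow> A \<in> BB \<and> A \<noteq> {} \<and>
     (\<forall>B\<in>BB. B \<noteq> {} \<and> B \<subseteq> A \<longrightarrow>
        finite (out_labels rg sg lab B) \<and> 0 < card (out_labels rg sg lab B))"

definition Breg :: "('e \<Rightarrow> 'v) \<Rightarrow> ('e \<Rightarrow> 'v) \<Rightarrow> ('e \<Rightarrow> 'a) \<Rightarrow> 'v set set \<Rightarrow> 'v set set" where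
  "Breg rg sg lab BB = {A. regular_set rg sg lab BB A} \<union> {{}}"

definition is_cycle :: "('e \<Rightarrow> 'v) \<Rightarrow> ('e \<Rightarrow> 'v) \<Rightarrow> ('e \<Rightarrow> 'a) \<Rightarrow> 'v set set \<Rightarrow> 'a list \<Rightarrow> 'v set \<Rightarrow> bool" where
  "is_cycle rg sg lab BB \<gamma> C \<longleftrightarrow> \<gamma> \<in> words rg sg lab \<and> \<gamma> \<noteq> [] \<and>
     C \<in> BB \<and> C \<subseteq> rword rg sg lab \<gamma> \<and>
     (\<forall>B\<in>BB. B \<subseteq> rword rg sg lab \<gamma> \<and> B \<subseteq> C \<longrightarrow> rset rg sg lab B \<gamma> = B)"

text \<open>gamma_(k+1) (1-based, with gamma_(|gamma|+1) = gamma_1) is (gamma @ [hd gamma]) ! k.\<close>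
definition has_exit :: "('e \<Rightarrow> 'v) \<Rightarrow> ('e \<Rightarrow> 'v) \<Rightarrow> ('e \<Rightarrow> 'a) \<Rightarrow> 'v set set \<Rightarrow> 'a list \<Rightarrow> 'v set \<Rightarrow> bool" where
  "has_exit rg sg lab BB \<gamma> C \<longleftrightarrow> (\<exists>k\<le>length \<gamma>. \<exists>B\<in>BB. B \<noteq> {} \<and>
     B \<subseteq> rset rg sg lab C (take k \<gamma>) \<and> out_labels rg sg lab B \<noteq> {(\<gamma> @ [hd \<gamma>]) ! k})"

datatype ('v, 'a) gen = P "'v set" | S 'a | Sst 'a

text \<open>Elements of the free algebra: finitely supported R-valued functions on
 non-empty words in the generators.\<close>

definition fzero :: "('v, 'a) gen list \<Rightarrow> 'r::comm_ring_1" where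
  "fzero = (\<lambda>w. 0)"

definition fmono :: "('v, 'a) gen list \<Rightarrow> ('v, 'a) gen list \<Rightarrow> 'r::comm_ring_1" where
  "fmono u = (\<lambda>w. if w = u then 1 else 0)"

definition fadd :: "(('v, 'a) gen list \<Rightarrow> 'r::comm_ring_1) \<Rightarrow> (('v, 'a) gen list \<Rightarrow> 'r) \<Rightarrow> ('v, 'a) gen list \<Rightarrow> 'r" where
  "fadd f g = (\<lambda>w. f w + g w)"

definition fsub :: "(('v, 'a) gen list \<Rightarrow> 'r::comm_ring_1) \<Rightarrow> (('v, 'a) gen list \<Rightarrow> 'r) \<Rightarrow> ('v, 'a) gen list \<Rightarrow> 'r" where
  "fsub f g = (\<lambda>w. f w - g w)"

definition fsmul :: "'r::comm_ring_1 \<Rightarrow> (('v, 'a) gen list \<Rightarrow> 'r) \<Rightarrow> ('v, 'a) gen list \<Rightarrow> 'r" where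
  "fsmul c f = (\<lambda>w. c * f w)"

definition fmul :: "(('v, 'a) gen list \<Rightarrow> 'r::comm_ring_1) \<Rightarrow> (('v, 'a) gen list \<Rightarrow> 'r) \<Rightarrow> ('v, 'a) gen list \<Rightarrow> 'r" where
  "fmul f g = (\<lambda>w. \<Sum>i\<in>{0..length w}. f (take i w) * g (drop i w))"

definition fsum :: "('i \<Rightarrow> ('v, 'a) gen list \<Rightarrow> 'r::comm_ring_1) \<Rightarrow> 'i set \<Rightarrow> ('v, 'a) gen list \<Rightarrow> 'r" where
  "fsum h X = (\<lambda>w. \<Sum>x\<in>X. h x w)"

fun valid_gen :: "('e \<Rightarrow> 'a) \<Rightarrow> 'v set set \<Rightarrow> ('v, 'a) gen \<Rightarrow> bool" where
  "valid_gen lab BB (P A) = (A \<in> BB)"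
| "valid_gen lab BB (S a) = (a \<in> range lab)"
| "valid_gen lab BB (Sst a) = (a \<in> range lab)"

definition freeF :: "('e \<Rightarrow> 'a) \<Rightarrow> 'v set set \<Rightarrow> (('v, 'a) gen list \<Rightarrow> 'r::comm_ring_1) set" where
  "freeF lab BB = {f. f [] = 0 \<and> finite {w. f w \<noteq> 0} \<and>
      (\<forall>w. f w \<noteq> 0 \<longrightarrow> (\<forall>g\<in>set w. valid_gen lab BB g))}"

abbreviation pA :: "'v set \<Rightarrow> ('v, 'a) gen list \<Rightarrow> 'r::comm_ring_1" where
  "pA A \<equiv> fmono [P A]"
abbreviation sa :: "'a \<Rightarrow> ('v, 'a) gen list \<Rightarrow> 'r::comm_ring_1" where
  "sa a \<equiv> fmono [S a]"
abbreviation sas :: "'a \<Rightarrow> ('v, 'a) gen list \<Rightarrow> 'r::comm_ring_1" where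
  "sas a \<equiv> fmono [Sst a]"

text \<open>The defining relations (i)-(v) of the Leavitt labelled path algebra,
 as elements of the free algebra (each relation x = y is encoded as x - y).\<close>
definition lpa_rels :: "('e \<Rightarrow> 'v) \<Rightarrow> ('e \<Rightarrow> 'v) \<Rightarrow> ('e \<Rightarrow> 'a) \<Rightarrow> 'v set set \<Rightarrow> (('v, 'a) gen list \<Rightarrow> 'r::comm_ring_1) set" where
  "lpa_rels rg sg lab BB =
     (\<Union>A\<in>BB. \<Union>B\<in>BB. {fsub (pA (A \<inter> B)) (fmul (pA A) (pA B)),
                        fsub (pA (A \<union> B)) (fsub (fadd (pA A) (pA B)) (pA (A \<inter> B)))})
   \<union> {pA {}}
   \<union> (\<Union>A\<in>BB. \<Union>a\<in>range lab.
        {fsub (fmul (pA A) (sa a)) (fmul (sa a) (pA (rset rg sg lab A [a]))),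
         fsub (fmul (sas a) (pA A)) (fmul (pA (rset rg sg lab A [a])) (sas a))})
   \<union> (\<Union>a\<in>range lab.
        {fsub (fmul (sas a) (sa a)) (pA (rword rg sg lab [a])),
         fsub (fmul (sa a) (fmul (sas a) (sa a))) (sa a),
         fsub (fmul (sas a) (fmul (sa a) (sas a))) (sas a)})
   \<union> {fmul (sas b) (sa a) | a b. a \<in> range lab \<and> b \<in> range lab \<and> b \<noteq> a}
   \<union> {fsub (pA A) (fsum (\<lambda>a. fmul (sa a) (fmul (pA (rset rg sg lab A [a])) (sas a)))
                          (out_labels rg sg lab A)) | A. A \<in> Breg rg sg lab BB}"

inductive_set gen_ideal :: "(('v, 'a) gen list \<Rightarrow> 'r::comm_ring_1) set \<Rightarrow> (('v, 'a) gen list \<Rightarrow> 'r) set \<Rightarrow> (('v, 'a) gen list \<Rightarrow> 'r) set"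
  for FF X where
  base: "x \<in> X \<Longrightarrow> x \<in> gen_ideal FF X"
| zero: "fzero \<in> gen_ideal FF X"
| add: "x \<in> gen_ideal FF X \<Longrightarrow> y \<in> gen_ideal FF X \<Longrightarrow> fadd x y \<in> gen_ideal FF X"
| smul: "x \<in> gen_ideal FF X \<Longrightarrow> fsmul c x \<in> gen_ideal FF X"
| lmul: "f \<in> FF \<Longrightarrow> x \<in> gen_ideal FF X \<Longrightarrow> fmul f x \<in> gen_ideal FF X"
| rmul: "f \<in> FF \<Longrightarrow> x \<in> gen_ideal FF X \<Longrightarrow> fmul x f \<in> gen_ideal FF X"

inductive_set gen_subalg :: "(('v, 'a) gen list \<Rightarrow> 'r::comm_ring_1) set \<Rightarrow> (('v, 'a) gen list \<Rightarrow> 'r) set"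
  for X where
  base: "x \<in> X \<Longrightarrow> x \<in> gen_subalg X"
| zero: "fzero \<in> gen_subalg X"
| add: "x \<in> gen_subalg X \<Longrightarrow> y \<in> gen_subalg X \<Longrightarrow> fadd x y \<in> gen_subalg X"
| smul: "x \<in> gen_subalg X \<Longrightarrow> fsmul c x \<in> gen_subalg X"
| mul: "x \<in> gen_subalg X \<Longrightarrow> y \<in> gen_subalg X \<Longrightarrow> fmul x y \<in> gen_subalg X"

definition lpa_ideal :: "('e \<Rightarrow> 'v) \<Rightarrow> ('e \<Rightarrow> 'v) \<Rightarrow> ('e \<Rightarrow> 'a) \<Rightarrow> 'v set set \<Rightarrow> (('v, 'a) gen list \<Rightarrow> 'r::comm_ring_1) set" where
  "lpa_ideal rg sg lab BB = gen_ideal (freeF lab BB) (lpa_rels rg sg lab BB)"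

definition lpa_rel :: "('e \<Rightarrow> 'v) \<Rightarrow> ('e \<Rightarrow> 'v) \<Rightarrow> ('e \<Rightarrow> 'a) \<Rightarrow> 'v set set \<Rightarrow> ((('v, 'a) gen list \<Rightarrow> 'r::comm_ring_1) \<times> (('v, 'a) gen list \<Rightarrow> 'r)) set" where
  "lpa_rel rg sg lab BB = {(f, g). f \<in> freeF lab BB \<and> g \<in> freeF lab BB \<and> fsub f g \<in> lpa_ideal rg sg lab BB}"

definition lpa_cls :: "('e \<Rightarrow> 'v) \<Rightarrow> ('e \<Rightarrow> 'v) \<Rightarrow> ('e \<Rightarrow> 'a) \<Rightarrow> 'v set set \<Rightarrow> (('v, 'a) gen list \<Rightarrow> 'r::comm_ring_1) \<Rightarrow> (('v, 'a) gen list \<Rightarrow> 'r) set" where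
  "lpa_cls rg sg lab BB f = lpa_rel rg sg lab BB `` {f}"

text \<open>Carrier of L_R(E,L,B).  Its operations are [f]+[g]=[f+g], c[f]=[cf], [f][g]=[fg].\<close>
definition LPA :: "('e \<Rightarrow> 'v) \<Rightarrow> ('e \<Rightarrow> 'v) \<Rightarrow> ('e \<Rightarrow> 'a) \<Rightarrow> 'v set set \<Rightarrow> (('v, 'a) gen list \<Rightarrow> 'r::comm_ring_1) set set" where
  "LPA rg sg lab BB = freeF lab BB // lpa_rel rg sg lab BB"

definition lpa_hom :: "('e \<Rightarrow> 'v) \<Rightarrow> ('e \<Rightarrow> 'v) \<Rightarrow> ('e \<Rightarrow> 'a) \<Rightarrow> 'v set set \<Rightarrow> ('r::comm_ring_1 \<Rightarrow> 'b::ring \<Rightarrow> 'b) \<Rightarrow> ((('v, 'a) gen list \<Rightarrow> 'r) set \<Rightarrow> 'b) \<Rightarrow> bool" where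
  "lpa_hom rg sg lab BB smul \<phi> \<longleftrightarrow>
     (\<forall>f\<in>freeF lab BB. \<forall>g\<in>freeF lab BB.
        \<phi> (lpa_cls rg sg lab BB (fadd f g)) = \<phi> (lpa_cls rg sg lab BB f) + \<phi> (lpa_cls rg sg lab BB g) \<and>
        \<phi> (lpa_cls rg sg lab BB (fmul f g)) = \<phi> (lpa_cls rg sg lab BB f) * \<phi> (lpa_cls rg sg lab BB g)) \<and>
     (\<forall>f\<in>freeF lab BB. \<forall>c.
        \<phi> (lpa_cls rg sg lab BB (fsmul c f)) = smul c (\<phi> (lpa_cls rg sg lab BB f)))"

definition r_algebra :: "('r::comm_ring_1 \<Rightarrow> 'b::ring \<Rightarrow> 'b) \<Rightarrow> bool" where
  "r_algebra smul \<longleftrightarrow>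
     (\<forall>c x y. smul c (x + y) = smul c x + smul c y) \<and>
     (\<forall>c d x. smul (c + d) x = smul c x + smul d x) \<and>
     (\<forall>c d x. smul (c * d) x = smul c (smul d x)) \<and>
     (\<forall>x. smul 1 x = x) \<and>
     (\<forall>c x y. smul c (x * y) = smul c x * y \<and> smul c (x * y) = x * smul c y)"

definition core_gens :: "('e \<Rightarrow> 'v) \<Rightarrow> ('e \<Rightarrow> 'v) \<Rightarrow> ('e \<Rightarrow> 'a) \<Rightarrow> 'v set set \<Rightarrow> (('v, 'a) gen list \<Rightarrow> 'r::comm_ring_1) set" where
  "core_gens rg sg lab BB =
     {fmono (map S \<alpha> @ [P A] @ rev (map Sst \<alpha>)) | \<alpha> A.
        \<alpha> \<in> words rg sg lab \<and> A \<in> BB \<and> A \<subseteq> rword rg sg lab \<alpha>}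
   \<union> {fmono (map S \<alpha> @ [P C] @ rev (map Sst \<gamma>) @ rev (map Sst \<alpha>)) | \<alpha> \<gamma> C.
        \<alpha> \<in> words rg sg lab \<and> is_cycle rg sg lab BB \<gamma> C \<and> \<not> has_exit rg sg lab BB \<gamma> C}
   \<union> {fmono (map S \<alpha> @ map S \<gamma> @ [P C] @ rev (map Sst \<alpha>)) | \<alpha> \<gamma> C.
        \<alpha> \<in> words rg sg lab \<and> is_cycle rg sg lab BB \<gamma> C \<and> \<not> has_exit rg sg lab BB \<gamma> C}"

definition abelian_core :: "('e \<Rightarrow> 'v) \<Rightarrow> ('e \<Rightarrow> 'v) \<Rightarrow> ('e \<Rightarrow> 'a) \<Rightarrow> 'v set set \<Rightarrow> (('v, 'a) gen list \<Rightarrow> 'r::comm_ring_1) set set" where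
  "abelian_core rg sg lab BB = lpa_cls rg sg lab BB ` gen_subalg (core_gens rg sg lab BB)"

end

theory Submission
  imports Defs
begin

text \<open>
  Let \<open>J\<close> be an ideal containing an element \<open>x \<noteq> 0\<close>; it must meet the abelian core nontrivially.
  Multiplying \<open>x\<close> by generators yields an element of \<open>J\<close> whose component of degree \<open>0\<close> is a nonzero element
  of the diagonal, and a further diagonal idempotent \<open>e\<close> turns that component into \<open>r e \<noteq> 0\<close> with a scalar \<open>r\<close>.
  The other terms are multiples of \<open>u = s\<^sub>\<alpha> s\<^sub>\<beta>\<^sup>*\<close> with \<open>|\<alpha>| \<noteq> |\<beta>|\<close>, and each of them is pushed into the core by
  shrinking \<open>e\<close>, keeping \<open>r e \<noteq> 0\<close>. The only resistant case, up to exchanging \<open>\<alpha>\<close> and \<open>\<beta>\<close>, is \<open>\<alpha> = \<beta>\<delta>\<close> with \<open>r e\<close> concentrated on the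
  path \<open>\<beta>\<delta>\<delta>\<delta>\<dots>\<close>: then \<open>e\<close> may be taken as \<open>s\<^sub>w p\<^sub>B s\<^sub>w\<^sup>*\<close> with \<open>w = \<beta>\<delta>\<^sup>k\<close>, and either some \<open>D \<subseteq> B\<close> is moved by \<open>\<delta>\<close>,
  so that a smaller idempotent \<open>f\<close> satisfies \<open>f u f = 0\<close>, or \<open>(\<delta>, B)\<close> is a cycle without exits and
  \<open>e u e\<close> is a generator of the core. The argument uses that \<open>r p\<^sub>A = 0\<close> only for \<open>r = 0\<close> or \<open>A = \<emptyset>\<close>, which is read off
  from the representation on boundary paths, and that the algebra is \<open>\<int>\<close>-graded; relation (v) enters
  only through that representation.
\<close>

section \<open>Ranges of words\<close>

text \<open>\<open>R\<close> may have zero divisors, so a nonzero idempotent \<open>e\<close> can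
  have a part annihilated by the scalar found for the diagonal component. Every case split in the
  shrinking step therefore asks whether \<open>K c * e\<close> vanishes, with \<open>c\<close>
  fixed, and never whether \<open>e\<close> does. Being concentrated on a path means that
  \<open>K c * (e - e * rproj w)\<close> is 0 for every finite stage \<open>w\<close>; faithfulness
  on the projections turns such equations into statements about vertex sets. Degree 0 is larger than
  the diagonal: it also contains \<open>sw \<alpha> * (p A * tw \<beta>)\<close> for distinct words
  of equal length. These are removed by stripping one letter on each side, and an element that no
  such stripping keeps nonzero turns out to be diagonal already. The element finally found in the
  core is nonzero because its degree 0 part is \<open>K c * f\<close>, which terms of other degrees
  cannot cancel. The algebra need not have a unit, while empty words and expressions such as
  \<open>1 - rproj w\<close> call for one. The computations therefore take place in a unital ring
  that contains the algebra, and idempotents are complemented only relative to one another.\<close>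

lemma lpath_append:
  assumes "es \<noteq> []" "fs \<noteq> []"
  shows "lpath rg sg (es @ fs) \<longleftrightarrow> lpath rg sg es \<and> lpath rg sg fs \<and> rg (last es) = sg (hd fs)"
proof
  assume L: "lpath rg sg (es @ fs)"
  then have *: "rg ((es @ fs) ! i) = sg ((es @ fs) ! Suc i)" if "Suc i < length es + length fs" for i
    using that unfolding lpath_def by auto
  have "rg (es ! i) = sg (es ! Suc i)" if "Suc i < length es" for i
    using *[of i] that by (simp add: nth_append)
  moreover have "rg (fs ! i) = sg (fs ! Suc i)" if "Suc i < length fs" for i
    using *[of "length es + i"] that by (simp add: nth_append)
  moreover have "rg (last es) = sg (hd fs)"
    using *[of "length es - 1"] assms by (simp add: nth_append last_conv_nth hd_conv_nth)
  ultimately show "lpath rg sg es \<and> lpath rg sg fs \<and> rg (last es) = sg (hd fs)"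
    using assms by (simp add: lpath_def)
next
  assume R: "lpath rg sg es \<and> lpath rg sg fs \<and> rg (last es) = sg (hd fs)"
  have "rg ((es @ fs) ! i) = sg ((es @ fs) ! Suc i)" if i: "Suc i < length es + length fs" for i
  proof (cases "Suc i < length es")
    case True
    then show ?thesis using R by (simp add: lpath_def nth_append)
  next
    case F: False
    show ?thesis
    proof (cases "Suc i = length es")
      case True
      then have "i = length es - 1" "i < length es" by auto
      then show ?thesis using R assms True
        by (simp add: nth_append last_conv_nth hd_conv_nth)
    next
      case False
      then obtain j where "i = length es + j" using F by (metis Suc_lessI le_add_diff_inverse not_less not_less_eq)
      then show ?thesis using R i by (simp add: lpath_def nth_append)
    qed
  qed
  then show "lpath rg sg (es @ fs)" using assms by (simp add: lpath_def)
qed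

lemma rset_Nil [simp]: "rset rg sg lab A [] = A"
  by (simp add: rset_def)

lemma rset_append: "rset rg sg lab A (\<alpha> @ \<beta>) = rset rg sg lab (rset rg sg lab A \<alpha>) \<beta>"
proof (cases "\<alpha> = [] \<or> \<beta> = []")
  case True
  then show ?thesis by auto
next
  case False
  show ?thesis
  proof (intro equalityI subsetI)
    fix x assume "x \<in> rset rg sg lab A (\<alpha> @ \<beta>)"
    then obtain gs where gs: "x = rg (last gs)" "lpath rg sg gs" "map lab gs = \<alpha> @ \<beta>" "sg (hd gs) \<in> A"
      using False by (auto simp: rset_def)
    obtain es fs where ef: "gs = es @ fs" "map lab es = \<alpha>" "map lab fs = \<beta>"
      using gs(3) by (auto simp: map_eq_append_conv)
    have ne: "es \<noteq> []" "fs \<noteq> []" using ef False by auto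
    have L: "lpath rg sg es" "lpath rg sg fs" "rg (last es) = sg (hd fs)"
      using gs(2) ef lpath_append[OF ne] by auto
    have "sg (hd es) \<in> A" using gs(4) ef ne by simp
    then have "rg (last es) \<in> rset rg sg lab A \<alpha>" using L ef False by (auto simp: rset_def)
    then have "rg (last fs) \<in> rset rg sg lab (rset rg sg lab A \<alpha>) \<beta>"
      using L(2,3) ef(3) False unfolding rset_def[of _ _ _ _ \<beta>] by auto
    then show "x \<in> rset rg sg lab (rset rg sg lab A \<alpha>) \<beta>" using gs ef ne by simp
  next
    fix x assume "x \<in> rset rg sg lab (rset rg sg lab A \<alpha>) \<beta>"
    then obtain fs where fs: "x = rg (last fs)" "lpath rg sg fs" "map lab fs = \<beta>"
      "sg (hd fs) \<in> rset rg sg lab A \<alpha>"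
      using False unfolding rset_def[of _ _ _ _ \<beta>] by auto
    obtain es where es: "sg (hd fs) = rg (last es)" "lpath rg sg es" "map lab es = \<alpha>" "sg (hd es) \<in> A"
      using fs(4) False by (auto simp: rset_def)
    have ne: "es \<noteq> []" "fs \<noteq> []" using es fs False by auto
    have "lpath rg sg (es @ fs)" using lpath_append[OF ne, of rg sg] es fs by auto
    then have "rg (last (es @ fs)) \<in> rset rg sg lab A (\<alpha> @ \<beta>)"
      unfolding rset_def using es fs ne False by (auto intro!: exI[of _ "es @ fs"])
    then show "x \<in> rset rg sg lab A (\<alpha> @ \<beta>)" using fs ne by simp
  qed
qed

lemma rset_mono: "A \<subseteq> B \<Longrightarrow> rset rg sg lab A \<alpha> \<subseteq> rset rg sg lab B \<alpha>"
  by (auto simp: rset_def)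

lemma rset_empty [simp]: "rset rg sg lab {} \<alpha> = {}"
  by (auto simp: rset_def)

text \<open>A path with label \<alpha> ends in the range of \<alpha>. So a non-word has empty range,
  and membership in \<open>BB\<close> and normality can be stated below for arbitrary lists.\<close>

lemma words_iff: "\<alpha> \<in> words rg sg lab \<longleftrightarrow> \<alpha> = [] \<or> rword rg sg lab \<alpha> \<noteq> {}"
  by (auto simp: words_def rword_def rset_def)

lemma rset_subset_rword: "rset rg sg lab A \<alpha> \<subseteq> rword rg sg lab \<alpha>"
  by (simp add: rword_def rset_mono)

lemma rword_append: "rword rg sg lab (\<alpha> @ \<beta>) = rset rg sg lab (rword rg sg lab \<alpha>) \<beta>"
  by (simp add: rword_def rset_append)

lemma rword_append_subset: "rword rg sg lab (\<alpha> @ \<beta>) \<subseteq> rword rg sg lab \<beta>"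
  by (simp add: rword_append rset_subset_rword)

lemma rset_not_range: "a \<notin> range lab \<Longrightarrow> rset rg sg lab A [a] = {}"
  by (auto simp: rset_def)

locale normal_space =
  fixes rg sg :: "'e \<Rightarrow> 'v" and lab :: "'e \<Rightarrow> 'a" and BB :: "'v set set"
  assumes normal: "normal_labelled_space rg sg lab BB"
begin

abbreviation "rr \<equiv> rset rg sg lab"
abbreviation "rw \<equiv> rword rg sg lab"

lemma empty_BB [simp, intro]: "{} \<in> BB"
  and Int_BB [simp, intro]: "A \<in> BB \<Longrightarrow> B \<in> BB \<Longrightarrow> A \<inter> B \<in> BB"
  and Un_BB [simp, intro]: "A \<in> BB \<Longrightarrow> B \<in> BB \<Longrightarrow> A \<union> B \<in> BB"
  and Diff_BB [simp, intro]: "A \<in> BB \<Longrightarrow> B \<in> BB \<Longrightarrow> A - B \<in> BB"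
  using normal by (auto simp: normal_labelled_space_def labelled_space_def)

lemma rw_BB [simp, intro]: "\<alpha> \<noteq> [] \<Longrightarrow> rw \<alpha> \<in> BB"
  using normal words_iff[of \<alpha> rg sg lab]
  by (cases "rw \<alpha> = {}") (auto simp: normal_labelled_space_def labelled_space_def)

lemma rr_BB [simp, intro]:
  assumes "A \<in> BB" shows "rr A \<alpha> \<in> BB"
proof (cases "\<alpha> \<in> words rg sg lab")
  case True
  then show ?thesis using normal assms by (auto simp: normal_labelled_space_def labelled_space_def)
next
  case False
  then have "rr A \<alpha> = {}" using rset_subset_rword[of rg sg lab A \<alpha>] words_iff[of \<alpha> rg sg lab] by auto
  then show ?thesis by simp
qed

text \<open>Normality, extended to the empty word and to non-words. Its main use is that disjoint
  members of \<open>BB\<close> have disjoint ranges along any word.\<close>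

lemma rr_Int:
  assumes "A \<in> BB" "B \<in> BB" shows "rr (A \<inter> B) \<alpha> = rr A \<alpha> \<inter> rr B \<alpha>"
proof (cases "\<alpha> \<in> words rg sg lab \<and> \<alpha> \<noteq> []")
  case True
  then show ?thesis using normal assms by (auto simp: normal_labelled_space_def)
next
  case False
  then show ?thesis using rset_subset_rword[of rg sg lab _ \<alpha>] words_iff[of \<alpha> rg sg lab] by (auto; force)
qed

end

section \<open>Words in the generators and diagonal idempotents\<close>

text \<open>Relations (i) to (iv) in a unital ring, with scalars as central elements
  \<open>K c\<close>. Letters run through the whole type: one outside the alphabet has empty range,
  so that interpreting it by 0 respects the relations.\<close>

locale labelled_rep = normal_space rg sg lab BB
  for rg sg :: "'e \<Rightarrow> 'v" and lab :: "'e \<Rightarrow> 'a" and BB :: "'v set set" +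
  fixes K :: "'r::comm_ring_1 \<Rightarrow> 'q::ring_1"
    and p :: "'v set \<Rightarrow> 'q" and s t :: "'a \<Rightarrow> 'q"
  assumes K_1: "K 1 = 1"
    and K_add: "K (c + d) = K c + K d"
    and K_mult: "K (c * d) = K c * K d"
    and K_comm: "x * K c = K c * x"
    and p_Int: "A \<in> BB \<Longrightarrow> B \<in> BB \<Longrightarrow> p A * p B = p (A \<inter> B)"
    and p_Un: "A \<in> BB \<Longrightarrow> B \<in> BB \<Longrightarrow> p (A \<union> B) = p A + p B - p (A \<inter> B)"
    and p_empty [simp]: "p {} = 0"
    and p_s: "A \<in> BB \<Longrightarrow> p A * s a = s a * p (rset rg sg lab A [a])"
    and t_p: "A \<in> BB \<Longrightarrow> t a * p A = p (rset rg sg lab A [a]) * t a"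
    and t_s_same: "t a * s a = p (rword rg sg lab [a])"
    and t_s_diff: "a \<noteq> b \<Longrightarrow> t b * s a = 0"
    and s_t_s: "s a * (t a * s a) = s a"
    and t_s_t: "t a * (s a * t a) = t a"
begin

text \<open>Products are kept nested to the right; this form lets a relation between two factors
  rewrite them when more factors follow.\<close>

lemma assoc_rule: "(x::'q) * y = z \<Longrightarrow> x * (y * w) = z * w"
  by (simp flip: mult.assoc)

lemma K_0 [simp]: "K 0 = 0"
  using K_add[of 0 0] by simp

lemma K_minus: "K (- c) = - K c"
  using K_add[of c "- c"] by (simp add: minus_unique)

lemma K_comm': "x * (K c * y) = K c * (x * y)"
  by (metis K_comm mult.assoc)

lemma p_Diff: "A \<in> BB \<Longrightarrow> B \<in> BB \<Longrightarrow> p (A - B) = p A - p A * p B"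
proof -
  assume AB: "A \<in> BB" "B \<in> BB"
  have "(A - B) \<union> (A \<inter> B) = A" "(A - B) \<inter> (A \<inter> B) = {}" by auto
  then have "p A = p (A - B) + p (A \<inter> B)" using p_Un[of "A - B" "A \<inter> B"] AB by simp
  then show ?thesis unfolding p_Int[OF AB] by (simp add: algebra_simps)
qed

definition sw :: "'a list \<Rightarrow> 'q" where "sw \<alpha> = prod_list (map s \<alpha>)"
definition tw :: "'a list \<Rightarrow> 'q" where "tw \<alpha> = prod_list (rev (map t \<alpha>))"

lemma sw_Nil [simp]: "sw [] = 1" and tw_Nil [simp]: "tw [] = 1"
  by (simp_all add: sw_def tw_def)

lemma sw_append: "sw (\<alpha> @ \<beta>) = sw \<alpha> * sw \<beta>" and tw_append: "tw (\<alpha> @ \<beta>) = tw \<beta> * tw \<alpha>"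
  by (simp_all add: sw_def tw_def)

lemma sw_Cons: "sw (a # \<beta>) = s a * sw \<beta>" and tw_Cons: "tw (a # \<beta>) = tw \<beta> * t a"
  by (simp_all add: sw_def tw_def)

lemma p_sw: "A \<in> BB \<Longrightarrow> p A * sw \<alpha> = sw \<alpha> * p (rr A \<alpha>)"
proof (induction \<alpha> arbitrary: A)
  case (Cons a \<alpha>)
  have "rr A (a # \<alpha>) = rr (rr A [a]) \<alpha>" using rset_append[of rg sg lab A "[a]" \<alpha>] by simp
  moreover have "p A * (s a * sw \<alpha>) = s a * (p (rr A [a]) * sw \<alpha>)"
    by (simp only: assoc_rule[OF p_s[OF Cons.prems]] mult.assoc)
  ultimately show ?case using Cons.IH[of "rr A [a]"] Cons.prems by (simp add: sw_Cons mult.assoc)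
qed simp

lemma tw_p: "A \<in> BB \<Longrightarrow> tw \<alpha> * p A = p (rr A \<alpha>) * tw \<alpha>"
proof (induction \<alpha> arbitrary: A)
  case (Cons a \<alpha>)
  have "rr A (a # \<alpha>) = rr (rr A [a]) \<alpha>" using rset_append[of rg sg lab A "[a]" \<alpha>] by simp
  moreover have "tw \<alpha> * t a * p A = tw \<alpha> * p (rr A [a]) * t a"
    by (simp only: t_p[OF Cons.prems] mult.assoc)
  ultimately show ?case using Cons.IH[of "rr A [a]"] Cons.prems by (simp add: tw_Cons mult.assoc[symmetric])
qed simp

lemma s_rw: "s a * p (rw [a]) = s a" and rw_t: "p (rw [a]) * t a = t a"
  using s_t_s[of a] t_s_t[of a] by (simp_all add: t_s_same flip: mult.assoc)

lemma sw_rw: "\<alpha> \<noteq> [] \<Longrightarrow> sw \<alpha> * p (rw \<alpha>) = sw \<alpha>"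
proof (induction \<alpha> rule: rev_induct)
  case (snoc a \<alpha>)
  show ?case
  proof (cases "\<alpha> = []")
    case True
    then show ?thesis by (simp add: sw_Cons s_rw)
  next
    case False
    have "sw (\<alpha> @ [a]) * p (rw (\<alpha> @ [a])) = sw \<alpha> * (s a * p (rr (rw \<alpha>) [a]))"
      by (simp add: sw_append sw_Cons rword_append mult.assoc)
    also have "\<dots> = sw \<alpha> * p (rw \<alpha>) * s a" by (simp only: p_s[OF rw_BB[OF False]] mult.assoc)
    finally show ?thesis using snoc False by (simp add: sw_append sw_Cons)
  qed
qed simp

lemma rw_tw: "\<alpha> \<noteq> [] \<Longrightarrow> p (rw \<alpha>) * tw \<alpha> = tw \<alpha>"
proof (induction \<alpha> rule: rev_induct)
  case (snoc a \<alpha>)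
  show ?case
  proof (cases "\<alpha> = []")
    case True
    then show ?thesis by (simp add: tw_Cons rw_t)
  next
    case False
    have "p (rw (\<alpha> @ [a])) * tw (\<alpha> @ [a]) = p (rr (rw \<alpha>) [a]) * t a * tw \<alpha>"
      by (simp add: tw_append tw_Cons rword_append mult.assoc)
    also have "\<dots> = t a * (p (rw \<alpha>) * tw \<alpha>)" by (simp only: t_p[OF rw_BB[OF False]] mult.assoc[symmetric])
    finally show ?thesis using snoc False by (simp add: tw_append tw_Cons)
  qed
qed simp

lemma sw_p_cut: "A \<in> BB \<Longrightarrow> \<alpha> \<noteq> [] \<Longrightarrow> sw \<alpha> * p A = sw \<alpha> * p (A \<inter> rw \<alpha>)"
  by (simp add: p_Int[symmetric] Int_commute[of A] assoc_rule[OF sw_rw])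

text \<open>The innermost pair collapses to the projection of its range, which passes through the
  remaining word and is absorbed, since the range of the whole word lies in that of its
  tail.\<close>

lemma tw_sw_same: "\<alpha> \<noteq> [] \<Longrightarrow> tw \<alpha> * sw \<alpha> = p (rw \<alpha>)"
proof (induction \<alpha>)
  case (Cons a \<alpha>)
  show ?case
  proof (cases "\<alpha> = []")
    case True
    then show ?thesis by (simp add: tw_Cons sw_Cons t_s_same)
  next
    case False
    have "rw (a # \<alpha>) = rr (rw [a]) \<alpha>" using rword_append[of rg sg lab "[a]" \<alpha>] by simp
    moreover have "tw (a # \<alpha>) * sw (a # \<alpha>) = tw \<alpha> * (p (rw [a]) * sw \<alpha>)"
      by (simp add: tw_Cons sw_Cons mult.assoc assoc_rule[OF t_s_same])
    ultimately have "tw (a # \<alpha>) * sw (a # \<alpha>) = p (rw \<alpha>) * p (rw (a # \<alpha>))"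
      using False by (simp add: p_sw assoc_rule[OF Cons.IH])
    also have "\<dots> = p (rw (a # \<alpha>))"
      using False rword_append_subset[of rg sg lab "[a]" \<alpha>] by (simp add: p_Int inf.absorb2)
    finally show ?thesis .
  qed
qed simp

lemma tw_sw_prefix: "\<alpha> \<noteq> [] \<Longrightarrow> tw \<alpha> * sw (\<alpha> @ \<mu>) = sw \<mu> * p (rw (\<alpha> @ \<mu>))"
  by (simp add: sw_append assoc_rule[OF tw_sw_same] p_sw rword_append)

lemma tw_sw_prefix': "\<alpha> \<noteq> [] \<Longrightarrow> tw (\<alpha> @ \<mu>) * sw \<alpha> = p (rw (\<alpha> @ \<mu>)) * tw \<mu>"
  by (simp add: tw_append mult.assoc tw_sw_same tw_p rword_append)

text \<open>The common prefix collapses to projections, and the first pair of different letters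
  gives 0.\<close>

lemma tw_sw_diff: "(\<nexists>\<mu>. \<beta> = \<alpha> @ \<mu>) \<Longrightarrow> (\<nexists>\<mu>. \<alpha> = \<beta> @ \<mu>) \<Longrightarrow> tw \<alpha> * sw \<beta> = 0"
proof (induction \<alpha> arbitrary: \<beta>)
  case (Cons a \<alpha>)
  then obtain b \<beta>' where b: "\<beta> = b # \<beta>'" by (cases \<beta>) auto
  show ?case
  proof (cases "a = b")
    case False
    then show ?thesis by (simp add: b tw_Cons sw_Cons mult.assoc assoc_rule[OF t_s_diff])
  next
    case True
    have z: "tw \<alpha> * sw \<beta>' = 0" using Cons b True by simp
    have "tw (a # \<alpha>) * sw \<beta> = tw \<alpha> * (p (rw [a]) * sw \<beta>')"
      by (simp add: b True tw_Cons sw_Cons mult.assoc assoc_rule[OF t_s_same])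
    also have "\<dots> = 0" by (simp add: p_sw assoc_rule[OF z])
    finally show ?thesis .
  qed
qed simp

lemma sw_tw_sw: "sw \<alpha> * (tw \<alpha> * sw \<alpha>) = sw \<alpha>"
  by (cases "\<alpha> = []") (simp_all add: tw_sw_same sw_rw)

lemma tw_sw_tw: "tw \<alpha> * (sw \<alpha> * tw \<alpha>) = tw \<alpha>"
  by (cases "\<alpha> = []") (simp_all add: assoc_rule[OF tw_sw_same] rw_tw)

text \<open>Projections onto cylinders: \<open>dproj\<close> over a set, \<open>rproj\<close> over
  the full range. They part ways at the empty word, where \<open>rproj\<close> is the unit of the
  ring, which need not come from any member of \<open>BB\<close>.\<close>

definition dproj :: "'a list \<Rightarrow> 'v set \<Rightarrow> 'q" where "dproj \<alpha> A = sw \<alpha> * (p A * tw \<alpha>)"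
definition rproj :: "'a list \<Rightarrow> 'q" where "rproj \<alpha> = sw \<alpha> * tw \<alpha>"

lemma dproj_cut: "A \<in> BB \<Longrightarrow> \<alpha> \<noteq> [] \<Longrightarrow> dproj \<alpha> A = dproj \<alpha> (A \<inter> rw \<alpha>)"
  unfolding dproj_def mult.assoc[symmetric] by (subst sw_p_cut) auto

lemma rproj_Nil [simp]: "rproj [] = 1" by (simp add: rproj_def)

lemma rproj_eq_dproj: "\<alpha> \<noteq> [] \<Longrightarrow> rproj \<alpha> = dproj \<alpha> (rw \<alpha>)"
  by (simp add: rproj_def dproj_def rw_tw)

text \<open>Cylinders intersect like sets of paths: along the longer word, the condition
  \<open>A\<close> imposed after the prefix becomes the condition \<open>rr A \<mu>\<close>.\<close>

lemma dproj_prefix_mult: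
  assumes "A \<in> BB" "B \<in> BB"
  shows "dproj \<alpha> A * dproj (\<alpha> @ \<mu>) B = dproj (\<alpha> @ \<mu>) (rr A \<mu> \<inter> B)" (is ?A)
    and "dproj (\<alpha> @ \<mu>) B * dproj \<alpha> A = dproj (\<alpha> @ \<mu>) (rr A \<mu> \<inter> B)" (is ?B)
proof -
  have a: "sw \<alpha> * (p A * (tw \<alpha> * (sw \<alpha> * x))) = sw \<alpha> * (p A * x)" for x
  proof (cases "\<alpha> = []")
    case False
    then show ?thesis
      by (simp add: assoc_rule[OF tw_sw_same] assoc_rule[OF p_Int] assms)
        (simp add: assms Int_commute[of "rw \<alpha>"] sw_p_cut[symmetric] flip: mult.assoc)
  qed simp
  have b: "tw \<alpha> * (sw \<alpha> * (p A * tw \<alpha>)) = p A * tw \<alpha>"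
  proof (cases "\<alpha> = []")
    case False
    then show ?thesis
      by (simp add: assoc_rule[OF tw_sw_same] assoc_rule[OF p_Int] assms)
        (simp add: assms Int_commute[of "rw \<alpha>"] p_Int[symmetric] mult.assoc rw_tw)
  qed simp
  show ?A
    by (simp add: dproj_def sw_append mult.assoc a assms assoc_rule[OF p_sw] assoc_rule[OF p_Int])
  show ?B
    by (simp add: dproj_def sw_append tw_append mult.assoc b assms assoc_rule[OF tw_p] assoc_rule[OF p_Int] Int_commute)
qed

lemma dproj_diff_mult:
  assumes "(\<nexists>\<mu>. \<beta> = \<alpha> @ \<mu>)" "(\<nexists>\<mu>. \<alpha> = \<beta> @ \<mu>)"
  shows "dproj \<alpha> A * dproj \<beta> B = 0"
  by (simp add: dproj_def mult.assoc assoc_rule[OF tw_sw_diff[OF assms]])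

lemma dproj_comm:
  assumes "A \<in> BB" "B \<in> BB" shows "dproj \<alpha> A * dproj \<beta> B = dproj \<beta> B * dproj \<alpha> A"
proof -
  consider \<mu> where "\<beta> = \<alpha> @ \<mu>" | \<mu> where "\<alpha> = \<beta> @ \<mu>" | "\<nexists>\<mu>. \<beta> = \<alpha> @ \<mu>" "\<nexists>\<mu>. \<alpha> = \<beta> @ \<mu>" by blast
  then show ?thesis
  proof cases
    case 1
    then show ?thesis using assms by (simp add: dproj_prefix_mult)
  next
    case 2
    then show ?thesis using assms by (simp add: dproj_prefix_mult)
  next
    case 3
    then show ?thesis by (simp add: dproj_diff_mult)
  qed
qed

lemma dproj_idem: "A \<in> BB \<Longrightarrow> dproj \<alpha> A * dproj \<alpha> A = dproj \<alpha> A"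
  using dproj_prefix_mult(1)[of A A \<alpha> "[]"] by simp

text \<open>The diagonal idempotents needed for shrinking. Complements are relative, because there
  may be no largest idempotent.\<close>

inductive_set idems :: "'q set" where
  gen: "A \<in> BB \<Longrightarrow> dproj \<alpha> A \<in> idems"
| mult: "e \<in> idems \<Longrightarrow> f \<in> idems \<Longrightarrow> e * f \<in> idems"
| diff: "e \<in> idems \<Longrightarrow> f \<in> idems \<Longrightarrow> e - e * f \<in> idems"

lemma comm_mult: "x * a = a * (x::'q) \<Longrightarrow> y * a = a * y \<Longrightarrow> x * y * a = a * (x * y)"
  by (simp add: mult.assoc) (simp flip: mult.assoc)

lemma comm_diff: "x * a = a * (x::'q) \<Longrightarrow> y * a = a * y \<Longrightarrow> (x - x * y) * a = a * (x - x * y)"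
  using comm_mult[of x a y] by (simp only: left_diff_distrib right_diff_distrib)

lemma idems_comm:
  assumes "e \<in> idems" "f \<in> idems" shows "e * f = f * e"
proof -
  have G: "f * dproj \<alpha> A = dproj \<alpha> A * f" if "A \<in> BB" for \<alpha> A
    using assms(2) by induction (simp_all add: that dproj_comm comm_mult comm_diff)
  show ?thesis
    using assms(1) by induction (simp_all add: G comm_mult comm_diff)
qed

lemma idems_idem: "e \<in> idems \<Longrightarrow> e * e = e"
proof (induction rule: idems.induct)
  case (mult e f)
  have "e * f * (e * f) = e * (f * e) * f" by (simp only: mult.assoc)
  also have "\<dots> = (e * e) * (f * f)" by (simp only: idems_comm[OF mult(2,1)] mult.assoc)
  finally show ?case by (simp only: mult.IH)
next
  case (diff e f)
  have 1: "e * (e * f) = e * f" using diff by (simp flip: mult.assoc)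
  have 2: "e * f * e = e * f" using idems_comm[OF diff(2,1)] 1 by (simp add: mult.assoc)
  have "e * f * (e * f) = e * f" using 2 diff(4) by (metis mult.assoc)
  with diff 1 2 show ?case by (simp only: left_diff_distrib right_diff_distrib) simp
qed (simp add: dproj_idem)

lemma p_idems: "A \<in> BB \<Longrightarrow> p A \<in> idems"
  using idems.gen[of A "[]"] by (simp add: dproj_def)

lemma idems_rproj: "e \<in> idems \<Longrightarrow> e * rproj \<alpha> \<in> idems"
  by (cases "\<alpha> = []") (auto simp: rproj_eq_dproj intro: idems.intros)

lemma idems_rproj_diff: "e \<in> idems \<Longrightarrow> \<alpha> \<noteq> [] \<Longrightarrow> e - e * rproj \<alpha> \<in> idems"
  by (auto simp: rproj_eq_dproj intro: idems.intros)

lemma rproj_comm: "e \<in> idems \<Longrightarrow> rproj \<alpha> * e = e * rproj \<alpha>"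
  by (cases "\<alpha> = []") (auto simp: rproj_eq_dproj intro: idems_comm idems.intros)

lemma rproj_idem: "rproj \<alpha> * rproj \<alpha> = rproj \<alpha>"
  by (simp add: rproj_def mult.assoc tw_sw_tw)

text \<open>Compression to the cylinder of \<open>w\<close> respects products on the diagonal,
  because \<open>rproj w\<close> commutes with \<open>e\<close>.\<close>

lemma compress_mult:
  assumes "e \<in> idems"
  shows "tw w * (e * f * sw w) = tw w * (e * sw w) * (tw w * (f * sw w))"
proof -
  have "tw w * (e * f * sw w) = (tw w * (sw w * tw w)) * e * f * sw w"
    by (simp only: tw_sw_tw) (simp only: mult.assoc)
  also have "\<dots> = tw w * (rproj w * e) * f * sw w" by (simp only: rproj_def mult.assoc)
  also have "\<dots> = tw w * (e * rproj w) * f * sw w" by (simp only: rproj_comm[OF assms])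
  finally show ?thesis by (simp only: rproj_def mult.assoc)
qed

text \<open>An idempotent of the diagonal involves finitely many words. Once \<open>w\<close> is at
  least as long as all of them, each is either a prefix of \<open>w\<close> or incomparable with it,
  so on the cylinder of \<open>w\<close> only a vertex set remains visible.\<close>

lemma idems_compress:
  assumes "e \<in> idems"
  shows "\<exists>m. \<forall>w. w \<noteq> [] \<longrightarrow> length w \<ge> m \<longrightarrow> (\<exists>B\<in>BB. tw w * (e * sw w) = p B)"
  using assms
proof induction
  case (gen A \<alpha>)
  show ?case
  proof (intro exI[of _ "length \<alpha>"] allI impI)
    fix w :: "'a list" assume w: "w \<noteq> []" "length \<alpha> \<le> length w"
    show "\<exists>B\<in>BB. tw w * (dproj \<alpha> A * sw w) = p B"
    proof (cases "\<exists>\<mu>. w = \<alpha> @ \<mu>")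
      case True
      then obtain \<mu> where \<mu>: "w = \<alpha> @ \<mu>" by blast
      have *: "tw w * (dproj \<alpha> A * sw w) = tw w * (dproj \<alpha> A * rproj w) * sw w"
        using sw_tw_sw[of w] by (simp add: rproj_def mult.assoc)
      also have "dproj \<alpha> A * rproj w = dproj w (rr A \<mu> \<inter> rw w)"
        using w dproj_prefix_mult(1)[OF gen, of "rw w" \<alpha> \<mu>] by (simp add: \<mu> rproj_eq_dproj)
      also have "tw w * dproj w (rr A \<mu> \<inter> rw w) * sw w = p (rw w) * (p (rr A \<mu> \<inter> rw w) * p (rw w))"
        using w by (simp add: dproj_def mult.assoc assoc_rule[OF tw_sw_same] tw_sw_same)
      also have "\<dots> = p (rr A \<mu> \<inter> rw w)"
        using w gen by (simp add: p_Int Int_ac)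
      finally show ?thesis using w gen by auto
    next
      case False
      have "\<nexists>\<mu>. \<alpha> = w @ \<mu>" using False w(2) by auto
      then have z: "tw w * sw \<alpha> = 0" using tw_sw_diff False by blast
      have "tw w * (dproj \<alpha> A * sw w) = p {}" by (simp add: dproj_def assoc_rule[OF z] mult.assoc)
      then show ?thesis by blast
    qed
  qed
next
  case (mult e f)
  then obtain m n where
    m: "\<And>w. w \<noteq> [] \<Longrightarrow> length w \<ge> m \<Longrightarrow> \<exists>B\<in>BB. tw w * (e * sw w) = p B" and
    n: "\<And>w. w \<noteq> [] \<Longrightarrow> length w \<ge> n \<Longrightarrow> \<exists>B\<in>BB. tw w * (f * sw w) = p B" by blast
  show ?case
  proof (intro exI[of _ "max m n"] allI impI)
    fix w :: "'a list" assume w: "w \<noteq> []" "max m n \<le> length w"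
    obtain B C where BC: "B \<in> BB" "tw w * (e * sw w) = p B" "C \<in> BB" "tw w * (f * sw w) = p C"
      using m[of w] n[of w] w by auto
    then show "\<exists>B\<in>BB. tw w * (e * f * sw w) = p B"
      using compress_mult[OF mult(1), of w f] by (auto simp: p_Int)
  qed
next
  case (diff e f)
  then obtain m n where
    m: "\<And>w. w \<noteq> [] \<Longrightarrow> length w \<ge> m \<Longrightarrow> \<exists>B\<in>BB. tw w * (e * sw w) = p B" and
    n: "\<And>w. w \<noteq> [] \<Longrightarrow> length w \<ge> n \<Longrightarrow> \<exists>B\<in>BB. tw w * (f * sw w) = p B" by blast
  show ?case
  proof (intro exI[of _ "max m n"] allI impI)
    fix w :: "'a list" assume w: "w \<noteq> []" "max m n \<le> length w"
    obtain B C where BC: "B \<in> BB" "tw w * (e * sw w) = p B" "C \<in> BB" "tw w * (f * sw w) = p C"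
      using m[of w] n[of w] w by auto
    have "tw w * ((e - e * f) * sw w) = tw w * (e * sw w) - tw w * (e * f * sw w)"
      by (simp only: left_diff_distrib right_diff_distrib)
    also have "\<dots> = p (B - C)"
      using BC compress_mult[OF diff(1), of w f] by (simp add: p_Diff)
    finally show "\<exists>B\<in>BB. tw w * ((e - e * f) * sw w) = p B" using BC by blast
  qed
qed

section \<open>Corners and cycles\<close>

text \<open>The abelian core inside the ring, rule by rule parallel to \<open>gen_subalg\<close>
  applied to \<open>core_gens\<close>.\<close>

inductive_set core_alg :: "'q set" where
  diag: "\<alpha> \<in> words rg sg lab \<Longrightarrow> A \<in> BB \<Longrightarrow> A \<subseteq> rw \<alpha> \<Longrightarrow> sw \<alpha> * (p A * tw \<alpha>) \<in> core_alg"
| cyc_tw: "\<alpha> \<in> words rg sg lab \<Longrightarrow> is_cycle rg sg lab BB \<gamma> C \<Longrightarrow> \<not> has_exit rg sg lab BB \<gamma> C \<Longrightarrow>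
    sw \<alpha> * (p C * (tw \<gamma> * tw \<alpha>)) \<in> core_alg"
| cyc_sw: "\<alpha> \<in> words rg sg lab \<Longrightarrow> is_cycle rg sg lab BB \<gamma> C \<Longrightarrow> \<not> has_exit rg sg lab BB \<gamma> C \<Longrightarrow>
    sw \<alpha> * (sw \<gamma> * (p C * tw \<alpha>)) \<in> core_alg"
| zero: "0 \<in> core_alg"
| add: "x \<in> core_alg \<Longrightarrow> y \<in> core_alg \<Longrightarrow> x + y \<in> core_alg"
| scale: "x \<in> core_alg \<Longrightarrow> K c * x \<in> core_alg"
| mult: "x \<in> core_alg \<Longrightarrow> y \<in> core_alg \<Longrightarrow> x * y \<in> core_alg"

lemma core_alg_diff: "x \<in> core_alg \<Longrightarrow> y \<in> core_alg \<Longrightarrow> x - y \<in> core_alg"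
  using core_alg.add[of x "K (- 1) * y"] core_alg.scale[of y "- 1"] by (simp add: K_minus K_1)

text \<open>The generators of the core require a word \<alpha> and a subset of its range. Cutting
  \<open>A\<close> down to \<open>rw \<alpha>\<close> achieves the second, and for a non-word it
  leaves 0.\<close>

lemma idems_core_alg: "e \<in> idems \<Longrightarrow> e \<in> core_alg"
proof (induction rule: idems.induct)
  case (gen A \<alpha>)
  show ?case
  proof (cases "\<alpha> = []")
    case True
    then show ?thesis using gen core_alg.diag[of "[]" A] by (simp add: dproj_def words_iff rword_def)
  next
    case False
    show ?thesis
    proof (cases "rw \<alpha> = {}")
      case True
      then show ?thesis using dproj_cut[OF gen False] by (simp add: dproj_def core_alg.zero)
    next
      case F: False
      then show ?thesis using dproj_cut[OF gen False] core_alg.diag[of \<alpha> "A \<inter> rw \<alpha>"] gen False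
        by (simp add: dproj_def words_iff)
    qed
  qed
qed (auto intro: core_alg.mult core_alg_diff)

lemma sw_diff_rproj: "(e - e * rproj w) * sw w = 0"
  by (simp add: left_diff_distrib rproj_def mult.assoc sw_tw_sw)

lemma tw_diff_rproj: "e \<in> idems \<Longrightarrow> tw w * (e - e * rproj w) = 0"
  by (simp add: rproj_comm[symmetric] right_diff_distrib) (simp add: rproj_def mult.assoc[symmetric] tw_sw_tw[unfolded mult.assoc[symmetric]])

text \<open>Compressing to the cylinder of \<open>w\<close> and expanding again gives
  \<open>rproj w * e * rproj w\<close>, which is \<open>e * rproj w\<close> by
  commutativity.\<close>

lemma dproj_below:
  assumes "e \<in> idems" "B \<in> BB" "tw w * (e * sw w) = p B"
  shows "e * rproj w = dproj w B"
proof -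
  have "e * rproj w = e * (rproj w * rproj w)" by (simp add: rproj_idem)
  also have "\<dots> = rproj w * e * rproj w" by (simp add: rproj_comm[OF assms(1)] mult.assoc)
  also have "\<dots> = sw w * (tw w * (e * sw w)) * tw w" by (simp only: rproj_def mult.assoc)
  finally show ?thesis by (simp add: assms(3) dproj_def mult.assoc)
qed

definition lasso :: "'a list \<Rightarrow> 'a list \<Rightarrow> nat \<Rightarrow> 'a list" where
  "lasso \<beta> \<delta> k = \<beta> @ concat (replicate k \<delta>)"

lemma lasso_0 [simp]: "lasso \<beta> \<delta> 0 = \<beta>" by (simp add: lasso_def)

lemma lasso_Suc: "lasso \<beta> \<delta> (Suc k) = lasso \<beta> \<delta> k @ \<delta>"
  by (simp add: lasso_def flip: replicate_append_same)

lemma length_lasso: "\<delta> \<noteq> [] \<Longrightarrow> k \<le> length (lasso \<beta> \<delta> k)"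
  by (induction k) (auto simp: lasso_Suc Suc_le_eq neq_Nil_conv)

text \<open>Inserting \<delta> right after \<beta> is the same as appending it at the end of the
  stage, so \<open>sw (\<beta> @ \<delta>) * tw \<beta>\<close> moves stage \<open>k\<close> to
  stage \<open>Suc k\<close>. The empty stage is separated because \<open>rw []\<close> is
  \<open>UNIV\<close>, which need not belong to \<open>BB\<close>.\<close>

lemma shift_sw:
  "sw (\<beta> @ \<delta>) * (tw \<beta> * sw (lasso \<beta> \<delta> k)) =
   sw (lasso \<beta> \<delta> (Suc k)) * (if lasso \<beta> \<delta> k = [] then 1 else p (rw (lasso \<beta> \<delta> k)))" (is "?L = ?R")
proof (cases "\<beta> = []")
  case True
  have "sw (lasso \<beta> \<delta> (Suc k)) = sw \<delta> * sw (lasso \<beta> \<delta> k)"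
    by (simp add: lasso_def True flip: sw_append)
  then show ?thesis by (simp add: True mult.assoc sw_rw)
next
  case False
  have "?L = sw \<beta> * (sw \<delta> * (sw (concat (replicate k \<delta>)) * p (rw (lasso \<beta> \<delta> k))))"
    using False by (simp add: lasso_def sw_append mult.assoc assoc_rule[OF tw_sw_same] p_sw rword_append)
  also have "\<dots> = sw (lasso \<beta> \<delta> (Suc k)) * p (rw (lasso \<beta> \<delta> k))"
    by (simp add: lasso_def sw_append mult.assoc)
  finally show ?thesis using False by (simp add: lasso_def)
qed

lemma shift_tw:
  "tw (lasso \<beta> \<delta> k) * (sw \<beta> * tw (\<beta> @ \<delta>)) =
   (if lasso \<beta> \<delta> k = [] then 1 else p (rw (lasso \<beta> \<delta> k))) * tw (lasso \<beta> \<delta> (Suc k))" (is "?L = ?R")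
proof (cases "\<beta> = []")
  case True
  have "tw (lasso \<beta> \<delta> (Suc k)) = tw (lasso \<beta> \<delta> k) * tw \<delta>"
    by (simp add: lasso_def True flip: tw_append)
  then show ?thesis by (simp add: True rw_tw flip: mult.assoc)
next
  case False
  have "?L = tw (concat (replicate k \<delta>)) * p (rw \<beta>) * tw \<delta> * tw \<beta>"
    using False by (simp add: lasso_def tw_append mult.assoc assoc_rule[OF tw_sw_same])
  also have "\<dots> = p (rw (lasso \<beta> \<delta> k)) * tw (lasso \<beta> \<delta> (Suc k))"
    using False by (simp add: lasso_def tw_append mult.assoc tw_p rword_append)
  finally show ?thesis using False by (simp add: lasso_def)
qed

text \<open>Everything is decided by \<open>rr G \<delta> \<inter> G\<close>: if it is empty, both
  corners vanish; if it is \<open>G\<close>, they have the shape of the two cycle generators of the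
  core.\<close>

lemma corner_dproj:
  assumes w: "w = lasso \<beta> \<delta> k" "w \<noteq> []" and G: "G \<in> BB" "G \<subseteq> rw w"
  shows "dproj w G * (sw (\<beta> @ \<delta>) * tw \<beta>) * dproj w G = sw w * (sw \<delta> * (p (rr G \<delta> \<inter> G) * tw w))" (is ?A)
    and "dproj w G * (sw \<beta> * tw (\<beta> @ \<delta>)) * dproj w G = sw w * (p (rr G \<delta> \<inter> G) * (tw \<delta> * tw w))" (is ?B)
proof -
  have sub: "rw w \<inter> G = G" "G \<inter> rw w = G" using G by auto
  have sub2: "rr G \<delta> \<subseteq> rw (w @ \<delta>)" using G by (simp add: rword_append rset_mono)
  then have sub3: "rr G \<delta> \<inter> rw (w @ \<delta>) = rr G \<delta>" "rw (w @ \<delta>) \<inter> rr G \<delta> = rr G \<delta>" by auto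
  have ne: "w @ \<delta> \<noteq> []" using w by simp
  have "dproj w G * (sw (\<beta> @ \<delta>) * tw \<beta>) * dproj w G
      = sw w * (p G * (tw w * (sw (\<beta> @ \<delta>) * (tw \<beta> * sw w)) * (p G * tw w)))"
    by (simp only: dproj_def mult.assoc)
  also have "tw w * (sw (\<beta> @ \<delta>) * (tw \<beta> * sw w)) = sw \<delta> * (p (rw (w @ \<delta>)) * p (rw w))"
    using w shift_sw[of \<beta> \<delta> k] tw_sw_prefix[OF w(2), of \<delta>] by (simp add: lasso_Suc assoc_rule mult.assoc flip: mult.assoc)
  also have "sw w * (p G * (sw \<delta> * (p (rw (w @ \<delta>)) * p (rw w)) * (p G * tw w)))
     = sw w * (sw \<delta> * (p (rr G \<delta>) * (p (rw (w @ \<delta>)) * (p (rw w) * (p G * tw w)))))"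
    by (simp add: mult.assoc assoc_rule[OF p_sw[OF G(1)]])
  also have "\<dots> = sw w * (sw \<delta> * (p (rr G \<delta> \<inter> G) * tw w))"
    using G w(2) ne by (simp add: assoc_rule[OF p_Int] sub sub3 flip: Int_assoc)
  finally show ?A .
  have "dproj w G * (sw \<beta> * tw (\<beta> @ \<delta>)) * dproj w G
      = sw w * (p G * ((tw w * (sw \<beta> * tw (\<beta> @ \<delta>))) * sw w * (p G * tw w)))"
    by (simp only: dproj_def mult.assoc)
  also have "tw w * (sw \<beta> * tw (\<beta> @ \<delta>)) * sw w = p (rw w) * (p (rw (w @ \<delta>)) * tw \<delta>)"
    using w shift_tw[of \<beta> \<delta> k] tw_sw_prefix'[OF w(2), of \<delta>] by (simp add: lasso_Suc mult.assoc)
  also have "sw w * (p G * (p (rw w) * (p (rw (w @ \<delta>)) * tw \<delta>) * (p G * tw w)))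
     = sw w * (p G * (p (rw w) * (p (rw (w @ \<delta>)) * (p (rr G \<delta>) * (tw \<delta> * tw w)))))"
    by (simp add: mult.assoc assoc_rule[OF tw_p[OF G(1)]])
  also have "\<dots> = sw w * (p (rr G \<delta> \<inter> G) * (tw \<delta> * tw w))"
    using G w(2) ne by (simp add: assoc_rule[OF p_Int] sub sub3 Int_commute flip: Int_assoc)
  finally show ?B .
qed

section \<open>Linear spans sorted by degree\<close>

inductive_set kspan :: "'q set \<Rightarrow> 'q set" for X where
  zero: "0 \<in> kspan X"
| step: "x \<in> X \<Longrightarrow> y \<in> kspan X \<Longrightarrow> K c * x + y \<in> kspan X"

text \<open>Degrees enter as a set, so that one notion covers the whole algebra
  (\<open>UNIV\<close>), a homogeneous part (\<open>{n}\<close>) and everything off degree 0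
  (\<open>- {0}\<close>).\<close>

definition hspan :: "int set \<Rightarrow> 'q set" where
  "hspan D = kspan {sw \<alpha> * (p A * tw \<beta>) | \<alpha> A \<beta>. A \<in> BB \<and> int (length \<alpha>) - int (length \<beta>) \<in> D}"

end

locale labelled_graded_rep = labelled_rep +
  assumes faith: "A \<in> BB \<Longrightarrow> K c * p A = 0 \<Longrightarrow> c = 0 \<or> A = {}"
    and graded: "x \<in> hspan {0} \<Longrightarrow> y \<in> hspan (- {0}) \<Longrightarrow> x + y = 0 \<Longrightarrow> x = 0"
begin

text \<open>Compressing by \<open>w\<close> recovers \<open>K c * p G\<close>, to which
  \<open>faith\<close> applies.\<close>

lemma faith_dproj:
  assumes "c \<noteq> 0" "G \<in> BB" "G \<subseteq> rw w" "w \<noteq> []" "G \<noteq> {}" shows "K c * dproj w G \<noteq> 0"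
proof
  assume z: "K c * dproj w G = 0"
  have "tw w * (K c * dproj w G) * sw w = K c * (tw w * (dproj w G * sw w))"
    by (simp add: K_comm' mult.assoc)
  also have "tw w * (dproj w G * sw w) = p G"
    using assms by (simp add: dproj_def mult.assoc assoc_rule[OF tw_sw_same] tw_sw_same p_Int inf.absorb1 inf.absorb2)
  finally show False using z faith[of G c] assms by simp
qed

text \<open>An exit would be a set \<open>D\<close> reached from \<open>B\<close> along a prefix of
  \<delta>. There \<open>K c * p D\<close> factors through the next letter \<open>b\<close> of the
  cycle; multiplying by another letter \<open>a\<close> shows that \<open>D\<close> emits no
  \<open>a\<close>, and if \<open>D\<close> emitted no \<open>b\<close> then
  \<open>K c * p D\<close> would be 0. So \<open>b\<close> is exactly what \<open>D\<close>
  emits.\<close>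

lemma no_exit:
  assumes c: "c \<noteq> 0" and w: "w \<noteq> []" and B: "B \<in> BB" "B \<subseteq> rw w"
    and \<delta>: "\<delta> \<noteq> []"
    and all: "K c * (dproj w B - dproj w B * rproj (w @ \<delta> @ \<delta>)) = 0"
  shows "\<not> has_exit rg sg lab BB \<delta> B"
proof
  assume "has_exit rg sg lab BB \<delta> B"
  then obtain k D where k: "k \<le> length \<delta>" "D \<in> BB" "D \<noteq> {}" "D \<subseteq> rr B (take k \<delta>)"
    and out: "out_labels rg sg lab D \<noteq> {(\<delta> @ [hd \<delta>]) ! k}" unfolding has_exit_def by blast
  define \<mu> where "\<mu> = take k \<delta>"
  define b where "b = (\<delta> @ [hd \<delta>]) ! k"
  define \<rho> where "\<rho> = drop (Suc k) (\<delta> @ \<delta>)"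
  \<comment> \<open>For \<open>k = length \<delta>\<close> the next letter is the first one of the
    second copy; this is why the hypothesis follows \<delta> twice.\<close>
  have b': "b = (\<delta> @ \<delta>) ! k" using k(1) \<delta> by (auto simp: b_def nth_append hd_conv_nth)
  have \<mu>': "\<mu> = take k (\<delta> @ \<delta>)" using k(1) by (simp add: \<mu>_def)
  have klt: "k < length (\<delta> @ \<delta>)" using k(1) \<delta> by (cases \<delta>) auto
  have split: "\<delta> @ \<delta> = \<mu> @ b # \<rho>"
    unfolding \<mu>' b' \<rho>_def using id_take_nth_drop[OF klt] .
  define v where "v = w @ \<mu>"
  have v: "v \<noteq> []" "w @ \<delta> @ \<delta> = v @ b # \<rho>" using w split by (auto simp: v_def)
  have Dv: "D \<subseteq> rw v" using k(4) B(2) rset_mono[of B "rw w" rg sg lab \<mu>] by (simp add: v_def rword_append \<mu>_def)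
  have gD: "dproj v D * dproj w B = dproj v D"
    using dproj_prefix_mult(2)[OF B(1) k(2), of w \<mu>] k(4) by (simp add: v_def \<mu>_def inf.absorb2)
  have "dproj v D * (dproj w B - dproj w B * rproj (v @ b # \<rho>)) = dproj v D - dproj v D * rproj (v @ b # \<rho>)"
    by (simp add: right_diff_distrib gD assoc_rule)
  then have "K c * (dproj v D - dproj v D * rproj (v @ b # \<rho>)) = dproj v D * (K c * (dproj w B - dproj w B * rproj (v @ b # \<rho>)))"
    by (simp add: K_comm')
  then have "K c * (dproj v D - dproj v D * rproj (v @ b # \<rho>)) = 0" using all v(2) by simp
  then have "tw v * (K c * (dproj v D - dproj v D * rproj (v @ b # \<rho>))) * sw v = 0" by simp
  then have z: "K c * (tw v * (dproj v D * sw v) - tw v * (dproj v D * (rproj (v @ b # \<rho>) * sw v))) = 0"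
    by (simp add: K_comm' left_diff_distrib right_diff_distrib mult.assoc)
  have e1: "tw v * (dproj v D * sw v) = p D"
    using v(1) k(2) Dv by (simp add: dproj_def mult.assoc assoc_rule[OF tw_sw_same] tw_sw_same p_Int inf.absorb1 inf.absorb2)
  have "tw v * (dproj v D * (rproj (v @ b # \<rho>) * sw v)) = p (rw v) * (p D * (tw v * sw (v @ b # \<rho>) * (tw (v @ b # \<rho>) * sw v)))"
    using v(1) by (simp add: dproj_def rproj_def mult.assoc assoc_rule[OF tw_sw_same])
  also have "\<dots> = p D * (sw (b # \<rho>) * (p (rw (v @ b # \<rho>)) * (p (rw (v @ b # \<rho>)) * tw (b # \<rho>))))"
    using v(1) k(2) Dv by (simp add: tw_sw_prefix tw_sw_prefix' assoc_rule[OF p_Int] inf.absorb2 mult.assoc)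
  finally have e2: "tw v * (dproj v D * (rproj (v @ b # \<rho>) * sw v))
      = p D * (s b * (sw \<rho> * (p (rw (v @ b # \<rho>)) * (tw \<rho> * t b))))"
    using v(1) by (simp add: assoc_rule[OF p_Int] sw_Cons tw_Cons mult.assoc)
  \<comment> \<open>\<open>Z\<close> ends in \<open>t b\<close>, hence is annihilated by
    \<open>s a\<close> on its right for every other letter \<open>a\<close>.\<close>
  define Z where "Z = sw \<rho> * (p (rw (v @ b # \<rho>)) * (tw \<rho> * t b))"
  have main: "K c * (p D - p D * (s b * Z)) = 0" using z unfolding e1 e2 Z_def .
  have "rr D [a] = {}" if "a \<noteq> b" for a
  proof -
    have "Z * s a = 0" using that by (simp add: Z_def mult.assoc t_s_diff)
    then have "K c * (p D * s a) = K c * (p D - p D * (s b * Z)) * s a"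
      by (simp add: left_diff_distrib mult.assoc)
    then have "K c * (p D * s a) = 0" using main by simp
    then have "t a * (K c * (p D * s a)) = 0" by simp
    then have "K c * (p (rw [a]) * p (rr D [a])) = 0"
      using k(2) by (simp add: K_comm' p_s assoc_rule[OF t_s_same])
    then have "K c * p (rr D [a]) = 0"
      using k(2) rset_subset_rword[of rg sg lab D "[a]"] by (simp add: p_Int inf.absorb2)
    then show ?thesis using faith[of "rr D [a]" c] c k(2) by simp
  qed
  moreover have "rr D [b] \<noteq> {}"
  proof
    assume "rr D [b] = {}"
    then have "p D * (s b * Z) = 0" using k(2) by (simp add: assoc_rule[OF p_s])
    then show False using main faith[OF k(2), of c] c k(3) by simp
  qed
  ultimately have "out_labels rg sg lab D = {b}" by (auto simp: out_labels_def)
  then show False using out by (simp add: b_def)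
qed

text \<open>Both \<open>sw \<alpha> * tw \<beta>\<close> and its transpose are treated by the same
  \<open>f\<close>, so assuming that \<beta> is the shorter word costs nothing later. If \<alpha>
  does not extend \<beta>, the two cylinders are disjoint and cutting by
  \<open>rproj \<beta>\<close> suffices; otherwise \<open>f\<close> is found by following the stages
  of \<beta>\<delta>\<delta>...\<close>

lemma corner_word:
  assumes len: "length \<beta> < length \<alpha>" and e: "e \<in> idems" "K c * e \<noteq> 0"
  shows "\<exists>f\<in>idems. f * e = f \<and> K c * f \<noteq> 0 \<and> f * (sw \<alpha> * tw \<beta>) * f \<in> core_alg \<and> f * (sw \<beta> * tw \<alpha>) * f \<in> core_alg"
proof (cases "\<exists>\<delta>. \<alpha> = \<beta> @ \<delta>")
  case False
  have ne: "\<beta> \<noteq> []" using False by auto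
  have "\<nexists>\<mu>. \<beta> = \<alpha> @ \<mu>" using len by auto
  then have z: "tw \<beta> * sw \<alpha> = 0" "tw \<alpha> * sw \<beta> = 0" using False tw_sw_diff by blast+
  show ?thesis
  \<comment> \<open>Off the cylinder of \<beta> the factor at \<beta> is annihilated; on it,
    \<open>rproj \<beta>\<close> annihilates the factor at \<alpha>. The side is chosen on which
    \<open>K c\<close> survives.\<close>
  proof (cases "K c * (e * rproj \<beta>) = 0")
    case True
    let ?f = "e - e * rproj \<beta>"
    have "?f * e = ?f" using e(1) by (simp add: left_diff_distrib idems_idem mult.assoc rproj_comm assoc_rule[OF idems_idem])
    moreover have "K c * ?f \<noteq> 0" using True e(2) by (simp add: right_diff_distrib)
    moreover have "?f * (sw \<alpha> * tw \<beta>) * ?f = 0" by (simp add: mult.assoc tw_diff_rproj e(1))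
    moreover have "?f * (sw \<beta> * tw \<alpha>) * ?f = 0" by (simp add: assoc_rule[OF sw_diff_rproj] mult.assoc)
    ultimately show ?thesis using idems_rproj_diff[OF e(1) ne] by (metis core_alg.zero)
  next
    case F: False
    let ?f = "e * rproj \<beta>"
    have "?f * e = ?f" using e(1) by (simp add: mult.assoc rproj_comm assoc_rule[OF idems_idem])
    moreover have "?f * (sw \<alpha> * tw \<beta>) * ?f = 0"
      by (simp add: rproj_def mult.assoc assoc_rule[OF z(1)])
    moreover have "?f * (sw \<beta> * tw \<alpha>) * ?f = 0"
    proof -
      have "tw \<alpha> * ?f = 0" using z(2) by (simp add: rproj_comm[OF e(1), symmetric]) (simp add: rproj_def assoc_rule)
      then show ?thesis by (simp add: mult.assoc)
    qed
    ultimately show ?thesis using idems_rproj[OF e(1)] F by (metis core_alg.zero)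
  qed
next
  case True
  then obtain \<delta> where \<alpha>: "\<alpha> = \<beta> @ \<delta>" by blast
  have \<delta>: "\<delta> \<noteq> []" using len \<alpha> by auto
  let ?w = "lasso \<beta> \<delta>"
  show ?thesis
  proof (cases "\<exists>k. K c * (e - e * rproj (?w k)) \<noteq> 0")
    case True
    \<comment> \<open>The first stage whose cylinder misses part of \<open>K c * e\<close>. The
      idempotent will sit on the stage before and off this one, and the element only moves the
      former into the latter.\<close>
    define k where "k = (LEAST k. K c * (e - e * rproj (?w k)) \<noteq> 0)"
    have k: "K c * (e - e * rproj (?w k)) \<noteq> 0" unfolding k_def using True by (rule LeastI_ex)
    have kmin: "K c * (e - e * rproj (?w j)) = 0" if "j < k" for j
      using not_less_Least that unfolding k_def by blast
    have ne: "?w k \<noteq> []" using k by auto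
    show ?thesis
    proof (cases k)
      case 0
      let ?f = "e - e * rproj \<beta>"
      have "?f * e = ?f" using e(1) by (simp add: left_diff_distrib idems_idem mult.assoc rproj_comm assoc_rule[OF idems_idem])
      moreover have "?f * (sw \<alpha> * tw \<beta>) * ?f = 0" by (simp add: mult.assoc tw_diff_rproj e(1))
      moreover have "?f * (sw \<beta> * tw \<alpha>) * ?f = 0" by (simp add: assoc_rule[OF sw_diff_rproj] mult.assoc)
      ultimately show ?thesis using idems_rproj_diff[OF e(1), of \<beta>] 0 k ne by (metis core_alg.zero lasso_0)
    next
      case (Suc j)
      let ?e = "e * rproj (?w j)"
      let ?f = "?e - ?e * rproj (?w k)"
      have eE: "?e \<in> idems" by (rule idems_rproj[OF e(1)])
      have fE: "?f \<in> idems" by (rule idems_rproj_diff[OF eE ne])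
      have "?e * e = ?e" using e(1) by (simp add: mult.assoc rproj_comm assoc_rule[OF idems_idem])
      moreover have fe: "?f = ?e * (1 - rproj (?w k))" "?f = (1 - rproj (?w k)) * ?e"
        using rproj_comm[OF eE] by (simp_all add: left_diff_distrib right_diff_distrib)
      ultimately have "?f * e = ?f" by (simp only: fe(2) mult.assoc)
      moreover have "K c * ?f \<noteq> 0"
      proof -
        \<comment> \<open>Minimality of \<open>k\<close>: multiplied by \<open>c\<close>, nothing of
          \<open>e\<close> is lost by cutting to the previous stage.\<close>
        have "K c * (e - ?e) = 0" using kmin[of j] Suc by simp
        then have a: "K c * ?e = K c * e" by (simp add: right_diff_distrib)
        have "K c * ?f = K c * ?e * (1 - rproj (?w k))" by (subst fe(1)) (simp only: mult.assoc)
        also have "\<dots> = K c * (e - e * rproj (?w k))" by (simp add: a right_diff_distrib mult.assoc)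
        finally show ?thesis using k by simp
      qed
      moreover have "?f * (sw \<alpha> * tw \<beta>) * ?f = 0"
      proof -
        have "rproj (?w j) * ?e = ?e" unfolding rproj_comm[OF eE] by (simp add: mult.assoc rproj_idem)
        then have "rproj (?w j) * ?f = ?f" by (simp only: fe(1) flip: mult.assoc)
        then have "?f * (sw \<alpha> * tw \<beta>) * ?f = ?f * (sw \<alpha> * tw \<beta>) * (rproj (?w j) * ?f)" by simp
        also have "\<dots> = ?f * (sw \<alpha> * (tw \<beta> * sw (?w j))) * (tw (?w j) * ?f)"
          by (simp only: rproj_def mult.assoc)
        also have "?f * (sw \<alpha> * (tw \<beta> * sw (?w j))) = 0"
          unfolding \<alpha> shift_sw using sw_diff_rproj[of ?e "?w k"] by (simp add: Suc flip: mult.assoc)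
        finally show ?thesis by simp
      qed
      moreover have "?f * (sw \<beta> * tw \<alpha>) * ?f = 0"
      proof -
        have "?e * rproj (?w j) = ?e" by (simp add: mult.assoc rproj_idem)
        moreover have "?f * rproj (?w j) = (1 - rproj (?w k)) * (?e * rproj (?w j))"
          by (subst fe(2)) (rule mult.assoc)
        ultimately have "?f * rproj (?w j) = ?f" using fe(2) by simp
        then have "?f * (sw \<beta> * tw \<alpha>) * ?f = ?f * rproj (?w j) * (sw \<beta> * tw \<alpha>) * ?f" by simp
        also have "\<dots> = ?f * sw (?w j) * ((tw (?w j) * (sw \<beta> * tw \<alpha>)) * ?f)"
          by (simp only: rproj_def mult.assoc)
        also have "(tw (?w j) * (sw \<beta> * tw \<alpha>)) * ?f = 0"
          unfolding \<alpha> shift_tw using tw_diff_rproj[OF eE, of "?w k"] by (simp add: Suc mult.assoc)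
        finally show ?thesis by simp
      qed
      ultimately show ?thesis using fE by (metis core_alg.zero)
    qed
  next
    case False
    then have all: "K c * (e * rproj (?w k)) = K c * e" for k by (simp add: right_diff_distrib)
    obtain m where m: "\<And>w. w \<noteq> [] \<Longrightarrow> length w \<ge> m \<Longrightarrow> \<exists>B\<in>BB. tw w * (e * sw w) = p B"
      using idems_compress[OF e(1)] by blast
    \<comment> \<open>Long enough for compression to a single vertex set, and at least 1, so that
      the stage ends in \<delta> and its range lies in that of \<delta>, as a cycle
      requires.\<close>
    define k where "k = Suc m"
    define w where "w = ?w k"
    have w: "w \<noteq> []" "m \<le> length w" using \<delta> length_lasso[OF \<delta>, of k \<beta>] by (auto simp: w_def k_def lasso_Suc)
    obtain B0 where B0: "B0 \<in> BB" "tw w * (e * sw w) = p B0" using m[OF w] by blast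
    define B where "B = B0 \<inter> rw w"
    have B: "B \<in> BB" "B \<subseteq> rw w" using B0 w by (auto simp: B_def)
    have eq: "e * rproj w = dproj w B" using dproj_below[OF e(1) B0] dproj_cut[OF B0(1) w(1)] by (simp add: B_def)
    have gBe: "dproj w B * e = dproj w B"
      unfolding eq[symmetric] using e(1) by (simp add: mult.assoc rproj_comm assoc_rule[OF idems_idem])
    have KgB: "K c * dproj w B \<noteq> 0" using all[of k] e(2) by (simp add: eq flip: w_def)
    then have c: "c \<noteq> 0" and Bne: "B \<noteq> {}" by (auto simp: dproj_def)
    have wSuc: "?w (Suc k) = w @ \<delta>" by (simp add: w_def lasso_Suc)
    show ?thesis
    proof (cases "\<exists>D\<in>BB. D \<subseteq> B \<and> rr D \<delta> \<noteq> D")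
      case True
      then obtain D where D: "D \<in> BB" "D \<subseteq> B" "rr D \<delta> \<noteq> D" by blast
      \<comment> \<open>A set moved by \<delta> yields a set disjoint from its own image. Either
        \<open>D - rr D \<delta>\<close>, whose image stays in \<open>rr D \<delta>\<close>, or, one
        stage further on, \<open>rr D \<delta> - D\<close>, whose image misses
        \<open>rr D \<delta>\<close> by normality.\<close>
      have "\<exists>k' G. ?w k' \<noteq> [] \<and> G \<in> BB \<and> G \<subseteq> rw (?w k') \<and> G \<noteq> {} \<and> dproj (?w k') G * dproj w B = dproj (?w k') G \<and> rr G \<delta> \<inter> G = {}"
      proof (cases "D - rr D \<delta> = {}")
        case False
        let ?G = "D - rr D \<delta>"
        have "rr ?G \<delta> \<subseteq> rr D \<delta>" by (rule rset_mono) auto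
        moreover have "dproj w ?G * dproj w B = dproj w ?G"
          using dproj_prefix_mult(2)[of B ?G w "[]"] B D by (simp add: Int_absorb1 Diff_subset le_infI2 subset_trans[OF Diff_subset])
        ultimately show ?thesis using False B D w
          by (intro exI[of _ k] exI[of _ ?G]) (auto simp flip: w_def)
      next
        case True
        let ?G = "rr D \<delta> - D"
        have G: "?G \<noteq> {}" "?G \<in> BB" using True D by auto
        have sub: "rr D \<delta> \<subseteq> rr B \<delta>" using D rset_mono by metis
        have "rr ?G \<delta> \<inter> rr D \<delta> = {}" using rr_Int[of ?G D \<delta>] D G by (simp add: Int_commute)
        then have "rr ?G \<delta> \<inter> ?G = {}" by auto
        moreover have "dproj (w @ \<delta>) ?G * dproj w B = dproj (w @ \<delta>) ?G"
          using dproj_prefix_mult(2)[of B ?G w \<delta>] B G(2) sub by (simp add: Int_absorb1 subset_trans[OF Diff_subset])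
        moreover have "?G \<subseteq> rw (w @ \<delta>)" using sub B rset_mono[of B "rw w" rg sg lab \<delta>] by (auto simp: rword_append)
        ultimately show ?thesis using G w by (intro exI[of _ "Suc k"] exI[of _ ?G]) (auto simp: wSuc)
      qed
      then obtain k' G where G: "?w k' \<noteq> []" "G \<in> BB" "G \<subseteq> rw (?w k')" "G \<noteq> {}"
        "dproj (?w k') G * dproj w B = dproj (?w k') G" "rr G \<delta> \<inter> G = {}" by blast
      let ?f = "dproj (?w k') G"
      have "?f * e = ?f" using G(5) gBe by (metis mult.assoc)
      moreover have "K c * ?f \<noteq> 0" using faith_dproj[OF c G(2,3,1,4)] .
      moreover have "?f * (sw \<alpha> * tw \<beta>) * ?f = 0" "?f * (sw \<beta> * tw \<alpha>) * ?f = 0"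
        unfolding \<alpha> by (simp_all add: corner_dproj[OF refl G(1-3)] G(6))
      ultimately show ?thesis using idems.gen[OF G(2), of "?w k'"] by (metis core_alg.zero)
    next
      case F: False
      have "rw w \<subseteq> rw \<delta>" using rword_append_subset[of rg sg lab "?w m" \<delta>] by (simp add: w_def k_def lasso_Suc)
      then have cyc: "is_cycle rg sg lab BB \<delta> B"
        using F B Bne \<delta> by (auto simp: is_cycle_def words_iff)
      have "K c * (dproj w B - dproj w B * rproj (w @ \<delta> @ \<delta>)) = 0"
      proof -
        \<comment> \<open>Two stages beyond \<open>w\<close>, matching the double \<delta> in
          \<open>no_exit\<close>.\<close>
        have "K c * (e * rproj (w @ \<delta> @ \<delta>)) = K c * e" using all[of "Suc (Suc k)"] by (simp add: lasso_Suc w_def)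
        then have "rproj w * (K c * (e - e * rproj (w @ \<delta> @ \<delta>))) = 0" by (simp add: right_diff_distrib)
        then have "K c * (rproj w * e - rproj w * e * rproj (w @ \<delta> @ \<delta>)) = 0"
          by (simp add: K_comm' right_diff_distrib mult.assoc)
        then show ?thesis using rproj_comm[OF e(1), of w] eq by simp
      qed
      then have ex: "\<not> has_exit rg sg lab BB \<delta> B" by (rule no_exit[OF c w(1) B \<delta>])
      let ?f = "dproj w B"
      have ww: "w \<in> words rg sg lab" using B Bne by (auto simp: words_iff)
      have rB: "rr B \<delta> \<inter> B = B" using F B by auto
      have "?f * (sw \<alpha> * tw \<beta>) * ?f \<in> core_alg" "?f * (sw \<beta> * tw \<alpha>) * ?f \<in> core_alg"
        unfolding \<alpha> using core_alg.cyc_sw[OF ww cyc ex] core_alg.cyc_tw[OF ww cyc ex]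
        by (simp_all add: corner_dproj[OF w_def w(1) B] rB)
      then show ?thesis using KgB gBe idems.gen[OF B(1)] by blast
    qed
  qed
qed

end

section \<open>Graded spans\<close>

context labelled_rep
begin

lemma kspan_base: "x \<in> X \<Longrightarrow> x \<in> kspan X"
  using kspan.step[of x X 0 1] by (simp add: kspan.zero K_1)

lemma kspan_add: "x \<in> kspan X \<Longrightarrow> y \<in> kspan X \<Longrightarrow> x + y \<in> kspan X"
  by (induction rule: kspan.induct) (auto simp: add.assoc intro: kspan.step)

lemma kspan_scale: "x \<in> kspan X \<Longrightarrow> K c * x \<in> kspan X"
proof (induction rule: kspan.induct)
  case (step x y d)
  then show ?case using kspan.step[of x X "K c * y" "c * d"] by (simp add: distrib_left K_mult mult.assoc)
qed (simp add: kspan.zero)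

lemma kspan_diff: "x \<in> kspan X \<Longrightarrow> y \<in> kspan X \<Longrightarrow> x - y \<in> kspan X"
  using kspan_add[of x X "K (- 1) * y"] kspan_scale[of y X "- 1"] by (simp add: K_minus K_1)

lemma kspan_sum: "(\<And>i. i \<in> I \<Longrightarrow> h i \<in> kspan X) \<Longrightarrow> sum h I \<in> kspan X"
  by (induction I rule: infinite_finite_induct) (auto intro: kspan.zero kspan_add)

lemma kspan_mono: "X \<subseteq> Z \<Longrightarrow> kspan X \<subseteq> kspan Z"
proof
  fix x assume XZ: "X \<subseteq> Z" and "x \<in> kspan X"
  from this(2) show "x \<in> kspan Z" by induction (use XZ in \<open>auto intro: kspan.intros\<close>)
qed

lemma kspan_lmul:
  assumes "y \<in> kspan X" "\<And>x. x \<in> X \<Longrightarrow> a * x \<in> kspan Z" shows "a * y \<in> kspan Z"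
  using assms(1)
  by induction (auto simp: distrib_left K_comm' intro: kspan.zero kspan_add kspan_scale assms(2))

lemma kspan_rmul:
  assumes "y \<in> kspan X" "\<And>x. x \<in> X \<Longrightarrow> x * a \<in> kspan Z" shows "y * a \<in> kspan Z"
  using assms(1)
  by induction (auto simp: distrib_right mult.assoc intro: kspan.zero kspan_add kspan_scale assms(2))

section \<open>Degree shifts under multiplication by generators\<close>

lemma hspan_base:
  "A \<in> BB \<Longrightarrow> int (length \<alpha>) - int (length \<beta>) \<in> D \<Longrightarrow> sw \<alpha> * (p A * tw \<beta>) \<in> hspan D"
  unfolding hspan_def by (rule kspan_base) blast

lemma hspan_zero: "0 \<in> hspan D" by (simp add: hspan_def kspan.zero)

lemma hspan_lmul:
  assumes "y \<in> hspan D"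
    and "\<And>\<alpha> A \<beta>. A \<in> BB \<Longrightarrow> int (length \<alpha>) - int (length \<beta>) \<in> D \<Longrightarrow> a * (sw \<alpha> * (p A * tw \<beta>)) \<in> hspan D'"
  shows "a * y \<in> hspan D'"
  using assms(1) unfolding hspan_def by (rule kspan_lmul) (use assms(2) hspan_def in auto)

lemma hspan_rmul:
  assumes "y \<in> hspan D"
    and "\<And>\<alpha> A \<beta>. A \<in> BB \<Longrightarrow> int (length \<alpha>) - int (length \<beta>) \<in> D \<Longrightarrow> sw \<alpha> * (p A * tw \<beta>) * a \<in> hspan D'"
  shows "y * a \<in> hspan D'"
  using assms(1) unfolding hspan_def by (rule kspan_rmul) (use assms(2) hspan_def in auto)

lemma hspan_s:
  assumes "y \<in> hspan D" shows "s a * y \<in> hspan ((\<lambda>d. d + 1) ` D)"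
  using assms
proof (rule hspan_lmul)
  fix \<alpha> \<beta> :: "'a list" and A assume "A \<in> BB" "int (length \<alpha>) - int (length \<beta>) \<in> D"
  then show "s a * (sw \<alpha> * (p A * tw \<beta>)) \<in> hspan ((\<lambda>d. d + 1) ` D)"
    using hspan_base[of A "a # \<alpha>" \<beta> "(\<lambda>d. d + 1) ` D"] by (force simp: sw_Cons mult.assoc)
qed

text \<open>The letter either cancels the first letter of \<alpha> or, when \<alpha> is empty,
  passes the projection and lengthens \<beta>; both lower the degree by one.\<close>

lemma hspan_t:
  assumes "y \<in> hspan D" shows "t a * y \<in> hspan ((\<lambda>d. d - 1) ` D)"
  using assms
proof (rule hspan_lmul)
  fix \<alpha> \<beta> :: "'a list" and A assume A: "A \<in> BB" and d: "int (length \<alpha>) - int (length \<beta>) \<in> D"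
  let ?D = "(\<lambda>d. d - 1) ` D"
  have d': "int (length \<alpha>) - int (length \<beta>) - 1 \<in> ?D" using d by blast
  have comm: "- 1 - x = - x - 1" for x :: int by simp
  show "t a * (sw \<alpha> * (p A * tw \<beta>)) \<in> hspan ?D"
  proof (cases \<alpha>)
    case Nil
    have "int (length []) - int (length (\<beta> @ [a])) \<in> ?D" using d' Nil by (simp add: comm)
    then show ?thesis
      using hspan_base[of "rr A [a]" "[]" "\<beta> @ [a]" ?D] A Nil by (simp add: tw_append tw_Cons assoc_rule[OF t_p] mult.assoc)
  next
    case (Cons b \<alpha>')
    show ?thesis
    proof (cases "a = b")
      case False
      then show ?thesis by (simp add: Cons sw_Cons mult.assoc assoc_rule[OF t_s_diff] hspan_zero)
    next
      case True
      then have "t a * (sw \<alpha> * (p A * tw \<beta>)) = sw \<alpha>' * (p (rr (rw [a]) \<alpha>' \<inter> A) * tw \<beta>)"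
        using A by (simp add: Cons sw_Cons mult.assoc assoc_rule[OF t_s_same] assoc_rule[OF p_sw] assoc_rule[OF p_Int])
      then show ?thesis using hspan_base[of "rr (rw [a]) \<alpha>' \<inter> A" \<alpha>' \<beta> ?D] A d' by (simp add: Cons)
    qed
  qed
qed

lemma hspan_p:
  assumes "y \<in> hspan D" "B \<in> BB" shows "p B * y \<in> hspan D"
  using assms(1)
proof (rule hspan_lmul)
  fix \<alpha> \<beta> :: "'a list" and A assume A: "A \<in> BB" and d: "int (length \<alpha>) - int (length \<beta>) \<in> D"
  then show "p B * (sw \<alpha> * (p A * tw \<beta>)) \<in> hspan D"
    using assms(2) hspan_base[of "rr B \<alpha> \<inter> A" \<alpha> \<beta> D] by (simp add: assoc_rule[OF p_sw] mult.assoc assoc_rule[OF p_Int])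
qed

lemma hspan_t_right:
  assumes "y \<in> hspan D" shows "y * t a \<in> hspan ((\<lambda>d. d - 1) ` D)"
  using assms
proof (rule hspan_rmul)
  fix \<alpha> \<beta> :: "'a list" and A assume "A \<in> BB" "int (length \<alpha>) - int (length \<beta>) \<in> D"
  then show "sw \<alpha> * (p A * tw \<beta>) * t a \<in> hspan ((\<lambda>d. d - 1) ` D)"
    using hspan_base[of A \<alpha> "a # \<beta>" "(\<lambda>d. d - 1) ` D"] by (force simp: tw_Cons mult.assoc algebra_simps)
qed

lemma hspan_s_right:
  assumes "y \<in> hspan D" shows "y * s a \<in> hspan ((\<lambda>d. d + 1) ` D)"
  using assms
proof (rule hspan_rmul)
  fix \<alpha> \<beta> :: "'a list" and A assume A: "A \<in> BB" and d: "int (length \<alpha>) - int (length \<beta>) \<in> D"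
  let ?D = "(\<lambda>d. d + 1) ` D"
  have d': "int (length \<alpha>) - int (length \<beta>) + 1 \<in> ?D" using d by blast
  show "sw \<alpha> * (p A * tw \<beta>) * s a \<in> hspan ?D"
  proof (cases \<beta>)
    case Nil
    then show ?thesis
      using hspan_base[of "rr A [a]" "\<alpha> @ [a]" "[]" ?D] A d' by (simp add: sw_append sw_Cons p_s mult.assoc add.commute)
  next
    case (Cons b \<beta>')
    show ?thesis
    proof (cases "a = b")
      case False
      then show ?thesis by (simp add: Cons tw_Cons mult.assoc t_s_diff hspan_zero)
    next
      case True
      then have "sw \<alpha> * (p A * tw \<beta>) * s a = sw \<alpha> * (p (A \<inter> rr (rw [a]) \<beta>') * tw \<beta>')"
        using A by (simp add: Cons tw_Cons mult.assoc t_s_same tw_p assoc_rule[OF p_Int])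
      then show ?thesis using hspan_base[of "A \<inter> rr (rw [a]) \<beta>'" \<alpha> \<beta>' ?D] A d' by (simp add: Cons algebra_simps)
    qed
  qed
qed

lemma hspan_p_right:
  assumes "y \<in> hspan D" "B \<in> BB" shows "y * p B \<in> hspan D"
  using assms(1)
proof (rule hspan_rmul)
  fix \<alpha> \<beta> :: "'a list" and A assume A: "A \<in> BB" and d: "int (length \<alpha>) - int (length \<beta>) \<in> D"
  then show "sw \<alpha> * (p A * tw \<beta>) * p B \<in> hspan D"
    using assms(2) hspan_base[of "A \<inter> rr B \<beta>" \<alpha> \<beta> D] by (simp add: tw_p mult.assoc assoc_rule[OF p_Int])
qed

lemma hspan_sw: "y \<in> hspan D \<Longrightarrow> sw \<alpha> * y \<in> hspan ((\<lambda>d. d + int (length \<alpha>)) ` D)"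
proof (induction \<alpha>)
  case (Cons a \<alpha>)
  then show ?case using hspan_s[of "sw \<alpha> * y" _ a] by (force simp: sw_Cons mult.assoc image_image algebra_simps)
qed simp

lemma hspan_tw: "y \<in> hspan D \<Longrightarrow> tw \<alpha> * y \<in> hspan ((\<lambda>d. d - int (length \<alpha>)) ` D)"
proof (induction \<alpha> arbitrary: y D)
  case (Cons a \<alpha>)
  then show ?case using Cons.IH[OF hspan_t[OF Cons.prems, of a]] by (simp add: tw_Cons mult.assoc image_image algebra_simps)
qed simp

lemma hspan_sw_right: "y \<in> hspan D \<Longrightarrow> y * sw \<alpha> \<in> hspan ((\<lambda>d. d + int (length \<alpha>)) ` D)"
proof (induction \<alpha> arbitrary: y D)
  case (Cons a \<alpha>)
  then show ?case using Cons.IH[OF hspan_s_right[OF Cons.prems, of a]] by (simp add: sw_Cons image_image algebra_simps)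
qed simp

lemma hspan_tw_right: "y \<in> hspan D \<Longrightarrow> y * tw \<alpha> \<in> hspan ((\<lambda>d. d - int (length \<alpha>)) ` D)"
proof (induction \<alpha>)
  case (Cons a \<alpha>)
  then show ?case using hspan_t_right[of "y * tw \<alpha>" _ a] by (force simp: tw_Cons mult.assoc image_image algebra_simps)
qed simp

lemma hspan_diff: "x \<in> hspan D \<Longrightarrow> y \<in> hspan D \<Longrightarrow> x - y \<in> hspan D"
  unfolding hspan_def by (rule kspan_diff)

text \<open>In \<open>dproj \<alpha> A\<close> the factor \<open>sw \<alpha>\<close> raises the
  degree by the length of \<alpha> and \<open>tw \<alpha>\<close> lowers it by the same
  amount.\<close>

lemma idems_hspan:
  assumes "e \<in> idems" "y \<in> hspan D" shows "e * y \<in> hspan D" "y * e \<in> hspan D"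
proof -
  have "\<forall>y\<in>hspan D. e * y \<in> hspan D \<and> y * e \<in> hspan D" using assms(1)
  proof induction
    case (gen A \<alpha>)
    show ?case
    proof
      fix y assume y: "y \<in> hspan D"
      have "dproj \<alpha> A * y \<in> hspan D"
        using hspan_sw[OF hspan_p[OF hspan_tw[OF y, of \<alpha>] gen], of \<alpha>] by (simp add: dproj_def mult.assoc image_image)
      moreover have "y * dproj \<alpha> A \<in> hspan D"
        using hspan_tw_right[OF hspan_p_right[OF hspan_sw_right[OF y, of \<alpha>] gen], of \<alpha>] by (simp add: dproj_def mult.assoc image_image)
      ultimately show "dproj \<alpha> A * y \<in> hspan D \<and> y * dproj \<alpha> A \<in> hspan D" by blast
    qed
  next
    case (mult e f)
    then show ?case by (metis mult.assoc)
  next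
    case (diff e f)
    then show ?case by (simp add: left_diff_distrib right_diff_distrib hspan_diff mult.assoc) (simp add: hspan_diff flip: mult.assoc)
  qed
  then show "e * y \<in> hspan D" "y * e \<in> hspan D" using assms(2) by auto
qed

lemma idems_hspan0: "e \<in> idems \<Longrightarrow> e \<in> hspan {0}"
  by (induction rule: idems.induct) (auto simp: dproj_def intro: hspan_base hspan_diff idems_hspan)

text \<open>Terms are collected by degree one at a time. Only existence is claimed; that degree 0
  does not interact with the rest is the separate property \<open>graded\<close>.\<close>

lemma hspan_decompose:
  assumes "x \<in> hspan UNIV"
  shows "\<exists>f N. finite N \<and> (\<forall>n. f n \<in> hspan {n}) \<and> (\<forall>n. n \<notin> N \<longrightarrow> f n = 0) \<and> x = sum f N"
  using assms unfolding hspan_def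
proof (induction rule: kspan.induct)
  case zero
  show ?case by (intro exI[of _ "\<lambda>_. 0"] exI[of _ "{}"]) (simp add: kspan.zero)
next
  case (step x y c)
  then obtain f N where f: "finite N" "\<And>n. f n \<in> hspan {n}" "\<And>n. n \<notin> N \<Longrightarrow> f n = 0" "y = sum f N"
    unfolding hspan_def by blast
  obtain \<alpha> A \<beta> where x: "x = sw \<alpha> * (p A * tw \<beta>)" "A \<in> BB" using step by blast
  define d where "d = int (length \<alpha>) - int (length \<beta>)"
  have "x \<in> hspan {d}" unfolding x by (rule hspan_base) (auto simp: x d_def)
  then have xd: "K c * x + f d \<in> hspan {d}" using f(2)[of d] unfolding hspan_def by (intro kspan_add kspan_scale)
  have sp: "sum f N = f d + sum f (N - {d})"
    using f(1,3) by (cases "d \<in> N") (simp_all add: sum.remove)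
  show ?case
    unfolding hspan_def[symmetric]
  proof (intro exI[of _ "f(d := K c * x + f d)"] exI[of _ "insert d N"] conjI)
    have "sum (f(d := K c * x + f d)) (insert d N) = K c * x + f d + sum (f(d := K c * x + f d)) (N - {d})"
      using f(1) by (simp add: sum.insert_remove)
    also have "sum (f(d := K c * x + f d)) (N - {d}) = sum f (N - {d})" by (rule sum.cong) auto
    finally show "K c * x + y = sum (f(d := K c * x + f d)) (insert d N)" using f(4) sp by (simp add: add.assoc)
    show "\<forall>n. (f(d := K c * x + f d)) n \<in> hspan {n}" using f(2) xd by simp
    show "\<forall>n. n \<notin> insert d N \<longrightarrow> (f(d := K c * x + f d)) n = 0" using f(3) by simp
  qed (simp add: f(1))
qed

lemma hspan_mono: "D \<subseteq> D' \<Longrightarrow> hspan D \<subseteq> hspan D'"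
  unfolding hspan_def by (rule kspan_mono) auto

lemma hspan_component:
  assumes "x \<in> hspan UNIV" "x \<noteq> 0"
  obtains n z y where "x = z + y" "z \<in> hspan {n}" "z \<noteq> 0" "y \<in> hspan (- {n})"
proof -
  obtain f N where f: "finite N" "\<And>n. f n \<in> hspan {n}" "x = sum f N"
    using hspan_decompose[OF assms(1)] by blast
  obtain n where n: "n \<in> N" "f n \<noteq> 0" using assms(2) f(3) by (metis sum.neutral)
  have "sum f (N - {n}) \<in> hspan (- {n})"
    unfolding hspan_def
  proof (rule kspan_sum, fold hspan_def)
    fix i assume "i \<in> N - {n}"
    then have "hspan {i} \<subseteq> hspan (- {n})" by (intro hspan_mono) auto
    then show "f i \<in> hspan (- {n})" using f(2) by blast
  qed
  then show ?thesis using that[of "f n" "sum f (N - {n})" n] n f sum.remove[OF f(1) n(1), of f] by simp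
qed

section \<open>Finite sums of letter projections as local units\<close>

definition letter_proj :: "'a set \<Rightarrow> 'q" where "letter_proj G = (\<Sum>a\<in>G. s a * t a)"

text \<open>The alphabet may be infinite, so only finite sums of the orthogonal projections
  \<open>s a * t a\<close> are available; each fixes whatever starts with one of its
  letters.\<close>

lemma letter_proj_s: "finite G \<Longrightarrow> b \<in> G \<Longrightarrow> letter_proj G * (s b * x) = s b * x"
proof -
  assume G: "finite G" "b \<in> G"
  have "s a * t a * (s b * x) = (if a = b then s b * x else 0)" for a
    using assoc_rule[OF s_t_s[of b]] by (auto simp: mult.assoc assoc_rule[OF t_s_diff])
  then show ?thesis using G by (simp add: letter_proj_def sum_distrib_right)
qed

lemma t_letter_proj: "finite G \<Longrightarrow> b \<in> G \<Longrightarrow> x * t b * letter_proj G = x * t b"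
proof -
  assume G: "finite G" "b \<in> G"
  have "x * t b * (s a * t a) = (if b = a then x * t b else 0)" for a
    using t_s_t[of b] by (auto simp: mult.assoc assoc_rule[OF t_s_diff])
  then show ?thesis using G by (simp add: letter_proj_def sum_distrib_left)
qed

text \<open>The property is asked of every finite set above \<open>F\<close>, so that the finitely
  many sets belonging to the terms of a sum can be merged.\<close>

lemma kspan_support:
  assumes "z \<in> kspan X" "\<And>x. x \<in> X \<Longrightarrow> \<exists>F. finite F \<and> (\<forall>G. finite G \<longrightarrow> F \<subseteq> G \<longrightarrow> Q G x)"
    and "\<And>G. Q G 0" "\<And>G c x y. Q G x \<Longrightarrow> Q G y \<Longrightarrow> Q G (K c * x + y)"
  shows "\<exists>F. finite F \<and> (\<forall>G. finite G \<longrightarrow> F \<subseteq> G \<longrightarrow> Q G z)"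
  using assms(1)
proof induction
  case zero
  then show ?case using assms(3) by blast
next
  case (step x y c)
  then obtain F F' where "finite F" "\<forall>G. finite G \<longrightarrow> F \<subseteq> G \<longrightarrow> Q G y"
    "finite F'" "\<forall>G. finite G \<longrightarrow> F' \<subseteq> G \<longrightarrow> Q G x" using assms(2) by metis
  then show ?case using assms(4) by (intro exI[of _ "F \<union> F'"]) auto
qed

lemma left_support:
  assumes "z \<in> kspan {sw \<alpha> * (p A * tw \<beta>) | \<alpha> A \<beta>. A \<in> BB \<and> Q \<alpha> \<beta>}" "\<And>\<alpha> \<beta>. Q \<alpha> \<beta> \<Longrightarrow> \<alpha> \<noteq> []"
  shows "\<exists>F. finite F \<and> (\<forall>G. finite G \<longrightarrow> F \<subseteq> G \<longrightarrow> letter_proj G * z = z)"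
  using assms(1)
proof (rule kspan_support[where Q = "\<lambda>G z. letter_proj G * z = z"])
  fix x assume "x \<in> {sw \<alpha> * (p A * tw \<beta>) | \<alpha> A \<beta>. A \<in> BB \<and> Q \<alpha> \<beta>}"
  then obtain \<alpha> A \<beta> where x: "x = sw \<alpha> * (p A * tw \<beta>)" "Q \<alpha> \<beta>" by blast
  then obtain b \<alpha>' where "\<alpha> = b # \<alpha>'" using assms(2) by (cases \<alpha>) auto
  then show "\<exists>F. finite F \<and> (\<forall>G. finite G \<longrightarrow> F \<subseteq> G \<longrightarrow> letter_proj G * x = x)"
    by (intro exI[of _ "{b}"]) (auto simp: x sw_Cons mult.assoc letter_proj_s)
qed (auto simp: distrib_left K_comm')

lemma right_support:
  assumes "z \<in> kspan {sw \<alpha> * (p A * tw \<beta>) | \<alpha> A \<beta>. A \<in> BB \<and> Q \<alpha> \<beta>}" "\<And>\<alpha> \<beta>. Q \<alpha> \<beta> \<Longrightarrow> \<beta> \<noteq> []"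
  shows "\<exists>F. finite F \<and> (\<forall>G. finite G \<longrightarrow> F \<subseteq> G \<longrightarrow> z * letter_proj G = z)"
  using assms(1)
proof (rule kspan_support[where Q = "\<lambda>G z. z * letter_proj G = z"])
  fix x assume "x \<in> {sw \<alpha> * (p A * tw \<beta>) | \<alpha> A \<beta>. A \<in> BB \<and> Q \<alpha> \<beta>}"
  then obtain \<alpha> A \<beta> where x: "x = sw \<alpha> * (p A * tw \<beta>)" "Q \<alpha> \<beta>" by blast
  then obtain b \<beta>' where b: "\<beta> = b # \<beta>'" using assms(2) by (cases \<beta>) auto
  have "x = sw \<alpha> * p A * tw \<beta>' * t b" by (simp add: x b tw_Cons mult.assoc)
  then show "\<exists>F. finite F \<and> (\<forall>G. finite G \<longrightarrow> F \<subseteq> G \<longrightarrow> x * letter_proj G = x)"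
    by (intro exI[of _ "{b}"]) (auto simp: t_letter_proj)
qed (auto simp: distrib_right mult.assoc)

section \<open>Corners on which a diagonal element is a scalar\<close>

lemma diag_corner:
  assumes "D \<in> kspan idems" "e \<in> idems" "e * (K r + D) \<noteq> 0"
  shows "\<exists>f\<in>idems. \<exists>r'. f * e = f \<and> f * (K r + D) = K r' * f \<and> K r' * f \<noteq> 0"
  using assms
proof (induction arbitrary: e r rule: kspan.induct)
  case zero
  then show ?case by (intro bexI[of _ e] exI[of _ r]) (auto simp: idems_idem K_comm)
next
  case (step h D c)
  have hh: "h * h = h" using idems_idem step(1) .
  have he: "h * e = e * h" using idems_comm step by blast
  have eid: "e * e = e" using idems_idem step by blast
  show ?case
  \<comment> \<open>On \<open>e * h\<close> the idempotent \<open>h\<close> acts as 1, and its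
    coefficient joins the scalar; on \<open>e - e * h\<close> it acts as 0. The two corners add up
    to the given nonzero one, so one of them is nonzero and has one term fewer.\<close>
  proof (cases "e * h * (K (r + c) + D) = 0")
    case False
    then obtain f r' where f: "f \<in> idems" "f * (e * h) = f" "f * (K (r + c) + D) = K r' * f" "K r' * f \<noteq> 0"
      using step.IH[of "e * h" "r + c"] idems.mult step by blast
    have fe: "f * e = f" by (metis f(2) eid he mult.assoc)
    have fh: "f * h = f" by (metis f(2) hh mult.assoc)
    have "f * (K r + (K c * h + D)) = f * (K (r + c) + D)"
      by (simp add: distrib_left K_comm' K_add K_comm[of f] fh add.assoc)
    then show ?thesis using f fe by metis
  next
    case True
    have "(e - e * h) * (K r + D) = e * (K r + (K c * h + D)) - e * h * (K (r + c) + D)"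
      by (simp add: algebra_simps K_comm' K_comm K_add hh)
    then have "(e - e * h) * (K r + D) \<noteq> 0" using True step.prems by simp
    then obtain f r' where f: "f \<in> idems" "f * (e - e * h) = f" "f * (K r + D) = K r' * f" "K r' * f \<noteq> 0"
      using step.IH[of "e - e * h" r] idems.diff step by blast
    have "(e - e * h) * e = e - e * h" by (simp add: left_diff_distrib eid mult.assoc he assoc_rule)
    then have fe: "f * e = f" by (metis f(2) mult.assoc)
    have "(e - e * h) * h = 0" by (simp add: left_diff_distrib mult.assoc hh)
    then have fh: "f * h = 0" by (metis f(2) mult.assoc mult_zero_right)
    have "f * (K r + (K c * h + D)) = f * (K r + D)"
      by (simp add: distrib_left K_comm' fh)
    then show ?thesis using f fe by metis
  qed
qed

lemma kspan_list:
  assumes "x \<in> kspan X"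
  shows "\<exists>L. snd ` set L \<subseteq> X \<and> x = (\<Sum>(c, h)\<leftarrow>L. K c * h)"
  using assms
proof induction
  case zero
  show ?case by (intro exI[of _ "[]"]) simp
next
  case (step x y c)
  then obtain L where "snd ` set L \<subseteq> X" "y = (\<Sum>(c, h)\<leftarrow>L. K c * h)" by blast
  then show ?case using step by (intro exI[of _ "(c, x) # L"]) simp
qed

text \<open>Without a unit among the idempotents, some \<open>e\<close> that does not annihilate the
  sum must be found. If \<open>h\<close> annihilates it, subtracting \<open>h\<close> times the sum
  changes nothing but removes the term of \<open>h\<close> and replaces each other idempotent
  \<open>k\<close> by \<open>k - k * h\<close>: the list gets shorter.\<close>

lemma diag_nonzero_list:
  assumes "snd ` set L \<subseteq> idems" "(\<Sum>(c, h)\<leftarrow>L. K c * h) \<noteq> 0"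
  shows "\<exists>e\<in>idems. e * (\<Sum>(c, h)\<leftarrow>L. K c * h) \<noteq> 0"
  using assms
proof (induction "length L" arbitrary: L)
  case (Suc n)
  obtain c h L' where L: "L = (c, h) # L'" using Suc(2) by (cases L) auto
  let ?D = "\<Sum>(c, h)\<leftarrow>L. K c * h"
  let ?D' = "\<Sum>(c, h)\<leftarrow>L'. K c * h"
  have h: "h \<in> idems" using Suc.prems L by auto
  show ?case
  proof (cases "h * ?D = 0")
    case True
    define M where "M = map (\<lambda>(c, k). (c, k - k * h)) L'"
    have M: "snd ` set M \<subseteq> idems" "n = length M" using Suc L h by (auto simp: M_def intro!: idems.diff)
    have aux: "(\<Sum>(c, k)\<leftarrow>map (\<lambda>(c, k). (c, k - k * h)) L0. K c * k) = (\<Sum>(c, k)\<leftarrow>L0. K c * k) - h * (\<Sum>(c, k)\<leftarrow>L0. K c * k)"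
      if "snd ` set L0 \<subseteq> idems" for L0 using that
    proof (induction L0)
      case (Cons a L0)
      have "snd a \<in> idems" using Cons.prems by auto
      then have "snd a * h = h * snd a" by (rule idems_comm[OF _ h])
      then show ?case using Cons by (cases a) (simp add: algebra_simps K_comm')
    qed simp
    have "?D = ?D - h * ?D" using True by simp
    also have "\<dots> = ?D' - h * ?D'" by (simp add: L algebra_simps K_comm' idems_idem[OF h])
    also have "\<dots> = (\<Sum>(c, k)\<leftarrow>M. K c * k)" unfolding M_def using Suc.prems L by (subst aux) auto
    finally have "?D = (\<Sum>(c, k)\<leftarrow>M. K c * k)" .
    then show ?thesis using Suc.hyps(1)[OF M(2,1)] Suc.prems(2) by simp
  qed (use h in blast)
qed simp

lemma diag_corner_scalar:
  assumes "D \<in> kspan idems" "D \<noteq> 0"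
  obtains e r where "e \<in> idems" "e * D = K r * e" "K r * e \<noteq> 0"
proof -
  obtain L where "snd ` set L \<subseteq> idems" "D = (\<Sum>(c, h)\<leftarrow>L. K c * h)" using kspan_list[OF assms(1)] by blast
  then obtain e where e: "e \<in> idems" "e * D \<noteq> 0" using diag_nonzero_list assms(2) by blast
  then show ?thesis using diag_corner[OF assms(1) e(1), of 0] that by auto
qed

text \<open>Splits off a diagonal factor that commutes with idempotents and lies in the core, which
  leaves only \<open>sw \<alpha> * tw \<beta>\<close> to be treated.\<close>

lemma T_factor_right: "A \<in> BB \<Longrightarrow> sw \<alpha> * (p A * tw \<beta>) = sw \<alpha> * tw \<beta> * dproj \<beta> A"
proof (cases "\<beta> = []")
  case False
  assume A: "A \<in> BB"
  have "sw \<alpha> * tw \<beta> * dproj \<beta> A = sw \<alpha> * (p (rw \<beta> \<inter> A) * tw \<beta>)"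
    using False A by (simp add: dproj_def mult.assoc assoc_rule[OF tw_sw_same] assoc_rule[OF p_Int])
  also have "\<dots> = sw \<alpha> * (p A * (p (rw \<beta>) * tw \<beta>))"
    using False A by (simp add: assoc_rule[OF p_Int] Int_commute)
  finally show ?thesis using False by (simp add: rw_tw)
qed (simp add: dproj_def)

section \<open>Reduction of an ideal element into the core\<close>

text \<open>The measure for descending from degree 0 to the diagonal: at \<open>m = 0\<close> both
  words are empty, and only combinations of vertex projections are left.\<close>

definition "diag_len m = kspan {sw \<alpha> * (p A * tw \<beta>) | \<alpha> A \<beta>. A \<in> BB \<and> length \<alpha> = length \<beta> \<and> length \<alpha> \<le> m}"

lemma diag_len_mono: "m \<le> n \<Longrightarrow> diag_len m \<subseteq> diag_len n"
  unfolding diag_len_def by (rule kspan_mono) force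

lemma diag_len_base:
  "A \<in> BB \<Longrightarrow> length \<alpha> = length \<beta> \<Longrightarrow> length \<alpha> \<le> m \<Longrightarrow> sw \<alpha> * (p A * tw \<beta>) \<in> diag_len m"
  unfolding diag_len_def
  by (rule kspan_base, rule CollectI, rule exI[of _ \<alpha>], rule exI[of _ A], rule exI[of _ \<beta>]) simp

lemma hspan0_diag_len: "z \<in> hspan {0} \<Longrightarrow> \<exists>m. z \<in> diag_len m"
  unfolding hspan_def
proof (induction rule: kspan.induct)
  case zero
  show ?case by (auto simp: diag_len_def kspan.zero)
next
  case (step x y c)
  then obtain m where m: "y \<in> diag_len m" by blast
  obtain \<alpha> A \<beta> where x: "x = sw \<alpha> * (p A * tw \<beta>)" "A \<in> BB" "length \<alpha> = length \<beta>" using step by auto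
  have "x \<in> diag_len (length \<alpha>)" unfolding x(1) by (rule diag_len_base) (use x in auto)
  then have "x \<in> diag_len (max m (length \<alpha>))" "y \<in> diag_len (max m (length \<alpha>))"
    using m diag_len_mono by (meson max.cobounded1 max.cobounded2 subsetD)+
  then show ?case unfolding diag_len_def by (meson kspan_add kspan_scale)
qed

text \<open>One letter is cancelled on each side. Terms with empty words merely restrict their set
  or vanish, hence a bound on lengths instead of an exact length.\<close>

lemma diag_len_compress:
  assumes "z \<in> diag_len (Suc m)" shows "t a * (z * s b) \<in> diag_len m"
proof -
  have "t a * z * s b \<in> diag_len m" using assms unfolding diag_len_def
  proof (induction rule: kspan.induct)
    case (step x y c)
    obtain \<alpha> A \<beta> where x: "x = sw \<alpha> * (p A * tw \<beta>)" "A \<in> BB" "length \<alpha> = length \<beta>" "length \<alpha> \<le> Suc m"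
      using step(1) by blast
    note base = diag_len_base[where m = m]
    have zero: "0 \<in> diag_len m" by (simp add: diag_len_def kspan.zero)
    have "t a * x * s b \<in> diag_len m"
    proof (cases \<alpha>)
      case Nil
      then have n: "\<alpha> = []" "\<beta> = []" using x by auto
      show ?thesis
      proof (cases "a = b")
        case True
        then have "t a * x * s b = sw [] * (p (rr A [a] \<inter> rw [a]) * tw [])"
          using x(2) by (simp add: x(1) n mult.assoc t_p assoc_rule[OF t_p] t_s_same p_Int)
        then show ?thesis using base[of "rr A [a] \<inter> rw [a]" "[]" "[]"] x(2) by simp
      next
        case False
        then show ?thesis using x(2) zero by (simp add: x(1) n mult.assoc t_p assoc_rule[OF t_p] t_s_diff)
      qed
    next
      case (Cons c \<alpha>')
      then obtain d \<beta>' where \<beta>: "\<beta> = d # \<beta>'" using x by (cases \<beta>) auto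
      show ?thesis
      proof (cases "a = c \<and> b = d")
        case True
        then have "t a * x * s b = sw \<alpha>' * (p (rr (rw [a]) \<alpha>' \<inter> A \<inter> rr (rw [b]) \<beta>') * tw \<beta>')"
          using x(2) by (simp add: x(1) Cons \<beta> sw_Cons tw_Cons mult.assoc t_s_same assoc_rule[OF t_s_same] assoc_rule[OF p_sw]
              assoc_rule[OF p_Int] tw_p)
        then show ?thesis using base[of "rr (rw [a]) \<alpha>' \<inter> A \<inter> rr (rw [b]) \<beta>'" \<alpha>' \<beta>'] x(2-4) Cons \<beta> by simp
      next
        case False
        then have "t a * s c = 0 \<or> t d * s b = 0" using t_s_diff[of c a] t_s_diff[of b d] by auto
        then have "t a * x * s b = 0"
        proof
          assume z: "t a * s c = 0"
          show ?thesis by (simp add: x(1) Cons sw_Cons mult.assoc assoc_rule[OF z])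
        next
          assume "t d * s b = 0"
          then show ?thesis by (simp add: x(1) \<beta> tw_Cons mult.assoc)
        qed
        then show ?thesis using zero by simp
      qed
    qed
    moreover have "t a * (K c * x + y) * s b = K c * (t a * x * s b) + t a * y * s b"
      by (simp add: distrib_left distrib_right K_comm' mult.assoc)
    ultimately show ?case using step(3) unfolding diag_len_def by (simp add: kspan_add kspan_scale)
  qed (simp add: kspan.zero)
  then show ?thesis by (simp add: mult.assoc)
qed

lemma diag_len_split:
  assumes "z \<in> diag_len m"
  shows "\<exists>d z'. z = d + z' \<and> d \<in> kspan (p ` BB) \<and>
    z' \<in> kspan {sw \<alpha> * (p A * tw \<beta>) | \<alpha> A \<beta>. A \<in> BB \<and> (\<alpha> \<noteq> [] \<and> \<beta> \<noteq> [])}"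
  using assms unfolding diag_len_def
proof (induction rule: kspan.induct)
  case zero
  show ?case by (intro exI[of _ 0]) (simp add: kspan.zero)
next
  case (step x y c)
  let ?X = "{sw \<alpha> * (p A * tw \<beta>) | \<alpha> A \<beta>. A \<in> BB \<and> (\<alpha> \<noteq> [] \<and> \<beta> \<noteq> [])}"
  obtain d z' where y: "y = d + z'" "d \<in> kspan (p ` BB)" "z' \<in> kspan ?X" using step by blast
  obtain \<alpha> A \<beta> where x: "x = sw \<alpha> * (p A * tw \<beta>)" "A \<in> BB" "length \<alpha> = length \<beta>" using step by blast
  show ?case
  proof (cases "\<alpha> = []")
    case True
    then have "x \<in> p ` BB" using x by simp
    then have "K c * x + d \<in> kspan (p ` BB)" using y(2) by (rule kspan.step)
    then show ?thesis using y by (intro exI[of _ "K c * x + d"] exI[of _ z']) (simp add: add.assoc)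
  next
    case False
    then have "x \<in> ?X" using x by fastforce
    then have "K c * x + z' \<in> kspan ?X" using y(3) by (rule kspan.step)
    then show ?thesis using y by (intro exI[of _ d] exI[of _ "K c * x + z'"]) (simp add: algebra_simps)
  qed
qed

text \<open>A vertex projection passes between the two letters, so the mixed terms contain
  \<open>t a * s b\<close> with different letters and vanish.\<close>

lemma letter_proj_p_letter_proj: "A \<in> BB \<Longrightarrow> letter_proj G * p A * letter_proj G \<in> kspan idems"
proof -
  assume A: "A \<in> BB"
  have "letter_proj G * p A * letter_proj G = (\<Sum>a\<in>G. \<Sum>b\<in>G. s a * t a * p A * (s b * t b))"
    by (simp add: letter_proj_def sum_distrib_left sum_distrib_right) (rule sum.swap)
  moreover have "s a * t a * p A * (s b * t b) \<in> kspan idems" for a b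
  proof (cases "a = b")
    case True
    then have "s a * t a * p A * (s b * t b) = dproj [a] (rr A [a])"
      using A by (simp add: dproj_def sw_Cons tw_Cons mult.assoc assoc_rule[OF t_p] assoc_rule[OF t_s_same] rw_t)
    then show ?thesis using A by (auto intro: kspan_base idems.gen)
  next
    case False
    then have "s a * t a * p A * (s b * t b) = 0"
      using A by (simp add: mult.assoc assoc_rule[OF t_p] assoc_rule[OF t_s_diff])
    then show ?thesis by (simp add: kspan.zero)
  qed
  ultimately show ?thesis by (simp add: kspan_sum)
qed

end

text \<open>The ring is larger than the algebra it contains, so \<open>J\<close> is required to
  absorb the generators only.\<close>

locale labelled_ideal = labelled_graded_rep +
  fixes J
  assumes J_diff: "x \<in> J \<Longrightarrow> y \<in> J \<Longrightarrow> x - y \<in> J"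
    and J_s: "x \<in> J \<Longrightarrow> s a * x \<in> J" "x \<in> J \<Longrightarrow> x * s a \<in> J"
    and J_t: "x \<in> J \<Longrightarrow> t a * x \<in> J" "x \<in> J \<Longrightarrow> x * t a \<in> J"
    and J_p: "A \<in> BB \<Longrightarrow> x \<in> J \<Longrightarrow> p A * x \<in> J" "A \<in> BB \<Longrightarrow> x \<in> J \<Longrightarrow> x * p A \<in> J"
begin

lemma J_sw: "x \<in> J \<Longrightarrow> sw \<alpha> * x \<in> J" "x \<in> J \<Longrightarrow> x * sw \<alpha> \<in> J"
proof (induction \<alpha> arbitrary: x)
  case (Cons a \<alpha>)
  { case 1 then show ?case using Cons by (simp add: sw_Cons mult.assoc J_s) }
  { case 2 then show ?case using Cons by (simp add: sw_Cons J_s flip: mult.assoc) }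
qed simp_all

lemma J_tw: "x \<in> J \<Longrightarrow> tw \<alpha> * x \<in> J" "x \<in> J \<Longrightarrow> x * tw \<alpha> \<in> J"
proof (induction \<alpha> arbitrary: x)
  case (Cons a \<alpha>)
  { case 1 then show ?case using Cons by (simp add: tw_Cons mult.assoc J_t) }
  { case 2 then show ?case using Cons by (simp add: tw_Cons J_t flip: mult.assoc) }
qed simp_all

lemma J_idems:
  assumes "e \<in> idems" shows "x \<in> J \<Longrightarrow> e * x \<in> J" "x \<in> J \<Longrightarrow> x * e \<in> J"
proof -
  have "\<forall>x\<in>J. e * x \<in> J \<and> x * e \<in> J" using assms
  proof induction
    case (gen A \<alpha>)
    have "dproj \<alpha> A * x \<in> J" "x * dproj \<alpha> A \<in> J" if "x \<in> J" for x
      using J_sw(1)[OF J_p(1)[OF gen J_tw(1)[OF that]], of \<alpha> \<alpha>] J_tw(2)[OF J_p(2)[OF gen J_sw(2)[OF that]], of \<alpha> \<alpha>]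
      by (simp_all add: dproj_def mult.assoc)
    then show ?case by blast
  next
    case (mult e f)
    then have "e * (f * x) \<in> J" "x * e * f \<in> J" if "x \<in> J" for x using that by auto
    then show ?case by (simp add: mult.assoc)
  next
    case (diff e f)
    then have "e * x - e * (f * x) \<in> J" "x * e - x * e * f \<in> J" if "x \<in> J" for x using that by (auto intro: J_diff)
    then show ?case by (simp add: left_diff_distrib right_diff_distrib mult.assoc)
  qed
  then show "x \<in> J \<Longrightarrow> e * x \<in> J" "x \<in> J \<Longrightarrow> x * e \<in> J" by auto
qed

text \<open>An element of positive degree begins with letters, so it is the sum of the
  \<open>s a * (t a * z)\<close> over finitely many letters and some \<open>t a * z\<close> is
  nonzero, of degree one less. The shift is injective on degrees, so the other components stay off
  the tracked one.\<close>

lemma shift_pos: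
  assumes "z \<in> hspan {int k}" "z \<noteq> 0" "y \<in> hspan (- {int k})" "z + y \<in> J"
  shows "\<exists>z y. z \<in> hspan {0} \<and> z \<noteq> 0 \<and> y \<in> hspan (- {0}) \<and> z + y \<in> J"
  using assms
proof (induction k arbitrary: z y)
  case 0
  then show ?case by auto
next
  case (Suc k)
  have "z \<in> kspan {sw \<alpha> * (p A * tw \<beta>) | \<alpha> A \<beta>. A \<in> BB \<and> int (length \<alpha>) - int (length \<beta>) \<in> {int (Suc k)}}"
    using Suc.prems(1) by (simp only: hspan_def)
  then have "\<exists>F. finite F \<and> (\<forall>G. finite G \<longrightarrow> F \<subseteq> G \<longrightarrow> letter_proj G * z = z)"
    by (rule left_support) auto
  then obtain F where "finite F" "letter_proj F * z = z" by auto
  then have "(\<Sum>a\<in>F. s a * (t a * z)) \<noteq> 0"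
    using Suc.prems(2) by (simp add: letter_proj_def sum_distrib_right mult.assoc)
  then obtain a where "s a * (t a * z) \<noteq> 0" by (meson sum.neutral)
  then have a: "t a * z \<noteq> 0" by auto
  have "t a * z \<in> hspan {int k}" using hspan_t[OF Suc.prems(1), of a] by simp
  moreover have "(\<lambda>d. d - 1) ` (- {int (Suc k)}) \<subseteq> - {int k}" by auto
  then have "t a * y \<in> hspan (- {int k})" using hspan_t[OF Suc.prems(3), of a] hspan_mono by blast
  moreover have "t a * z + t a * y \<in> J" using J_t(1)[OF Suc.prems(4), of a] by (simp add: distrib_left)
  ultimately show ?case using Suc.IH[of "t a * z" "t a * y"] a by blast
qed

text \<open>Mirror image: an element of negative degree ends in starred letters, which are removed
  from the right.\<close>

lemma shift_neg:
  assumes "z \<in> hspan {- int k}" "z \<noteq> 0" "y \<in> hspan (- {- int k})" "z + y \<in> J"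
  shows "\<exists>z y. z \<in> hspan {0} \<and> z \<noteq> 0 \<and> y \<in> hspan (- {0}) \<and> z + y \<in> J"
  using assms
proof (induction k arbitrary: z y)
  case 0
  then show ?case by auto
next
  case (Suc k)
  have "z \<in> kspan {sw \<alpha> * (p A * tw \<beta>) | \<alpha> A \<beta>. A \<in> BB \<and> int (length \<alpha>) - int (length \<beta>) \<in> {- int (Suc k)}}"
    using Suc.prems(1) by (simp only: hspan_def)
  then have "\<exists>F. finite F \<and> (\<forall>G. finite G \<longrightarrow> F \<subseteq> G \<longrightarrow> z * letter_proj G = z)"
    by (rule right_support) auto
  then obtain F where "finite F" "z * letter_proj F = z" by auto
  then have "(\<Sum>a\<in>F. z * s a * t a) \<noteq> 0"
    using Suc.prems(2) by (simp add: letter_proj_def sum_distrib_left mult.assoc)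
  then obtain a where "z * s a * t a \<noteq> 0" by (meson sum.neutral)
  then have a: "z * s a \<noteq> 0" by auto
  have "z * s a \<in> hspan {- int k}" using hspan_s_right[OF Suc.prems(1), of a] by simp
  moreover have "(\<lambda>d. d + 1) ` (- {- int (Suc k)}) \<subseteq> - {- int k}" by auto
  then have "y * s a \<in> hspan (- {- int k})" using hspan_s_right[OF Suc.prems(3), of a] hspan_mono by blast
  moreover have "z * s a + y * s a \<in> J" using J_s(2)[OF Suc.prems(4), of a] by (simp add: distrib_right)
  ultimately show ?case using Suc.IH[of "z * s a" "y * s a"] a by blast
qed

lemma reach_degree_0:
  assumes "x \<in> J" "x \<in> hspan UNIV" "x \<noteq> 0"
  shows "\<exists>z y. z \<in> hspan {0} \<and> z \<noteq> 0 \<and> y \<in> hspan (- {0}) \<and> z + y \<in> J"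
proof -
  obtain n z y where zy: "x = z + y" "z \<in> hspan {n}" "z \<noteq> 0" "y \<in> hspan (- {n})" using hspan_component[OF assms(2,3)] .
  show ?thesis
  proof (cases "n \<ge> 0")
    case True
    then show ?thesis using shift_pos[of z "nat n" y] zy assms(1) by simp
  next
    case False
    then show ?thesis using shift_neg[of z "nat (- n)" y] zy assms(1) by simp
  qed
qed

text \<open>Strip letters while some \<open>t a * (z * s b)\<close> is nonzero. When all vanish,
  write \<open>z = d + z'\<close> with \<open>d\<close> spanned by vertex projections and
  \<open>z'\<close> having letters on both sides: a large \<open>letter_proj G\<close> fixes
  \<open>z'\<close> on both sides but annihilates \<open>z\<close>, so \<open>z'\<close> is minus
  the corner of \<open>d\<close>, which is diagonal.\<close>

lemma reach_diag:
  assumes "z \<in> diag_len m" "z \<noteq> 0" "y \<in> hspan (- {0})" "z + y \<in> J"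
  shows "\<exists>D y. D \<in> kspan idems \<and> D \<noteq> 0 \<and> y \<in> hspan (- {0}) \<and> D + y \<in> J"
  using assms
proof (induction m arbitrary: z y)
  case 0
  have "diag_len 0 \<subseteq> kspan idems"
    unfolding diag_len_def by (rule kspan_mono) (auto intro: p_idems)
  then show ?case using 0 by blast
next
  case (Suc m)
  show ?case
  proof (cases "\<exists>a b. t a * (z * s b) \<noteq> 0")
    case True
    then obtain a b where ab: "t a * (z * s b) \<noteq> 0" by blast
    have "t a * (y * s b) \<in> hspan (- {0})"
      using hspan_t[OF hspan_s_right[OF Suc.prems(3), of b], of a] by (simp add: image_image)
    moreover have "t a * (z * s b) + t a * (y * s b) \<in> J"
      using J_t(1)[OF J_s(2)[OF Suc.prems(4)], of a b] by (simp add: distrib_left distrib_right)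
    ultimately show ?thesis using Suc.IH diag_len_compress[OF Suc.prems(1)] ab by blast
  next
    case False
    obtain d z' where z: "z = d + z'" "d \<in> kspan (p ` BB)"
      and z': "z' \<in> kspan {sw \<alpha> * (p A * tw \<beta>) | \<alpha> A \<beta>. A \<in> BB \<and> (\<alpha> \<noteq> [] \<and> \<beta> \<noteq> [])}"
      using diag_len_split[OF Suc.prems(1)] by blast
    obtain F where F: "finite F" "\<And>G. finite G \<Longrightarrow> F \<subseteq> G \<Longrightarrow> letter_proj G * z' = z'"
      using left_support[OF z'] by blast
    obtain F' where F': "finite F'" "\<And>G. finite G \<Longrightarrow> F' \<subseteq> G \<Longrightarrow> z' * letter_proj G = z'"
      using right_support[OF z'] by blast
    define G where "G = F \<union> F'"
    have G: "letter_proj G * z' * letter_proj G = z'" using F F' by (simp add: G_def)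
    \<comment> \<open>Every term of the expanded corner contains one of the vanishing stripped
      elements.\<close>
    have "letter_proj G * z * letter_proj G = (\<Sum>a\<in>G. \<Sum>b\<in>G. s b * (t b * (z * s a)) * t a)"
      by (simp add: letter_proj_def sum_distrib_left sum_distrib_right mult.assoc)
    also have "\<dots> = 0" using False by simp
    finally have "z' = - (letter_proj G * d * letter_proj G)" using G by (simp add: z(1) distrib_left distrib_right add_eq_0_iff)
    then have "z = d - letter_proj G * d * letter_proj G" by (simp add: z(1))
    moreover have "d \<in> kspan idems" using z(2) kspan_mono[of "p ` BB" idems] p_idems by blast
    moreover have "letter_proj G * d * letter_proj G \<in> kspan idems"
      using z(2) by induction
        (auto simp: distrib_left distrib_right K_comm' mult.assoc kspan.zero intro!: kspan_add kspan_scale letter_proj_p_letter_proj[unfolded mult.assoc])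
    ultimately have "z \<in> kspan idems" by (simp add: kspan_diff)
    then show ?thesis using Suc.prems by blast
  qed
qed

text \<open>The terms of \<open>y\<close> are treated one after the other with decreasing
  idempotents. Terms already done stay in the core, because
  \<open>f' * y * f' = f' * (f * y * f) * f'\<close> once \<open>f'\<close> lies below
  \<open>f\<close>.\<close>

lemma corner_core:
  assumes "y \<in> hspan (- {0})" "e \<in> idems" "K c * e \<noteq> 0"
  shows "\<exists>f\<in>idems. f * e = f \<and> K c * f \<noteq> 0 \<and> f * y * f \<in> core_alg"
  using assms(1) unfolding hspan_def
proof (induction rule: kspan.induct)
  case zero
  then show ?case using assms by (intro bexI[of _ e]) (auto simp: idems_idem core_alg.zero)
next
  case (step x y d)
  then obtain f where f: "f \<in> idems" "f * e = f" "K c * f \<noteq> 0" "f * y * f \<in> core_alg" by blast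
  obtain \<alpha> A \<beta> where x: "x = sw \<alpha> * (p A * tw \<beta>)" and A: "A \<in> BB" and "length \<alpha> \<noteq> length \<beta>"
    using step by force
  then consider "length \<beta> < length \<alpha>" | "length \<alpha> < length \<beta>" by linarith
  then have "\<exists>f'\<in>idems. f' * f = f' \<and> K c * f' \<noteq> 0 \<and> f' * (sw \<alpha> * tw \<beta>) * f' \<in> core_alg"
    using corner_word[of \<beta> \<alpha> f c] corner_word[of \<alpha> \<beta> f c] f by cases blast+
  then obtain f' where f': "f' \<in> idems" "f' * f = f'" "K c * f' \<noteq> 0" "f' * (sw \<alpha> * tw \<beta>) * f' \<in> core_alg" by blast
  have "f' * x * f' = f' * (sw \<alpha> * tw \<beta>) * (dproj \<beta> A * f')"
    using A by (simp add: x T_factor_right mult.assoc)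
  also have "\<dots> = f' * (sw \<alpha> * tw \<beta>) * f' * dproj \<beta> A"
    unfolding idems_comm[OF idems.gen[OF A] f'(1)] by (simp add: mult.assoc)
  finally have xM: "f' * x * f' \<in> core_alg" using core_alg.mult[OF f'(4) idems_core_alg[OF idems.gen[OF A]]] by simp
  have ff': "f * f' = f'" using idems_comm[OF f(1) f'(1)] f'(2) by simp
  have "f' * y * f' = f' * (f * y * f) * f'"
    by (metis f'(2) ff' mult.assoc)
  then have yM: "f' * y * f' \<in> core_alg" using core_alg.mult[OF core_alg.mult[OF idems_core_alg[OF f'(1)] f(4)] idems_core_alg[OF f'(1)]] by simp
  have "f' * (K d * x + y) * f' = K d * (f' * x * f') + f' * y * f'"
    by (simp add: distrib_left distrib_right K_comm' mult.assoc)
  then have "f' * (K d * x + y) * f' \<in> core_alg" using xM yM by (simp add: core_alg.add core_alg.scale)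
  moreover have "f' * e = f'" by (metis f'(2) f(2) mult.assoc)
  ultimately show ?case using f' by blast
qed

text \<open>The witness is \<open>f * (D + y) * f = K c * f + f * y * f\<close>. Both summands lie
  in the core; the first is nonzero of degree 0 and the second has no such degree, so
  \<open>graded\<close> forbids cancellation.\<close>

theorem core_meets_ideal:
  assumes "x \<in> J" "x \<in> hspan UNIV" "x \<noteq> 0"
  shows "\<exists>y\<in>J. y \<in> core_alg \<and> y \<noteq> 0"
proof -
  obtain z y0 where "z \<in> hspan {0}" "z \<noteq> 0" "y0 \<in> hspan (- {0})" "z + y0 \<in> J"
    using reach_degree_0[OF assms] by blast
  then obtain D y where D: "D \<in> kspan idems" "D \<noteq> 0" and y: "y \<in> hspan (- {0})" and J: "D + y \<in> J"
    using reach_diag hspan0_diag_len by blast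
  obtain e c where e: "e \<in> idems" "e * D = K c * e" "K c * e \<noteq> 0" using diag_corner_scalar[OF D] .
  obtain f where f: "f \<in> idems" "f * e = f" "K c * f \<noteq> 0" "f * y * f \<in> core_alg" using corner_core[OF y e(1,3)] by blast
  have "f * D = f * (e * D)" by (simp add: f(2) flip: mult.assoc)
  also have "\<dots> = K c * f" by (simp add: e(2) K_comm' f(2))
  finally have eq: "f * (D + y) * f = K c * f + f * y * f"
    using idems_idem[OF f(1)] by (simp add: distrib_left distrib_right mult.assoc)
  have "f * (D + y) * f \<in> J" using J J_idems[OF f(1)] by blast
  moreover have "f * (D + y) * f \<in> core_alg" unfolding eq using idems_core_alg[OF f(1)] f(4) by (intro core_alg.add core_alg.scale)
  moreover have "f * (D + y) * f \<noteq> 0"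
  proof
    assume "f * (D + y) * f = 0"
    moreover have "K c * f \<in> hspan {0}" using idems_hspan0[OF f(1)] unfolding hspan_def by (rule kspan_scale)
    moreover have "f * y * f \<in> hspan (- {0})" using idems_hspan[OF f(1)] y by blast
    ultimately show False using graded[of "K c * f" "f * y * f"] f(3) eq by simp
  qed
  ultimately show ?thesis by blast
qed

end

section \<open>Quotients of the free algebra\<close>

text \<open>Unlike \<open>freeF\<close>, this admits the empty word and all generators of the type:
  it describes a unital free algebra.\<close>

definition fin_supp :: "(('v, 'a) gen list \<Rightarrow> 'r::comm_ring_1) \<Rightarrow> bool" where
  "fin_supp f \<longleftrightarrow> finite {w. f w \<noteq> 0}"

lemma fin_supp_fzero [simp]: "fin_supp fzero"
  by (simp add: fin_supp_def fzero_def)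

lemma fin_supp_fmono [simp]: "fin_supp (fmono u)"
  by (simp add: fin_supp_def fmono_def)

lemma fin_supp_fadd [simp]: "fin_supp f \<Longrightarrow> fin_supp g \<Longrightarrow> fin_supp (fadd f g)"
  unfolding fin_supp_def fadd_def
  by (rule finite_subset[of _ "{w. f w \<noteq> 0} \<union> {w. g w \<noteq> 0}"]) auto

lemma fin_supp_fsub [simp]: "fin_supp f \<Longrightarrow> fin_supp g \<Longrightarrow> fin_supp (fsub f g)"
  unfolding fin_supp_def fsub_def
  by (rule finite_subset[of _ "{w. f w \<noteq> 0} \<union> {w. g w \<noteq> 0}"]) auto

lemma fin_supp_fsmul [simp]: "fin_supp f \<Longrightarrow> fin_supp (fsmul c f)"
  unfolding fin_supp_def fsmul_def
  by (rule finite_subset[of _ "{w. f w \<noteq> 0}"]) auto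

lemma fin_supp_fmul [simp]:
  assumes "fin_supp f" "fin_supp g" shows "fin_supp (fmul f g)"
  unfolding fin_supp_def
proof (rule finite_subset)
  show "{w. fmul f g w \<noteq> 0} \<subseteq> (\<lambda>(u, v). u @ v) ` ({w. f w \<noteq> 0} \<times> {w. g w \<noteq> 0})"
  proof
    fix w assume "w \<in> {w. fmul f g w \<noteq> 0}"
    then have "(\<Sum>i\<in>{0..length w}. f (take i w) * g (drop i w)) \<noteq> 0" by (simp add: fmul_def)
    then obtain i where "f (take i w) * g (drop i w) \<noteq> 0" by (meson sum.neutral)
    then have "f (take i w) \<noteq> 0" "g (drop i w) \<noteq> 0" by auto
    then show "w \<in> (\<lambda>(u, v). u @ v) ` ({w. f w \<noteq> 0} \<times> {w. g w \<noteq> 0})"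
      by (intro image_eqI[of _ _ "(take i w, drop i w)"]) auto
  qed
  show "finite ((\<lambda>(u, v). u @ v) ` ({w. f w \<noteq> 0} \<times> {w. g w \<noteq> 0}))"
    using assms by (simp add: fin_supp_def)
qed

lemma fsum_empty [simp]: "fsum h {} = fzero"
  by (simp add: fsum_def fzero_def)

lemma fsum_insert: "finite X \<Longrightarrow> x \<notin> X \<Longrightarrow> fsum h (insert x X) = fadd (h x) (fsum h X)"
  by (simp add: fsum_def fadd_def)

lemma fin_supp_fsum [simp]: "finite X \<Longrightarrow> (\<And>x. x \<in> X \<Longrightarrow> fin_supp (h x)) \<Longrightarrow> fin_supp (fsum h X)"
  by (induction X rule: finite_induct) (simp_all add: fsum_insert)

text \<open>Both sides sum over the cuts of \<open>w\<close> into three pieces; \<open>i\<close> and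
  \<open>j\<close> are the lengths of the first two.\<close>

lemma fmul_assoc: "fmul (fmul f g) h = fmul f (fmul g h)"
proof
  fix w
  let ?\<phi> = "\<lambda>i j. f (take i w) * g (take j (drop i w)) * h (drop (i + j) w)"
  let ?n = "length w"
  have "fmul (fmul f g) h w = (\<Sum>k\<le>?n. \<Sum>i\<le>k. ?\<phi> i (k - i))"
    unfolding fmul_def atLeast0AtMost
  proof (rule sum.cong[OF refl])
    fix k assume "k \<in> {..?n}"
    then have "length (take k w) = k" by simp
    then show "(\<Sum>i\<le>length (take k w). f (take i (take k w)) * g (drop i (take k w))) * h (drop k w)
        = (\<Sum>i\<le>k. ?\<phi> i (k - i))"
      unfolding sum_distrib_right by (intro sum.cong) (auto simp: min_def drop_take)
  qed
  also have "\<dots> = (\<Sum>(i, j)\<in>{(i, j). i + j \<le> ?n}. ?\<phi> i j)"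
    by (rule sum.triangle_reindex_eq[symmetric])
  also have "{(i, j). i + j \<le> ?n} = Sigma {..?n} (\<lambda>i. {..?n - i})" by auto
  also have "(\<Sum>(i, j)\<in>Sigma {..?n} (\<lambda>i. {..?n - i}). ?\<phi> i j) = (\<Sum>i\<le>?n. \<Sum>j\<le>?n - i. ?\<phi> i j)"
    by (simp add: sum.Sigma)
  also have "\<dots> = fmul f (fmul g h) w"
    unfolding fmul_def atLeast0AtMost
    by (intro sum.cong refl) (simp add: sum_distrib_left mult.assoc add.commute)
  finally show "fmul (fmul f g) h w = fmul f (fmul g h) w" .
qed

lemma fmul_add_left: "fmul (fadd f g) h = fadd (fmul f h) (fmul g h)"
  and fmul_add_right: "fmul f (fadd g h) = fadd (fmul f g) (fmul f h)"
  and fmul_sub_left: "fmul (fsub f g) h = fsub (fmul f h) (fmul g h)"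
  and fmul_sub_right: "fmul f (fsub g h) = fsub (fmul f g) (fmul f h)"
  by (auto simp: fmul_def fadd_def fsub_def sum.distrib sum_subtractf algebra_simps)

lemma fmul_smul_left: "fmul (fsmul c f) g = fsmul c (fmul f g)"
  and fmul_smul_right: "fmul f (fsmul c g) = fsmul c (fmul f g)"
  by (auto simp: fmul_def fsmul_def sum_distrib_left algebra_simps)

lemma fmul_zero [simp]: "fmul fzero f = fzero" "fmul f fzero = fzero"
  by (auto simp: fmul_def fzero_def)

lemma fmono_mul:
  "fmul (fmono u) g w = (if take (length u) w = u then g (drop (length u) w) else 0)"
proof -
  have *: "(if take i w = u then 1 else 0) * g (drop i w)
      = (if i = length u then (if take (length u) w = u then g (drop (length u) w) else 0) else 0)"
    if "i \<le> length w" for i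
    using that by (cases "i = length u") auto
  have "fmul (fmono u) g w = (\<Sum>i\<le>length w. if i = length u then (if take (length u) w = u then g (drop (length u) w) else 0) else 0)"
    unfolding fmul_def atLeast0AtMost fmono_def by (rule sum.cong[OF refl], rule *, simp)
  also have "\<dots> = (if length u \<le> length w then (if take (length u) w = u then g (drop (length u) w) else 0) else 0)"
    by simp
  also have "\<dots> = (if take (length u) w = u then g (drop (length u) w) else 0)"
  proof (cases "length u \<le> length w")
    case False
    then have "take (length u) w \<noteq> u" by auto
    then show ?thesis using False by (simp only: if_False)
  qed simp
  finally show ?thesis .
qed

lemma mul_fmono:
  "fmul g (fmono u) w = (if length u \<le> length w \<and> drop (length w - length u) w = u then g (take (length w - length u) w) else 0)"
proof -
  have *: "g (take i w) * (if drop i w = u then 1 else 0) = (if i = length w - length u then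
      (if length u \<le> length w \<and> drop (length w - length u) w = u then g (take i w) else 0) else 0)"
    if "i \<le> length w" for i
    using that by (cases "length u \<le> length w \<and> i = length w - length u") auto
  have "fmul g (fmono u) w = (\<Sum>i\<le>length w. if i = length w - length u then
      (if length u \<le> length w \<and> drop (length w - length u) w = u then g (take i w) else 0) else 0)"
    unfolding fmul_def atLeast0AtMost fmono_def by (rule sum.cong[OF refl], rule *, simp)
  then show ?thesis by (simp only: sum.delta finite_atMost atMost_iff diff_le_self if_True)
qed

lemma fmono_append: "fmono (u @ v) = fmul (fmono u) (fmono v)"
proof
  fix w
  show "fmono (u @ v) w = fmul (fmono u) (fmono v) w"
  proof (cases "take (length u) w = u")
    case True
    then obtain x where "w = u @ x" by (metis append_take_drop_id)
    then show ?thesis by (simp add: fmono_mul) (simp add: fmono_def)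
  next
    case False
    then have "w \<noteq> u @ v" by auto
    then show ?thesis using False by (simp add: fmono_mul) (simp add: fmono_def)
  qed
qed

lemma fmul_one [simp]: "fmul (fmono []) f = f" "fmul f (fmono []) = f"
  by (auto simp: fmono_mul mul_fmono)

definition two_sided :: "(('v, 'a) gen list \<Rightarrow> 'r::comm_ring_1) set \<Rightarrow> bool" where
  "two_sided N \<longleftrightarrow> (\<forall>f\<in>N. fin_supp f) \<and> fzero \<in> N \<and> (\<forall>f\<in>N. \<forall>g\<in>N. fadd f g \<in> N) \<and>
     (\<forall>f g. fin_supp f \<longrightarrow> g \<in> N \<longrightarrow> fmul f g \<in> N \<and> fmul g f \<in> N)"

lemma two_sided_fsmul: "two_sided N \<Longrightarrow> f \<in> N \<Longrightarrow> fsmul c f \<in> N"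
  using fmul_smul_left[of c "fmono []" f] by (metis fin_supp_fmono fin_supp_fsmul fmul_one(1) two_sided_def)

lemma fsub_conv: "fsub f g = fadd f (fsmul (- 1) g)"
  by (simp add: fsub_def fadd_def fsmul_def)

lemma two_sided_fsub: "two_sided N \<Longrightarrow> f \<in> N \<Longrightarrow> g \<in> N \<Longrightarrow> fsub f g \<in> N"
  by (simp add: fsub_conv two_sided_fsmul) (simp add: two_sided_def two_sided_fsmul)

lemma two_sided_sym: "two_sided N \<Longrightarrow> fsub f g \<in> N \<Longrightarrow> fsub g f \<in> N"
  using two_sided_fsmul[of N "fsub f g" "- 1"] by (simp add: fsub_def fsmul_def)

lemma two_sided_trans: "two_sided N \<Longrightarrow> fsub f g \<in> N \<Longrightarrow> fsub g h \<in> N \<Longrightarrow> fsub f h \<in> N"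
proof -
  assume N: "two_sided N" "fsub f g \<in> N" "fsub g h \<in> N"
  have "fadd (fsub f g) (fsub g h) = fsub f h" by (simp add: fadd_def fsub_def)
  then show ?thesis using N by (metis two_sided_def)
qed

text \<open>Being an ideal cannot be expressed in the index type, so \<open>N\<close> runs over all
  sets; at a set that is not a two-sided ideal all finitely supported functions are related and the
  factor is trivial.\<close>

definition qrel :: "((('v, 'a) gen list \<Rightarrow> 'r::comm_ring_1) set \<Rightarrow> ('v, 'a) gen list \<Rightarrow> 'r) \<Rightarrow>
    ((('v, 'a) gen list \<Rightarrow> 'r) set \<Rightarrow> ('v, 'a) gen list \<Rightarrow> 'r) \<Rightarrow> bool" where
  "qrel F G \<longleftrightarrow> (\<forall>N. fin_supp (F N) \<and> fin_supp (G N) \<and> (two_sided N \<longrightarrow> fsub (F N) (G N) \<in> N))"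

lemma qrel_eq: "(\<And>N. fin_supp (F N)) \<Longrightarrow> qrel F F"
  by (auto simp: qrel_def two_sided_def fsub_def simp flip: fzero_def)

lemma part_equivp_qrel: "part_equivp qrel"
proof (rule part_equivpI)
  show "\<exists>F. qrel F F" by (rule exI[of _ "\<lambda>_. fzero"]) (simp add: qrel_eq)
  show "symp qrel" by (auto simp: symp_def qrel_def intro: two_sided_sym)
  show "transp qrel" unfolding transp_def qrel_def by (meson two_sided_trans)
qed

text \<open>A quotient by an ideal that is a term is not a type. All quotients of the free algebra
  are therefore collected in one product ring, indexed by the ideals.\<close>
quotient_type (overloaded) ('v, 'a, 'r) all_quots =
  "(('v, 'a) gen list \<Rightarrow> 'r::comm_ring_1) set \<Rightarrow> ('v, 'a) gen list \<Rightarrow> 'r" / partial: qrel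
  by (rule part_equivp_qrel)

instantiation all_quots :: (type, type, comm_ring_1) ring_1
begin

lift_definition zero_all_quots :: "('a, 'b, 'c) all_quots" is "\<lambda>_. fzero"
  by (simp add: qrel_eq)

lift_definition one_all_quots :: "('a, 'b, 'c) all_quots" is "\<lambda>_. fmono []"
  by (simp add: qrel_eq)

lift_definition plus_all_quots :: "('a, 'b, 'c) all_quots \<Rightarrow> ('a, 'b, 'c) all_quots \<Rightarrow> ('a, 'b, 'c) all_quots"
  is "\<lambda>F G N. fadd (F N) (G N)"
proof -
  fix F F' G G' :: "(('a, 'b) gen list \<Rightarrow> 'c) set \<Rightarrow> ('a, 'b) gen list \<Rightarrow> 'c"
  assume A: "qrel F F'" "qrel G G'"
  have "fsub (fadd (F N) (G N)) (fadd (F' N) (G' N)) = fadd (fsub (F N) (F' N)) (fsub (G N) (G' N))" for N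
    by (simp add: fadd_def fsub_def algebra_simps)
  then show "qrel (\<lambda>N. fadd (F N) (G N)) (\<lambda>N. fadd (F' N) (G' N))"
    using A by (simp add: qrel_def) (simp add: two_sided_def)
qed

lift_definition uminus_all_quots :: "('a, 'b, 'c) all_quots \<Rightarrow> ('a, 'b, 'c) all_quots"
  is "\<lambda>F N. fsmul (- 1) (F N)"
proof -
  fix F F' :: "(('a, 'b) gen list \<Rightarrow> 'c) set \<Rightarrow> ('a, 'b) gen list \<Rightarrow> 'c"
  assume A: "qrel F F'"
  have "fsub (fsmul (- 1) (F N)) (fsmul (- 1) (F' N)) = fsmul (- 1) (fsub (F N) (F' N))" for N
    by (simp add: fsmul_def fsub_def algebra_simps)
  then show "qrel (\<lambda>N. fsmul (- 1) (F N)) (\<lambda>N. fsmul (- 1) (F' N))"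
    using A by (simp add: qrel_def two_sided_fsmul)
qed

lift_definition minus_all_quots :: "('a, 'b, 'c) all_quots \<Rightarrow> ('a, 'b, 'c) all_quots \<Rightarrow> ('a, 'b, 'c) all_quots"
  is "\<lambda>F G N. fsub (F N) (G N)"
proof -
  fix F F' G G' :: "(('a, 'b) gen list \<Rightarrow> 'c) set \<Rightarrow> ('a, 'b) gen list \<Rightarrow> 'c"
  assume A: "qrel F F'" "qrel G G'"
  have "fsub (fsub (F N) (G N)) (fsub (F' N) (G' N)) = fsub (fsub (F N) (F' N)) (fsub (G N) (G' N))" for N
    by (simp add: fsub_def algebra_simps)
  then show "qrel (\<lambda>N. fsub (F N) (G N)) (\<lambda>N. fsub (F' N) (G' N))"
    using A by (simp add: qrel_def two_sided_fsub)
qed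

lift_definition times_all_quots :: "('a, 'b, 'c) all_quots \<Rightarrow> ('a, 'b, 'c) all_quots \<Rightarrow> ('a, 'b, 'c) all_quots"
  is "\<lambda>F G N. fmul (F N) (G N)"
proof -
  fix F F' G G' :: "(('a, 'b) gen list \<Rightarrow> 'c) set \<Rightarrow> ('a, 'b) gen list \<Rightarrow> 'c"
  assume A: "qrel F F'" "qrel G G'"
  have "fsub (fmul (F N) (G N)) (fmul (F' N) (G' N))
      = fadd (fmul (fsub (F N) (F' N)) (G N)) (fmul (F' N) (fsub (G N) (G' N)))" for N
    unfolding fmul_sub_left fmul_sub_right by (simp add: fadd_def fsub_def)
  then show "qrel (\<lambda>N. fmul (F N) (G N)) (\<lambda>N. fmul (F' N) (G' N))"
    using A by (simp add: qrel_def) (simp add: two_sided_def)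
qed

instance
proof
  fix x y z :: "('a, 'b, 'c) all_quots"
  have E: "qrel F G" if "\<And>N. fin_supp (F N)" "F = G" for F G :: "(('a, 'b) gen list \<Rightarrow> 'c) set \<Rightarrow> ('a, 'b) gen list \<Rightarrow> 'c"
    using that by (simp add: qrel_eq)
  show "x * y * z = x * (y * z)"
    by transfer (rule E, auto simp: fmul_assoc qrel_def)
  show "1 * x = x" "x * 1 = x"
    by (transfer, rule E, auto simp: qrel_def)+
  show "x + y + z = x + (y + z)"
    by transfer (rule E, auto simp: qrel_def, auto simp: fadd_def add.assoc)
  show "x + y = y + x"
    by transfer (rule E, auto simp: qrel_def, auto simp: fadd_def add.commute)
  show "0 + x = x"
    by transfer (rule E, auto simp: qrel_def, auto simp: fadd_def fzero_def)
  show "- x + x = 0"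
    by transfer (rule E, auto simp: qrel_def, auto simp: fadd_def fzero_def fsmul_def)
  show "x - y = x + - y"
    by transfer (rule E, auto simp: qrel_def, auto simp: fsub_conv)
  show "(x + y) * z = x * z + y * z"
    by transfer (rule E, auto simp: qrel_def, auto simp: fmul_add_left)
  show "x * (y + z) = x * y + x * z"
    by transfer (rule E, auto simp: qrel_def, auto simp: fmul_add_right)
  show "(0 :: ('a, 'b, 'c) all_quots) \<noteq> 1"
  proof transfer
    \<comment> \<open>The factor at the zero ideal is the free algebra itself, where 0 and 1
      differ.\<close>
    have "two_sided {fzero :: ('a, 'b) gen list \<Rightarrow> 'c}"
      by (simp add: two_sided_def) (simp add: fadd_def fzero_def)
    moreover have "fsub fzero (fmono []) \<noteq> (fzero :: ('a, 'b) gen list \<Rightarrow> 'c)"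
      by (auto simp: fsub_def fzero_def fmono_def fun_eq_iff)
    ultimately show "\<not> qrel (\<lambda>_. fzero :: ('a, 'b) gen list \<Rightarrow> 'c) (\<lambda>_. fmono [])"
      by (auto simp: qrel_def)
  qed
qed

end

lift_definition qscal :: "'r \<Rightarrow> ('v, 'a, 'r::comm_ring_1) all_quots" is "\<lambda>c _. fsmul c (fmono [])"
  by (simp add: qrel_eq)

text \<open>The residue class in the factor at \<open>N\<close> alone. It is additive and
  multiplicative but in general not unital, whereas \<open>qscal\<close> places a scalar in all
  factors at once. The test for finite support keeps the values legal.\<close>

lift_definition qemb :: "(('v, 'a) gen list \<Rightarrow> 'r::comm_ring_1) set \<Rightarrow> (('v, 'a) gen list \<Rightarrow> 'r) \<Rightarrow> ('v, 'a, 'r) all_quots"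
  is "\<lambda>N f M. if M = N \<and> fin_supp f then f else fzero"
  by (simp add: qrel_eq)

lemma qrelI: "(\<And>N. fin_supp (F N)) \<Longrightarrow> F = G \<Longrightarrow> qrel F G"
  by (simp add: qrel_eq)

lemma fzero_simps [simp]:
  "fadd fzero f = f" "fadd f fzero = f" "fsub fzero fzero = fzero" "fsub f f = fzero" "fsub f fzero = f" "fsmul c fzero = fzero"
  by (simp_all add: fadd_def fsub_def fsmul_def fzero_def)

lemma qscal_1: "qscal 1 = 1"
  by transfer (rule qrelI, auto simp: fsmul_def)

lemma qscal_add: "qscal (c + d) = qscal c + qscal d"
  by transfer (rule qrelI, auto, auto simp: fsmul_def fadd_def algebra_simps)

lemma qscal_mult: "qscal (c * d) = qscal c * qscal d"
  by transfer (rule qrelI, auto simp: fmul_smul_left fmul_smul_right, auto simp: fsmul_def mult_ac)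

lemma qscal_comm: "x * qscal c = qscal c * x"
  by transfer (rule qrelI, auto simp: qrel_def fmul_smul_left fmul_smul_right)

lemma qemb_add: "fin_supp f \<Longrightarrow> fin_supp g \<Longrightarrow> qemb N (fadd f g) = qemb N f + qemb N g"
  by transfer (rule qrelI, auto)

lemma qemb_sub: "fin_supp f \<Longrightarrow> fin_supp g \<Longrightarrow> qemb N (fsub f g) = qemb N f - qemb N g"
  by transfer (rule qrelI, auto)

lemma qemb_mul: "fin_supp f \<Longrightarrow> fin_supp g \<Longrightarrow> qemb N (fmul f g) = qemb N f * qemb N g"
  by transfer (rule qrelI, auto)

lemma qemb_smul: "fin_supp f \<Longrightarrow> qemb N (fsmul c f) = qscal c * qemb N f"
  by transfer (rule qrelI, auto simp: fmul_smul_left)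

lemma qemb_eq_0: "two_sided N \<Longrightarrow> fin_supp f \<Longrightarrow> qemb N f = 0 \<longleftrightarrow> f \<in> N"
  by transfer (auto simp: qrel_def, auto simp: two_sided_def)

section \<open>Evaluation and grading\<close>

lemma freeF_fin_supp: "f \<in> freeF lab BB \<Longrightarrow> fin_supp f"
  by (simp add: freeF_def fin_supp_def)

lemma freeF_fzero [simp]: "fzero \<in> freeF lab BB"
  by (simp add: freeF_def fzero_def)

lemma freeF_fmono [simp]: "fmono w \<in> freeF lab BB \<longleftrightarrow> w \<noteq> [] \<and> (\<forall>g\<in>set w. valid_gen lab BB g)"
  by (auto simp: freeF_def fmono_def)

lemma freeF_fadd [simp]: "f \<in> freeF lab BB \<Longrightarrow> g \<in> freeF lab BB \<Longrightarrow> fadd f g \<in> freeF lab BB"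
  using fin_supp_fadd[of f g] by (auto simp: freeF_def fin_supp_def fadd_def) (metis add_0)

lemma freeF_fsmul [simp]: "f \<in> freeF lab BB \<Longrightarrow> fsmul c f \<in> freeF lab BB"
  using fin_supp_fsmul[of f c] by (auto simp: freeF_def fin_supp_def fsmul_def) (metis mult_zero_right)

lemma freeF_fsub [simp]: "f \<in> freeF lab BB \<Longrightarrow> g \<in> freeF lab BB \<Longrightarrow> fsub f g \<in> freeF lab BB"
  by (simp add: fsub_conv)

lemma fmul_nonzero:
  assumes "fmul f g w \<noteq> 0"
  obtains u v where "w = u @ v" "f u \<noteq> 0" "g v \<noteq> 0"
proof -
  have "(\<Sum>i\<in>{0..length w}. f (take i w) * g (drop i w)) \<noteq> 0" using assms by (simp add: fmul_def)
  then obtain i where "f (take i w) * g (drop i w) \<noteq> 0" by (meson sum.neutral)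
  then have "f (take i w) \<noteq> 0" "g (drop i w) \<noteq> 0" by auto
  then show ?thesis using that[of "take i w" "drop i w"] by simp
qed

lemma freeF_fmul [simp]:
  assumes "f \<in> freeF lab BB" "g \<in> freeF lab BB" shows "fmul f g \<in> freeF lab BB"
proof -
  have "fmul f g [] = 0" using assms by (simp add: fmul_def freeF_def)
  moreover have "finite {w. fmul f g w \<noteq> 0}"
    using fin_supp_fmul[of f g] assms by (simp add: freeF_def fin_supp_def)
  moreover have "\<forall>x\<in>set w. valid_gen lab BB x" if nz: "fmul f g w \<noteq> 0" for w
  proof -
    obtain u v where "w = u @ v" "f u \<noteq> 0" "g v \<noteq> 0" using fmul_nonzero[OF nz] .
    then show ?thesis using assms by (auto simp: freeF_def)
  qed
  ultimately show ?thesis by (auto simp: freeF_def)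
qed

lemma freeF_fsum [simp]: "finite X \<Longrightarrow> (\<And>x. x \<in> X \<Longrightarrow> h x \<in> freeF lab BB) \<Longrightarrow> fsum h X \<in> freeF lab BB"
  by (induction X rule: finite_induct) (simp_all add: fsum_insert)

text \<open>Reduces multiplication by an arbitrary element, as it occurs in the rules of
  \<open>gen_ideal\<close>, to multiplication by words.\<close>

lemma freeF_induct [consumes 1, case_names zero step]:
  fixes Q :: "(('v, 'a) gen list \<Rightarrow> 'r::comm_ring_1) \<Rightarrow> bool"
  assumes "f \<in> freeF lab BB" and z: "Q fzero"
    and s: "\<And>c w g. w \<noteq> [] \<Longrightarrow> (\<forall>x\<in>set w. valid_gen lab BB x) \<Longrightarrow> g \<in> freeF lab BB \<Longrightarrow> Q g \<Longrightarrow>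
      Q (fadd (fsmul c (fmono w)) g)"
  shows "Q f"
proof -
  have "\<forall>f\<in>freeF lab BB. {w. f w \<noteq> 0} \<subseteq> W \<longrightarrow> Q f" if "finite W" for W
    using that
  proof induction
    case empty
    have "f = fzero" if "{w. f w \<noteq> 0} \<subseteq> {}" for f :: "('v, 'a) gen list \<Rightarrow> 'r" using that by (auto simp: fzero_def)
    then show ?case using z by blast
  next
    case (insert w W)
    show ?case
    proof (intro ballI impI)
      fix f :: "('v, 'a) gen list \<Rightarrow> 'r" assume f: "f \<in> freeF lab BB" "{w. f w \<noteq> 0} \<subseteq> insert w W"
      show "Q f"
      proof (cases "f w = 0")
        case True
        then show ?thesis using f insert by auto
      next
        case False
        define g where "g = f(w := 0)"
        have "{v. g v \<noteq> 0} \<subseteq> {v. f v \<noteq> 0}" by (auto simp: g_def)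
        then have "finite {v. g v \<noteq> 0}" by (rule finite_subset) (use f(1) in \<open>simp add: freeF_def\<close>)
        moreover have "g v \<noteq> 0 \<Longrightarrow> f v \<noteq> 0" for v by (auto simp: g_def split: if_splits)
        ultimately have g: "g \<in> freeF lab BB" using f(1) by (auto simp: freeF_def g_def)
        have "{w. g w \<noteq> 0} \<subseteq> W" using f(2) by (auto simp: g_def)
        then have "Q g" using insert.IH g by blast
        moreover have "f = fadd (fsmul (f w) (fmono w)) g"
          by (auto simp: fadd_def fsmul_def fmono_def g_def)
        moreover have "w \<noteq> []" "\<forall>x\<in>set w. valid_gen lab BB x" using f(1) False by (auto simp: freeF_def)
        ultimately show ?thesis using s g by metis
      qed
    qed
  qed
  then show ?thesis using assms(1) by (auto simp: freeF_def)
qed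

text \<open>The linear extension of \<open>H\<close> from words to the free algebra.\<close>

definition ev :: "(('v, 'a) gen list \<Rightarrow> 'r::comm_ring_1) \<Rightarrow> (('v, 'a) gen list \<Rightarrow> 'r) \<Rightarrow> 'r" where
  "ev H f = (\<Sum>w | f w \<noteq> 0. f w * H w)"

lemma ev_superset: "finite W \<Longrightarrow> {w. f w \<noteq> 0} \<subseteq> W \<Longrightarrow> ev H f = (\<Sum>w\<in>W. f w * H w)"
  unfolding ev_def by (rule sum.mono_neutral_left) auto

lemma ev_fadd:
  assumes "fin_supp f" "fin_supp g" shows "ev H (fadd f g) = ev H f + ev H g"
proof -
  let ?W = "{w. f w \<noteq> 0} \<union> {w. g w \<noteq> 0}"
  have W: "finite ?W" using assms by (simp add: fin_supp_def)
  have "ev H (fadd f g) = (\<Sum>w\<in>?W. fadd f g w * H w)" by (rule ev_superset[OF W]) (auto simp: fadd_def)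
  moreover have "ev H f = (\<Sum>w\<in>?W. f w * H w)" by (rule ev_superset[OF W]) auto
  moreover have "ev H g = (\<Sum>w\<in>?W. g w * H w)" by (rule ev_superset[OF W]) auto
  ultimately show ?thesis by (simp add: fadd_def distrib_right sum.distrib)
qed

lemma ev_fsmul:
  assumes "fin_supp f" shows "ev H (fsmul c f) = c * ev H f"
proof -
  have "ev H (fsmul c f) = (\<Sum>w | f w \<noteq> 0. fsmul c f w * H w)"
    by (rule ev_superset) (use assms in \<open>auto simp: fin_supp_def fsmul_def\<close>)
  then show ?thesis by (simp add: ev_def fsmul_def sum_distrib_left mult.assoc)
qed

lemma ev_fsub: "fin_supp f \<Longrightarrow> fin_supp g \<Longrightarrow> ev H (fsub f g) = ev H f - ev H g"
  by (simp add: fsub_conv ev_fadd ev_fsmul)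

lemma ev_fzero [simp]: "ev H fzero = 0"
  by (simp add: ev_def fzero_def)

lemma ev_fmono [simp]: "ev H (fmono w) = H w"
  using ev_superset[of "{w}" "fmono w" H] by (simp add: fmono_def)

lemma ev_fsum: "finite X \<Longrightarrow> (\<And>x. x \<in> X \<Longrightarrow> fin_supp (h x)) \<Longrightarrow> ev H (fsum h X) = (\<Sum>x\<in>X. ev H (h x))"
  by (induction X rule: finite_induct) (simp_all add: fsum_insert ev_fadd)

lemma ev_fmono_mul:
  assumes "fin_supp g" shows "ev H (fmul (fmono u) g) = ev (\<lambda>w. H (u @ w)) g"
proof -
  have "ev H (fmul (fmono u) g) = (\<Sum>w\<in>(@) u ` {w. g w \<noteq> 0}. fmul (fmono u) g w * H w)"
  proof (rule ev_superset)
    show "{w. fmul (fmono u) g w \<noteq> 0} \<subseteq> (@) u ` {w. g w \<noteq> 0}"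
    proof
      fix w assume "w \<in> {w. fmul (fmono u) g w \<noteq> 0}"
      then have "fmul (fmono u) g w \<noteq> 0" by simp
      then obtain u' v where "w = u' @ v" "fmono u u' \<noteq> (0::'c)" "g v \<noteq> 0" by (rule fmul_nonzero)
      then show "w \<in> (@) u ` {w. g w \<noteq> 0}" by (auto simp: fmono_def split: if_splits)
    qed
  qed (use assms in \<open>simp add: fin_supp_def\<close>)
  also have "\<dots> = (\<Sum>w | g w \<noteq> 0. g w * H (u @ w))"
    by (subst sum.reindex) (auto simp: inj_on_def fmono_mul)
  finally show ?thesis by (simp add: ev_def)
qed

lemma ev_mul_fmono:
  assumes "fin_supp g" shows "ev H (fmul g (fmono u)) = ev (\<lambda>w. H (w @ u)) g"
proof -
  have "ev H (fmul g (fmono u)) = (\<Sum>w\<in>(\<lambda>w. w @ u) ` {w. g w \<noteq> 0}. fmul g (fmono u) w * H w)"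
  proof (rule ev_superset)
    show "{w. fmul g (fmono u) w \<noteq> 0} \<subseteq> (\<lambda>w. w @ u) ` {w. g w \<noteq> 0}"
    proof
      fix w assume "w \<in> {w. fmul g (fmono u) w \<noteq> 0}"
      then have "fmul g (fmono u) w \<noteq> 0" by simp
      then obtain v u' where "w = v @ u'" "g v \<noteq> 0" "fmono u u' \<noteq> (0::'c)" by (rule fmul_nonzero)
      then show "w \<in> (\<lambda>w. w @ u) ` {w. g w \<noteq> 0}" by (auto simp: fmono_def split: if_splits)
    qed
  qed (use assms in \<open>simp add: fin_supp_def\<close>)
  also have "\<dots> = (\<Sum>w | g w \<noteq> 0. g w * H (w @ u))"
    by (subst sum.reindex) (auto simp: inj_on_def mul_fmono)
  finally show ?thesis by (simp add: ev_def)
qed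

section \<open>The integer grading of the free algebra and of its ideals\<close>

fun gdeg :: "('v, 'a) gen \<Rightarrow> int" where
  "gdeg (P A) = 0"
| "gdeg (S a) = 1"
| "gdeg (Sst a) = - 1"

definition wdeg :: "('v, 'a) gen list \<Rightarrow> int" where
  "wdeg w = sum_list (map gdeg w)"

lemma wdeg_simps [simp]: "wdeg [] = 0" "wdeg (x # w) = gdeg x + wdeg w" "wdeg (u @ v) = wdeg u + wdeg v"
  by (simp_all add: wdeg_def)

definition hcomp :: "int \<Rightarrow> (('v, 'a) gen list \<Rightarrow> 'r::comm_ring_1) \<Rightarrow> ('v, 'a) gen list \<Rightarrow> 'r" where
  "hcomp n f = (\<lambda>w. if wdeg w = n then f w else 0)"

definition homog :: "int \<Rightarrow> (('v, 'a) gen list \<Rightarrow> 'r::comm_ring_1) \<Rightarrow> bool" where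
  "homog n f \<longleftrightarrow> (\<forall>w. f w \<noteq> 0 \<longrightarrow> wdeg w = n)"

lemma hcomp_homog: "homog m f \<Longrightarrow> hcomp n f = (if n = m then f else fzero)"
  by (auto simp: hcomp_def homog_def fzero_def fun_eq_iff)

lemma homog_fmono: "wdeg w = n \<Longrightarrow> homog n (fmono w)"
  by (simp add: homog_def fmono_def)

lemma homog_fadd: "homog n f \<Longrightarrow> homog n g \<Longrightarrow> homog n (fadd f g)"
  by (auto simp: homog_def fadd_def) (metis add_0)

lemma homog_fsub: "homog n f \<Longrightarrow> homog n g \<Longrightarrow> homog n (fsub f g)"
  by (auto simp: homog_def fsub_def) (metis diff_0_right)

lemma homog_fsum: "(\<And>x. x \<in> X \<Longrightarrow> homog n (h x)) \<Longrightarrow> homog n (fsum h X)"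
  unfolding homog_def fsum_def by (meson sum.neutral)

lemma hcomp_fadd: "hcomp n (fadd f g) = fadd (hcomp n f) (hcomp n g)"
  and hcomp_fsmul: "hcomp n (fsmul c f) = fsmul c (hcomp n f)"
  and hcomp_fzero: "hcomp n fzero = fzero"
  by (auto simp: hcomp_def fadd_def fsmul_def fzero_def)

lemma hcomp_fmono_mul: "hcomp n (fmul (fmono u) g) = fmul (fmono u) (hcomp (n - wdeg u) g)"
proof
  fix w
  show "hcomp n (fmul (fmono u) g) w = fmul (fmono u) (hcomp (n - wdeg u) g) w"
  proof (cases "take (length u) w = u")
    case True
    then obtain v where "w = u @ v" by (metis append_take_drop_id)
    then show ?thesis by (auto simp: hcomp_def fmono_mul)
  qed (simp add: hcomp_def fmono_mul)
qed

lemma hcomp_mul_fmono: "hcomp n (fmul g (fmono u)) = fmul (hcomp (n - wdeg u) g) (fmono u)"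
proof
  fix w
  show "hcomp n (fmul g (fmono u)) w = fmul (hcomp (n - wdeg u) g) (fmono u) w"
  proof (cases "length u \<le> length w \<and> drop (length w - length u) w = u")
    case True
    then obtain v where "w = v @ u" by (metis append_take_drop_id)
    then show ?thesis by (auto simp: hcomp_def mul_fmono)
  qed (auto simp: hcomp_def mul_fmono)
qed

text \<open>An ideal with homogeneous generators is graded: multiplying by a word shifts components
  by its degree, and general factors are sums of words.\<close>

lemma gen_ideal_hcomp:
  assumes "x \<in> gen_ideal (freeF lab BB) X" "\<And>y. y \<in> X \<Longrightarrow> \<exists>m. homog m y"
  shows "hcomp n x \<in> gen_ideal (freeF lab BB) X"
  using assms(1)
proof (induction arbitrary: n)
  case (base x)
  then obtain m where "homog m x" using assms(2) by blast
  then show ?case using base by (simp add: hcomp_homog gen_ideal.base gen_ideal.zero)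
next
  case (lmul f x)
  from lmul(1) show ?case
  proof (induction arbitrary: n rule: freeF_induct)
    case (step c w g)
    have "fmul (fmono w) (hcomp (n - wdeg w) x) \<in> gen_ideal (freeF lab BB) X"
      using step lmul.IH by (intro gen_ideal.lmul) auto
    then show ?case using step
      by (simp add: fmul_add_left fmul_smul_left hcomp_fadd hcomp_fsmul hcomp_fmono_mul gen_ideal.add gen_ideal.smul)
  qed (simp add: hcomp_fzero gen_ideal.zero)
next
  case (rmul f x)
  from rmul(1) show ?case
  proof (induction arbitrary: n rule: freeF_induct)
    case (step c w g)
    have "fmul (hcomp (n - wdeg w) x) (fmono w) \<in> gen_ideal (freeF lab BB) X"
      using step rmul.IH by (intro gen_ideal.rmul) auto
    then show ?case using step
      by (simp add: fmul_add_right fmul_smul_right hcomp_fadd hcomp_fsmul hcomp_mul_fmono gen_ideal.add gen_ideal.smul)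
  qed (simp add: hcomp_fzero gen_ideal.zero)
qed (simp_all add: hcomp_fadd hcomp_fsmul hcomp_fzero gen_ideal.zero gen_ideal.add gen_ideal.smul)

lemma homog_ex:
  "\<exists>m. homog m (fmono u)" "wdeg u = wdeg v \<Longrightarrow> \<exists>m. homog m (fsub (fmono u) (fmono v))"
  by (auto intro: homog_fsub homog_fmono)

lemma lpa_rels_homog: "x \<in> lpa_rels rg sg lab BB \<Longrightarrow> \<exists>m. homog m x"
  unfolding lpa_rels_def fmono_append[symmetric]
proof (elim UnE)
  assume "x \<in> (\<Union>A\<in>BB. \<Union>B\<in>BB. {fsub (pA (A \<inter> B)) (fmono ([P A] @ [P B])),
      fsub (pA (A \<union> B)) (fsub (fadd (pA A) (pA B)) (pA (A \<inter> B)))})"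
  then show ?thesis by (auto intro!: homog_ex exI[of _ 0] homog_fsub homog_fadd homog_fmono)
next
  assume "x \<in> {fsub (pA A) (fsum (\<lambda>a. fmono ([S a] @ [P (rset rg sg lab A [a])] @ [Sst a])) (out_labels rg sg lab A)) |
      A. A \<in> Breg rg sg lab BB}"
  then show ?thesis by (auto intro!: exI[of _ 0] homog_fsub homog_fsum homog_fmono)
qed (auto intro!: homog_ex)

section \<open>Boundary path representation\<close>

context normal_space
begin

definition prime0 :: "'v set set \<Rightarrow> bool" where
  "prime0 \<xi> \<longleftrightarrow> \<xi> \<subseteq> BB \<and> {} \<notin> \<xi> \<and> (\<forall>A\<in>\<xi>. \<forall>B\<in>\<xi>. A \<inter> B \<in> \<xi>) \<and>
     (\<forall>A\<in>\<xi>. \<forall>B\<in>BB. A \<subseteq> B \<longrightarrow> B \<in> \<xi>) \<and> (\<forall>A\<in>BB. \<forall>B\<in>BB. A \<union> B \<in> \<xi> \<longrightarrow> A \<in> \<xi> \<or> B \<in> \<xi>)"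

lemma prime0_D:
  assumes "prime0 \<xi>"
  shows "A \<in> \<xi> \<Longrightarrow> A \<in> BB" "A \<in> \<xi> \<Longrightarrow> A \<noteq> {}" "A \<in> \<xi> \<Longrightarrow> B \<in> \<xi> \<Longrightarrow> A \<inter> B \<in> \<xi>"
    "A \<in> \<xi> \<Longrightarrow> B \<in> BB \<Longrightarrow> A \<subseteq> B \<Longrightarrow> B \<in> \<xi>"
    "A \<in> BB \<Longrightarrow> B \<in> BB \<Longrightarrow> A \<union> B \<in> \<xi> \<Longrightarrow> A \<in> \<xi> \<or> B \<in> \<xi>"
  using assms unfolding prime0_def by blast+

text \<open>The ultrafilter lemma for a Boolean ring of sets that may lack a largest member: a
  maximal proper filter above \<open>G\<close> is prime.\<close>

lemma prime_extension:
  assumes G: "G \<subseteq> BB" "G \<noteq> {}" "{} \<notin> G" "\<And>A B. A \<in> G \<Longrightarrow> B \<in> G \<Longrightarrow> A \<inter> B \<in> G"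
  shows "\<exists>\<xi>. prime0 \<xi> \<and> G \<subseteq> \<xi>"
proof -
  define pf where "pf F \<longleftrightarrow> F \<subseteq> BB \<and> {} \<notin> F \<and> (\<forall>A\<in>F. \<forall>B\<in>F. A \<inter> B \<in> F) \<and>
     (\<forall>A\<in>F. \<forall>B\<in>BB. A \<subseteq> B \<longrightarrow> B \<in> F)" for F
  have up: "pf {B \<in> BB. \<exists>A\<in>H. A \<subseteq> B}"
    if "H \<subseteq> BB" "{} \<notin> H" "\<And>A B. A \<in> H \<Longrightarrow> B \<in> H \<Longrightarrow> A \<inter> B \<in> H" for H
    unfolding pf_def
  proof (intro conjI ballI impI)
    fix A B assume "A \<in> {B \<in> BB. \<exists>A\<in>H. A \<subseteq> B}" "B \<in> {B \<in> BB. \<exists>A\<in>H. A \<subseteq> B}"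
    then obtain A' B' where "A \<in> BB" "B \<in> BB" "A' \<in> H" "B' \<in> H" "A' \<subseteq> A" "B' \<subseteq> B" by blast
    moreover from this have "A' \<inter> B' \<in> H" "A' \<inter> B' \<subseteq> A \<inter> B" using that(3) by auto
    ultimately show "A \<inter> B \<in> {B \<in> BB. \<exists>A\<in>H. A \<subseteq> B}" by blast
  next
    fix A B assume "A \<in> {B \<in> BB. \<exists>A\<in>H. A \<subseteq> B}" and B: "B \<in> BB" "A \<subseteq> B"
    then obtain C where "C \<in> H" "C \<subseteq> A" by blast
    with B show "B \<in> {B \<in> BB. \<exists>A\<in>H. A \<subseteq> B}" using subset_trans[of C A B] by blast
  next
    show "{B \<in> BB. \<exists>A\<in>H. A \<subseteq> B} \<subseteq> BB" by blast
    show "{} \<notin> {B \<in> BB. \<exists>A\<in>H. A \<subseteq> B}" using that(2) by auto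
  qed
  let ?S = "{F. pf F \<and> G \<subseteq> F}"
  have "\<exists>M\<in>?S. \<forall>F\<in>?S. M \<subseteq> F \<longrightarrow> F = M"
  proof (rule subset_Zorn_nonempty)
    show "?S \<noteq> {}" using up[OF G(1,3,4)] G(1) by blast
  next
    fix C assume C: "C \<noteq> {}" "subset.chain ?S C"
    have pfC: "pf F" "G \<subseteq> F" if "F \<in> C" for F using C(2) that by (auto simp: subset.chain_def)
    have "A \<inter> B \<in> \<Union>C" if AB: "A \<in> \<Union>C" "B \<in> \<Union>C" for A B
    proof -
      obtain F F' where F: "F \<in> C" "A \<in> F" "F' \<in> C" "B \<in> F'" using AB by blast
      then have "F \<subseteq> F' \<or> F' \<subseteq> F" using C(2) by (auto simp: subset_chain_def)
      then show ?thesis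
      proof
        assume "F \<subseteq> F'"
        then have "A \<inter> B \<in> F'" using pfC(1)[OF F(3)] F by (auto simp: pf_def)
        then show ?thesis using F by blast
      next
        assume "F' \<subseteq> F"
        then have "A \<inter> B \<in> F" using pfC(1)[OF F(1)] F by (auto simp: pf_def)
        then show ?thesis using F by blast
      qed
    qed
    moreover have "B \<in> \<Union>C" if "A \<in> \<Union>C" "B \<in> BB" "A \<subseteq> B" for A B
    proof -
      obtain F where F: "F \<in> C" "A \<in> F" using \<open>A \<in> \<Union>C\<close> by blast
      then have "B \<in> F" using pfC(1)[OF F(1)] that(2,3) by (simp add: pf_def)
      then show ?thesis using F by blast
    qed
    moreover have "F \<subseteq> BB \<and> {} \<notin> F" if "F \<in> C" for F using pfC(1)[OF that] by (simp add: pf_def)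
    then have "\<Union>C \<subseteq> BB" "{} \<notin> \<Union>C" by (meson Sup_least, meson UnionE)
    ultimately have "pf (\<Union>C)" by (simp add: pf_def)
    then show "\<Union>C \<in> ?S" using C(1) pfC(2) by blast
  qed
  then obtain M where MS: "M \<in> ?S" "\<forall>F\<in>?S. M \<subseteq> F \<longrightarrow> F = M" by (rule bexE)
  then have M: "pf M" "G \<subseteq> M" "pf F \<Longrightarrow> G \<subseteq> F \<Longrightarrow> M \<subseteq> F \<Longrightarrow> F = M" for F by simp_all
  \<comment> \<open>If every member of \<open>M\<close> met \<open>A\<close>, their traces on
    \<open>A\<close> would generate a proper filter above \<open>M\<close> that contains
    \<open>A\<close>, against maximality.\<close>
  have split: "\<exists>C\<in>M. C \<inter> A = {}" if A: "A \<in> BB" "A \<notin> M" for A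
  proof (rule ccontr)
    assume no: "\<not> (\<exists>C\<in>M. C \<inter> A = {})"
    let ?H = "(\<lambda>C. C \<inter> A) ` M"
    have "pf {B \<in> BB. \<exists>A\<in>?H. A \<subseteq> B}"
    proof (rule up)
      show "?H \<subseteq> BB" using M(1) A(1) by (auto simp: pf_def)
      show "{} \<notin> ?H" using no by auto
      fix X Z assume "X \<in> ?H" "Z \<in> ?H"
      then obtain C D where "C \<in> M" "D \<in> M" "X = C \<inter> A" "Z = D \<inter> A" by blast
      moreover from this have "C \<inter> D \<in> M" "X \<inter> Z = (C \<inter> D) \<inter> A" using M(1) by (auto simp: pf_def)
      ultimately show "X \<inter> Z \<in> ?H" by blast
    qed
    moreover have "M \<subseteq> {B \<in> BB. \<exists>A\<in>?H. A \<subseteq> B}" using M(1) by (auto simp: pf_def)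
    ultimately have "{B \<in> BB. \<exists>A\<in>?H. A \<subseteq> B} = M" using M(3) subset_trans[OF M(2)] by simp
    moreover have "A \<in> {B \<in> BB. \<exists>A\<in>?H. A \<subseteq> B}" using A(1) M(2) G(2) by blast
    ultimately show False using A(2) by blast
  qed
  have "A \<in> M \<or> B \<in> M" if AB: "A \<in> BB" "B \<in> BB" "A \<union> B \<in> M" for A B
  proof (rule ccontr)
    assume "\<not> (A \<in> M \<or> B \<in> M)"
    then obtain C D where CD: "C \<in> M" "C \<inter> A = {}" "D \<in> M" "D \<inter> B = {}" using split AB by meson
    then have "(C \<inter> D) \<inter> (A \<union> B) \<in> M" using M(1) AB(3) by (auto simp: pf_def)
    moreover have "(C \<inter> D) \<inter> (A \<union> B) = {}" using CD by auto
    ultimately show False using M(1) by (simp add: pf_def)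
  qed
  then have "prime0 M" using M(1) by (auto simp: pf_def prime0_def)
  then show ?thesis using M(2) by blast
qed

definition pull :: "'a \<Rightarrow> 'v set set \<Rightarrow> 'v set set" where
  "pull a \<eta> = {A \<in> BB. rr A [a] \<in> \<eta>}"

lemma rr_Un: "rr (A \<union> B) [a] = rr A [a] \<union> rr B [a]"
  by (auto simp: rset_def)

text \<open>Taking ranges along a letter preserves unions always and intersections by normality, so
  preimages of prime filters are prime.\<close>

lemma prime0_pull: "prime0 \<eta> \<Longrightarrow> prime0 (pull a \<eta>)"
proof -
  assume \<eta>: "prime0 \<eta>"
  show ?thesis
    unfolding prime0_def
  proof (intro conjI ballI impI)
    show "pull a \<eta> \<subseteq> BB" by (auto simp: pull_def)
    show "{} \<notin> pull a \<eta>" using prime0_D(2)[OF \<eta>] by (auto simp: pull_def)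
  next
    fix A B assume "A \<in> pull a \<eta>" "B \<in> pull a \<eta>"
    then show "A \<inter> B \<in> pull a \<eta>" using prime0_D(3)[OF \<eta>] by (simp add: pull_def rr_Int)
  next
    fix A B assume AB: "A \<in> pull a \<eta>" "B \<in> BB" "A \<subseteq> B"
    then have "rr A [a] \<in> \<eta>" "rr A [a] \<subseteq> rr B [a]" "rr B [a] \<in> BB" by (auto simp: pull_def rset_mono)
    then show "B \<in> pull a \<eta>" using prime0_D(4)[OF \<eta>] AB(2) unfolding pull_def by blast
  next
    fix A B assume "A \<in> BB" "B \<in> BB" "A \<union> B \<in> pull a \<eta>"
    then show "A \<in> pull a \<eta> \<or> B \<in> pull a \<eta>"
      using prime0_D(5)[OF \<eta>, of "rr A [a]" "rr B [a]"] by (auto simp: pull_def rr_Un)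
  qed
qed

definition singular :: "'v set set \<Rightarrow> bool" where
  "singular \<xi> \<longleftrightarrow> (\<forall>A\<in>\<xi>. \<not> regular_set rg sg lab BB A)"

text \<open>A regular \<open>A\<close> in \<xi> emits finitely many labels. If each were missing
  from some member of \<xi>, intersecting these with \<open>A\<close> would leave a nonempty subset
  of \<open>A\<close> that emits nothing. So some \<open>a\<close> is emitted by every member, and
  the ranges along \<open>a\<close> extend to a prime filter \<eta>.\<close>

lemma edge_exists:
  assumes \<xi>: "prime0 \<xi>" and ns: "\<not> singular \<xi>"
  shows "\<exists>a \<eta>. prime0 \<eta> \<and> rw [a] \<in> \<eta> \<and> \<xi> = pull a \<eta>"
proof -
  obtain A where A: "A \<in> \<xi>" "regular_set rg sg lab BB A" using ns by (auto simp: singular_def)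
  have meet: "\<exists>B\<in>\<xi>. B \<subseteq> A \<and> (\<forall>a\<in>L. rr B [a] = {})" if "finite L" "\<forall>a\<in>L. \<exists>B\<in>\<xi>. rr B [a] = {}" for L
    using that
  proof induction
    case empty
    then show ?case using A by blast
  next
    case (insert a L)
    then obtain B C where B: "B \<in> \<xi>" "B \<subseteq> A" "\<forall>a\<in>L. rr B [a] = {}" and C: "C \<in> \<xi>" "rr C [a] = {}" by blast
    have "B \<inter> C \<in> \<xi>" "B \<inter> C \<subseteq> A" using B C prime0_D(3)[OF \<xi>] by auto
    moreover have "rr (B \<inter> C) [b] = {}" if "b \<in> insert a L" for b
      using rset_mono[of "B \<inter> C" B rg sg lab "[b]"] rset_mono[of "B \<inter> C" C rg sg lab "[b]"] B C that by auto
    ultimately show ?case by blast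
  qed
  have "\<exists>a. \<forall>B\<in>\<xi>. rr B [a] \<noteq> {}"
  proof (rule ccontr)
    assume no: "\<not> ?thesis"
    have fin: "finite (out_labels rg sg lab A)" using A(2) by (auto simp: regular_set_def)
    have "\<exists>B\<in>\<xi>. B \<subseteq> A \<and> (\<forall>a\<in>out_labels rg sg lab A. rr B [a] = {})"
      by (rule meet[OF fin]) (use no in simp)
    then obtain B where B: "B \<in> \<xi>" "B \<subseteq> A" "\<forall>a\<in>out_labels rg sg lab A. rr B [a] = {}" by auto
    have "B \<in> BB" "B \<noteq> {}" using prime0_D(1,2)[OF \<xi> B(1)] by auto
    then have "0 < card (out_labels rg sg lab B)" using A(2) B(2) by (auto simp: regular_set_def)
    then obtain a where "a \<in> out_labels rg sg lab B" by fastforce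
    moreover from this have "a \<in> out_labels rg sg lab A"
      using rset_mono[OF B(2), of rg sg lab "[a]"] by (auto simp: out_labels_def)
    ultimately show False using B(3) by (auto simp: out_labels_def)
  qed
  then obtain a where a: "\<And>B. B \<in> \<xi> \<Longrightarrow> rr B [a] \<noteq> {}" by blast
  have "\<exists>\<eta>. prime0 \<eta> \<and> (\<lambda>B. rr B [a]) ` \<xi> \<subseteq> \<eta>"
  proof (rule prime_extension)
    show "(\<lambda>B. rr B [a]) ` \<xi> \<subseteq> BB" using prime0_D(1)[OF \<xi>] by auto
    show "(\<lambda>B. rr B [a]) ` \<xi> \<noteq> {}" using A by auto
    show "{} \<notin> (\<lambda>B. rr B [a]) ` \<xi>" using a by force
    fix X Z assume "X \<in> (\<lambda>B. rr B [a]) ` \<xi>" "Z \<in> (\<lambda>B. rr B [a]) ` \<xi>"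
    then obtain B C where "B \<in> \<xi>" "C \<in> \<xi>" "X = rr B [a]" "Z = rr C [a]" by blast
    moreover from this have "B \<inter> C \<in> \<xi>" "X \<inter> Z = rr (B \<inter> C) [a]"
      using prime0_D(1,3)[OF \<xi>] by (simp_all add: rr_Int)
    ultimately show "X \<inter> Z \<in> (\<lambda>B. rr B [a]) ` \<xi>" by blast
  qed
  then obtain \<eta> where \<eta>: "prime0 \<eta>" "\<And>B. B \<in> \<xi> \<Longrightarrow> rr B [a] \<in> \<eta>" by blast
  have "rw [a] \<in> \<eta>"
    using prime0_D(4)[OF \<eta>(1) \<eta>(2)[OF A(1)], of "rw [a]"] by (simp add: rset_subset_rword)
  moreover have "\<xi> = pull a \<eta>"
  proof
    show "\<xi> \<subseteq> pull a \<eta>" using \<eta>(2) prime0_D(1)[OF \<xi>] by (auto simp: pull_def)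
    \<comment> \<open>Primeness of \<xi> decides between \<open>A - B\<close> and
      \<open>A \<inter> B\<close>; the former would put two disjoint ranges into \<eta>.\<close>
    show "pull a \<eta> \<subseteq> \<xi>"
    proof
      fix B assume "B \<in> pull a \<eta>"
      then have B: "B \<in> BB" "rr B [a] \<in> \<eta>" by (auto simp: pull_def)
      have ABB: "A \<in> BB" using prime0_D(1)[OF \<xi> A(1)] .
      have "A - B \<notin> \<xi>"
      proof
        assume "A - B \<in> \<xi>"
        then have "rr (A - B) [a] \<inter> rr B [a] \<in> \<eta>" using prime0_D(3)[OF \<eta>(1)] \<eta>(2) B by blast
        moreover have "rr (A - B) [a] \<inter> rr B [a] = {}"
          using rr_Int[of "A - B" B "[a]"] B ABB by (simp add: Int_commute)
        ultimately show False using prime0_D(2)[OF \<eta>(1)] by blast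
      qed
      moreover have "(A - B) \<union> (A \<inter> B) \<in> \<xi>" using A(1) by (simp add: Un_Diff_Int)
      ultimately have "A \<inter> B \<in> \<xi>" using prime0_D(5)[OF \<xi>, of "A - B" "A \<inter> B"] B ABB by auto
      then show "B \<in> \<xi>" using prime0_D(4)[OF \<xi>] B by blast
    qed
  qed
  ultimately show ?thesis using \<eta>(1) by blast
qed

text \<open>Boundary paths: a filter followed by a sequence of labelled steps between prime filters,
  which may stop only at a filter without regular sets. The source filter is determined by the
  first step, and it may be empty.\<close>
coinductive bpath :: "'v set set \<Rightarrow> (nat \<Rightarrow> ('a \<times> 'v set set) option) \<Rightarrow> bool" where
  stop: "prime0 \<xi> \<Longrightarrow> singular \<xi> \<Longrightarrow> bpath \<xi> (\<lambda>_. None)"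
| step: "prime0 \<eta> \<Longrightarrow> rw [a] \<in> \<eta> \<Longrightarrow> \<sigma> 0 = Some (a, \<eta>) \<Longrightarrow> bpath \<eta> (\<lambda>n. \<sigma> (Suc n)) \<Longrightarrow> bpath (pull a \<eta>) \<sigma>"

lemma bpath_prime0: "bpath \<xi> \<sigma> \<Longrightarrow> prime0 \<xi>"
  by (erule bpath.cases) (auto intro: prime0_pull)

lemma bpath_Some:
  "bpath \<xi> \<sigma> \<Longrightarrow> \<sigma> 0 = Some (a, \<eta>) \<Longrightarrow> \<xi> = pull a \<eta> \<and> prime0 \<eta> \<and> rw [a] \<in> \<eta> \<and> bpath \<eta> (\<lambda>n. \<sigma> (Suc n))"
  by (erule bpath.cases) auto

lemma bpath_None: "bpath \<xi> \<sigma> \<Longrightarrow> \<sigma> 0 = None \<Longrightarrow> singular \<xi>"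
  by (erule bpath.cases) auto

text \<open>A fixed choice of continuation at every filter that may not stop, from which
  \<open>walk\<close> builds a whole boundary path.\<close>

definition next_step :: "'v set set \<Rightarrow> ('a \<times> 'v set set) option" where
  "next_step \<xi> = (if singular \<xi> then None
     else Some (SOME (a, \<eta>). prime0 \<eta> \<and> rw [a] \<in> \<eta> \<and> \<xi> = pull a \<eta>))"

fun walk :: "nat \<Rightarrow> 'v set set \<Rightarrow> ('a \<times> 'v set set) option" where
  "walk 0 \<xi> = next_step \<xi>"
| "walk (Suc n) \<xi> = (case next_step \<xi> of None \<Rightarrow> None | Some (a, \<eta>) \<Rightarrow> walk n \<eta>)"

text \<open>The tail of a walk is the walk from the next filter, so walks satisfy the coinductive
  rule. Every prime filter is thus the source of a boundary path.\<close>

lemma bpath_walk: "prime0 \<xi> \<Longrightarrow> bpath \<xi> (\<lambda>n. walk n \<xi>)"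
proof -
  assume "prime0 \<xi>"
  then have "prime0 \<xi> \<and> (\<lambda>n. walk n \<xi>) = (\<lambda>n. walk n \<xi>)" by simp
  then show ?thesis
  proof (coinduct rule: bpath.coinduct[where X = "\<lambda>\<xi> \<sigma>. prime0 \<xi> \<and> \<sigma> = (\<lambda>n. walk n \<xi>)"])
    case (bpath \<xi> \<sigma>)
    show ?case
    proof (cases "singular \<xi>")
      case True
      have "walk n \<xi> = None" for n by (cases n) (simp_all add: next_step_def True)
      then show ?thesis using bpath True by auto
    next
      case False
      define W where "W = (\<lambda>(a, \<eta>). prime0 \<eta> \<and> rw [a] \<in> \<eta> \<and> \<xi> = pull a \<eta>)"
      have "\<exists>x. W x" using edge_exists[of \<xi>] bpath False by (auto simp: W_def)
      then have "W (SOME x. W x)" by (rule someI_ex)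
      moreover obtain a \<eta> where x: "(SOME x. W x) = (a, \<eta>)" by (cases "SOME x. W x")
      ultimately have "W (a, \<eta>)" by simp
      then have "prime0 \<eta>" "rw [a] \<in> \<eta>" "\<xi> = pull a \<eta>" by (simp_all add: W_def)
      moreover have n: "next_step \<xi> = Some (a, \<eta>)"
        using False x unfolding next_step_def W_def by simp
      moreover have "(\<lambda>m. \<sigma> (Suc m)) = (\<lambda>m. walk m \<eta>)" "\<sigma> 0 = Some (a, \<eta>)" using bpath n by auto
      ultimately show ?thesis by blast
    qed
  qed
qed

section \<open>The action of words on boundary paths\<close>

fun act1 :: "('v, 'a) gen \<Rightarrow> 'v set set \<times> (nat \<Rightarrow> ('a \<times> 'v set set) option) \<Rightarrow>
    ('v set set \<times> (nat \<Rightarrow> ('a \<times> 'v set set) option)) option" where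
  "act1 (P A) (\<xi>, \<sigma>) = (if A \<in> \<xi> then Some (\<xi>, \<sigma>) else None)"
| "act1 (S a) (\<xi>, \<sigma>) = (case \<sigma> 0 of None \<Rightarrow> None
     | Some (b, \<eta>) \<Rightarrow> if b = a then Some (\<eta>, \<lambda>n. \<sigma> (Suc n)) else None)"
| "act1 (Sst a) (\<xi>, \<sigma>) = (if rw [a] \<in> \<xi> then Some (pull a \<xi>, case_nat (Some (a, \<xi>)) \<sigma>) else None)"

primrec actw where
  "actw [] x = Some x"
| "actw (u # w) x = Option.bind (act1 u x) (actw w)"

abbreviation "isbp x \<equiv> bpath (fst x) (snd x)"

lemma act1_bpath: "isbp x \<Longrightarrow> act1 u x = Some y \<Longrightarrow> isbp y"
proof (induction u x rule: act1.induct)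
  case (2 a \<xi> \<sigma>)
  then show ?case using bpath_Some by (auto split: option.splits if_splits)
next
  case (3 a \<xi> \<sigma>)
  then show ?case using bpath.step[of \<xi> a "case_nat (Some (a, \<xi>)) \<sigma>"] bpath_prime0[of \<xi> \<sigma>]
    by (auto split: if_splits)
qed (auto split: if_splits)

lemma actw_bpath: "isbp x \<Longrightarrow> actw w x = Some y \<Longrightarrow> isbp y"
  by (induction w arbitrary: x) (auto simp: bind_eq_Some_conv dest: act1_bpath)

lemma actw_append: "actw (u @ v) x = Option.bind (actw u x) (actw v)"
proof (induction u arbitrary: x)
  case (Cons a u)
  then show ?case by (cases "act1 a x") simp_all
qed simp

text \<open>Words act on functions by composition with partial maps, with value 0 where the map is
  undefined. This is contravariant, so in \<open>act1\<close> the generator \<open>S a\<close>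
  removes a first step and \<open>Sst a\<close> adds one.\<close>

definition actf where
  "actf w \<psi> x = (case actw w x of None \<Rightarrow> 0 | Some y \<Rightarrow> \<psi> y)"

lemma actf_append: "actf (u @ v) \<psi> x = actf u (actf v \<psi>) x"
  by (auto simp: actf_def actw_append split: option.splits bind_splits)

text \<open>The kernel of the representation on functions of boundary paths, tested at each function
  and each path.\<close>

definition kills :: "(('v, 'a) gen list \<Rightarrow> 'r::comm_ring_1) \<Rightarrow> bool" where
  "kills f \<longleftrightarrow> fin_supp f \<and> (\<forall>\<psi> x. isbp x \<longrightarrow> ev (\<lambda>w. actf w \<psi> x) f = 0)"

lemma kills_fmono_mul: "kills f \<Longrightarrow> kills (fmul (fmono u) f)"
  unfolding kills_def
proof (intro conjI allI impI)
  fix \<psi> x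
  assume f: "fin_supp f \<and> (\<forall>\<psi> x. isbp x \<longrightarrow> ev (\<lambda>w. actf w \<psi> x) f = 0)" and x: "isbp x"
  have "ev (\<lambda>w. actf w \<psi> x) (fmul (fmono u) f) = ev (\<lambda>w. actf u (actf w \<psi>) x) f"
    using f by (simp add: ev_fmono_mul actf_append)
  also have "\<dots> = 0"
  proof (cases "actw u x")
    case None
    then show ?thesis by (simp add: actf_def ev_def)
  next
    case (Some y)
    then have "ev (\<lambda>w. actf w \<psi> y) f = 0" using f actw_bpath[OF x] by blast
    then show ?thesis using Some by (simp add: actf_def[of u])
  qed
  finally show "ev (\<lambda>w. actf w \<psi> x) (fmul (fmono u) f) = 0" .
qed auto

lemma kills_mul_fmono: "kills f \<Longrightarrow> kills (fmul f (fmono u))"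
  by (simp add: kills_def ev_mul_fmono actf_append)

lemma kills_fadd: "kills f \<Longrightarrow> kills g \<Longrightarrow> kills (fadd f g)"
  and kills_fsmul: "kills f \<Longrightarrow> kills (fsmul c f)"
  and kills_fzero: "kills fzero"
  by (auto simp: kills_def ev_fadd ev_fsmul)

lemma kills_diff:
  "(\<And>x. isbp x \<Longrightarrow> actw u x = actw v x) \<Longrightarrow> kills (fsub (fmono u) (fmono v))"
  by (simp add: kills_def ev_fsub actf_def)

lemma actw_out_and_back:
  assumes "bpath \<xi> \<sigma>" "\<sigma> 0 = Some (a, \<eta>)"
  shows "actw [Sst a] (\<eta>, \<lambda>n. \<sigma> (Suc n)) = Some (\<xi>, \<sigma>)"
proof -
  have "\<xi> = pull a \<eta>" "rw [a] \<in> \<eta>" using bpath_Some[OF assms] by auto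
  moreover have "case_nat (Some (a, \<eta>)) (\<lambda>n. \<sigma> (Suc n)) = \<sigma>"
    using assms(2) by (auto split: nat.splits)
  ultimately show ?thesis by simp
qed

text \<open>A path that stops has a singular filter, so neither side sees it. On a path whose first
  label is \<open>b\<close> only the summand of \<open>b\<close> survives, and it agrees with
  \<open>p A\<close> because \<open>A\<close> lies in the source filter exactly if
  \<open>rr A [b]\<close> lies in the next one.\<close>

lemma kills_CK:
  assumes A: "A \<in> Breg rg sg lab BB"
  shows "kills (fsub (pA A) (fsum (\<lambda>a. fmono [S a, P (rset rg sg lab A [a]), Sst a]) (out_labels rg sg lab A)) ::
    ('v, 'a) gen list \<Rightarrow> 'r::comm_ring_1)"
proof -
  let ?O = "out_labels rg sg lab A"
  have fin: "finite ?O" and AB: "A \<in> BB"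
    using A by (auto simp: Breg_def regular_set_def out_labels_def)
  have "actf [P A] \<psi> x = (\<Sum>a\<in>?O. actf [S a, P (rr A [a]), Sst a] \<psi> x)"
    if x: "isbp x" for x and \<psi> :: "_ \<Rightarrow> 'r::comm_ring_1"
  proof -
    obtain \<xi> \<sigma> where xx: "x = (\<xi>, \<sigma>)" by (cases x)
    have bp: "bpath \<xi> \<sigma>" using x xx by simp
    show ?thesis
    proof (cases "\<sigma> 0")
      case None
      then have "A \<notin> \<xi>" using bpath_None[OF bp None] prime0_D(2)[OF bpath_prime0[OF bp]] A
        by (auto simp: singular_def Breg_def)
      then show ?thesis using None by (simp add: xx actf_def)
    next
      case (Some bn)
      then obtain b \<eta> where b: "\<sigma> 0 = Some (b, \<eta>)" by (cases bn) auto
      have \<eta>: "\<xi> = pull b \<eta>" "prime0 \<eta>" using bpath_Some[OF bp b] by auto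
      have "actf [S a, P (rr A [a]), Sst a] \<psi> x = (if a = b then actf [P A] \<psi> x else 0)" for a
        using b actw_out_and_back[OF bp b] \<eta> AB by (auto simp: xx actf_def pull_def)
      moreover have "actf [P A] \<psi> x = 0" if "b \<notin> ?O"
      proof -
        have "rr A [b] \<notin> \<eta>" using that prime0_D(2)[OF \<eta>(2)] by (auto simp: out_labels_def)
        then show ?thesis using \<eta> by (simp add: xx actf_def pull_def)
      qed
      ultimately show ?thesis using fin by simp
    qed
  qed
  then show ?thesis unfolding kills_def using fin
    by (intro conjI allI impI) (simp_all only: ev_fsub ev_fsum ev_fmono fin_supp_fsub fin_supp_fsum fin_supp_fmono diff_self)
qed

lemma kills_rels:
  fixes f :: "('v, 'a) gen list \<Rightarrow> 'r::comm_ring_1"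
  shows "f \<in> lpa_rels rg sg lab BB \<Longrightarrow> kills f"
  unfolding lpa_rels_def fmono_append[symmetric]
proof (elim UnE)
  assume "f \<in> (\<Union>A\<in>BB. \<Union>B\<in>BB. {fsub (pA (A \<inter> B)) (fmono ([P A] @ [P B])),
      fsub (pA (A \<union> B)) (fsub (fadd (pA A) (pA B)) (pA (A \<inter> B)))})"
  then obtain A B where AB: "A \<in> BB" "B \<in> BB" and f: "f = fsub (pA (A \<inter> B)) (fmono ([P A] @ [P B])) \<or>
      f = fsub (pA (A \<union> B)) (fsub (fadd (pA A) (pA B)) (pA (A \<inter> B)))" by blast
  have I: "A \<inter> B \<in> \<xi> \<longleftrightarrow> A \<in> \<xi> \<and> B \<in> \<xi>" and U: "A \<union> B \<in> \<xi> \<longleftrightarrow> A \<in> \<xi> \<or> B \<in> \<xi>" if "prime0 \<xi>" for \<xi>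
  proof -
    show "A \<inter> B \<in> \<xi> \<longleftrightarrow> A \<in> \<xi> \<and> B \<in> \<xi>"
      using prime0_D(3,4)[OF that] AB by (metis inf_le1 inf_le2)
    show "A \<union> B \<in> \<xi> \<longleftrightarrow> A \<in> \<xi> \<or> B \<in> \<xi>"
      using prime0_D(5)[OF that AB] prime0_D(4)[OF that _ Un_BB[OF AB]] by (metis Un_upper1 Un_upper2)
  qed
  from f show ?thesis
  proof
    assume "f = fsub (pA (A \<inter> B)) (fmono ([P A] @ [P B]))"
    then show ?thesis using I bpath_prime0 by (auto intro!: kills_diff)
  next
    assume f: "f = fsub (pA (A \<union> B)) (fsub (fadd (pA A) (pA B)) (pA (A \<inter> B)))"
    have "actf [P (A \<union> B)] \<psi> x = actf [P A] \<psi> x + actf [P B] \<psi> x - actf [P (A \<inter> B)] \<psi> x"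
      if "isbp x" for x and \<psi> :: "_ \<Rightarrow> 'r"
      using I[OF bpath_prime0[OF that]] U[OF bpath_prime0[OF that]] by (cases x) (simp add: actf_def)
    then show ?thesis unfolding kills_def f
      by (intro conjI allI impI) (simp_all only: ev_fsub ev_fadd ev_fmono fin_supp_fsub fin_supp_fadd fin_supp_fmono diff_self)
  qed
next
  assume "f \<in> {pA {}}"
  then show ?thesis using prime0_D(2)[OF bpath_prime0] by (auto simp: kills_def actf_def)
next
  assume "f \<in> (\<Union>A\<in>BB. \<Union>a\<in>range lab. {fsub (fmono ([P A] @ [S a])) (fmono ([S a] @ [P (rr A [a])])),
      fsub (fmono ([Sst a] @ [P A])) (fmono ([P (rr A [a])] @ [Sst a]))})"
  then obtain A a where A: "A \<in> BB" and f: "f = fsub (fmono ([P A] @ [S a])) (fmono ([S a] @ [P (rr A [a])])) \<or>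
      f = fsub (fmono ([Sst a] @ [P A])) (fmono ([P (rr A [a])] @ [Sst a]))" by blast
  have "actw ([P A] @ [S a]) x = actw ([S a] @ [P (rr A [a])]) x" if "isbp x" for x
    using that A bpath_Some[of "fst x" "snd x"]
    by (cases x) (fastforce simp: pull_def split: option.splits)
  moreover have "actw ([Sst a] @ [P A]) x = actw ([P (rr A [a])] @ [Sst a]) x" for x
    using A by (cases x) (auto simp: pull_def)
  ultimately show ?thesis using f by (auto intro!: kills_diff)
next
  assume "f \<in> (\<Union>a\<in>range lab. {fsub (fmono ([Sst a] @ [S a])) (pA (rw [a])),
      fsub (fmono ([S a] @ [Sst a] @ [S a])) (sa a), fsub (fmono ([Sst a] @ [S a] @ [Sst a])) (sas a)})"
  then obtain a where f: "f = fsub (fmono ([Sst a] @ [S a])) (pA (rw [a])) \<or>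
      f = fsub (fmono ([S a] @ [Sst a] @ [S a])) (sa a) \<or> f = fsub (fmono ([Sst a] @ [S a] @ [Sst a])) (sas a)" by blast
  have "actw ([Sst a] @ [S a]) x = actw [P (rw [a])] x" for x
    by (cases x) auto
  moreover have "actw ([S a] @ [Sst a] @ [S a]) x = actw [S a] x" if "isbp x" for x
    using that bpath_Some[of "fst x" "snd x"] by (cases x) (auto split: option.splits)
  moreover have "actw ([Sst a] @ [S a] @ [Sst a]) x = actw [Sst a] x" for x
    by (cases x) auto
  ultimately show ?thesis using f by (auto intro!: kills_diff)
next
  assume "f \<in> {fmono ([Sst b] @ [S a]) | a b. a \<in> range lab \<and> b \<in> range lab \<and> b \<noteq> a}"
  then show ?thesis by (auto simp: kills_def actf_def)
next
  assume "f \<in> {fsub (pA A) (fsum (\<lambda>a. fmono ([S a] @ [P (rr A [a])] @ [Sst a])) (out_labels rg sg lab A)) |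
      A. A \<in> Breg rg sg lab BB}"
  then show ?thesis using kills_CK by auto
qed

lemma kills_ideal: "f \<in> lpa_ideal rg sg lab BB \<Longrightarrow> kills f"
  unfolding lpa_ideal_def
proof (induction rule: gen_ideal.induct)
  case (lmul f x)
  from lmul(1) show ?case
    by (induction rule: freeF_induct)
      (simp_all add: kills_fzero fmul_add_left fmul_smul_left kills_fadd kills_fsmul kills_fmono_mul lmul.IH)
next
  case (rmul f x)
  from rmul(1) show ?case
    by (induction rule: freeF_induct)
      (simp_all add: kills_fzero fmul_add_right fmul_smul_right kills_fadd kills_fsmul kills_mul_fmono rmul.IH)
qed (auto intro: kills_rels kills_fzero kills_fadd kills_fsmul)

text \<open>A prime filter containing \<open>A\<close> starts a boundary path, and there the element
  sends the constant function 1 to \<open>c\<close>.\<close>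

lemma scalar_projection_faithful:
  assumes "A \<in> BB" "A \<noteq> {}" "fsmul c (pA A) \<in> lpa_ideal rg sg lab BB"
  shows "c = 0"
proof -
  obtain \<xi> where \<xi>: "prime0 \<xi>" "A \<in> \<xi>" using prime_extension[of "{A}"] assms(1,2) by auto
  let ?x = "(\<xi>, \<lambda>n. walk n \<xi>)"
  have "isbp ?x" using bpath_walk[OF \<xi>(1)] by simp
  then have "ev (\<lambda>w. actf w (\<lambda>_. 1) ?x) (fsmul c (pA A)) = 0"
    using kills_ideal[OF assms(3)] unfolding kills_def by blast
  then show ?thesis using \<xi>(2) by (simp add: ev_fsmul actf_def)
qed

end

section \<open>The Leavitt labelled path algebra\<close>

text \<open>Discards all words that use a set outside \<open>BB\<close> or a letter outside the
  alphabet; it is multiplicative because a product word is valid exactly if both pieces are.\<close>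

definition restr :: "('e \<Rightarrow> 'a) \<Rightarrow> 'v set set \<Rightarrow> (('v, 'a) gen list \<Rightarrow> 'r::comm_ring_1) \<Rightarrow> ('v, 'a) gen list \<Rightarrow> 'r" where
  "restr lab BB f = (\<lambda>w. if \<forall>x\<in>set w. valid_gen lab BB x then f w else 0)"

lemma restr_fzero [simp]: "restr lab BB fzero = fzero"
  and restr_fadd: "restr lab BB (fadd f g) = fadd (restr lab BB f) (restr lab BB g)"
  by (auto simp: restr_def fzero_def fadd_def)

lemma restr_fmul: "restr lab BB (fmul f g) = fmul (restr lab BB f) (restr lab BB g)"
proof
  fix w
  show "restr lab BB (fmul f g) w = fmul (restr lab BB f) (restr lab BB g) w"
  proof (cases "\<forall>x\<in>set w. valid_gen lab BB x")
    case True
    then have "\<forall>x\<in>set (take i w). valid_gen lab BB x" "\<forall>x\<in>set (drop i w). valid_gen lab BB x" for i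
      using set_take_subset[of i w] set_drop_subset[of i w] by blast+
    then show ?thesis using True by (simp add: restr_def fmul_def)
  next
    case False
    have "restr lab BB f (take i w) * restr lab BB g (drop i w) = 0" for i
    proof -
      have "set w = set (take i w) \<union> set (drop i w)" by (metis append_take_drop_id set_append)
      then show ?thesis using False by (auto simp: restr_def)
    qed
    then have "fmul (restr lab BB f) (restr lab BB g) w = 0" by (simp add: fmul_def)
    moreover have "restr lab BB (fmul f g) w = 0" unfolding restr_def using False by (rule if_not_P)
    ultimately show ?thesis by simp
  qed
qed

lemma restr_freeF: "f \<in> freeF lab BB \<Longrightarrow> restr lab BB f = f"
  by (auto simp: restr_def freeF_def fun_eq_iff)

lemma restr_split:
  assumes "fin_supp f"
  obtains f0 where "f0 \<in> freeF lab BB" "restr lab BB f = fadd (fsmul (f []) (fmono [])) f0"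
proof
  let ?f = "(restr lab BB f)([] := 0)"
  have "finite {w. ?f w \<noteq> 0}"
    by (rule finite_subset[of _ "{w. f w \<noteq> 0}"]) (use assms in \<open>auto simp: restr_def fin_supp_def split: if_splits\<close>)
  then show "?f \<in> freeF lab BB" by (auto simp: freeF_def restr_def split: if_splits)
  show "restr lab BB f = fadd (fsmul (f []) (fmono [])) ?f"
    by (auto simp: restr_def fadd_def fsmul_def fmono_def)
qed

lemma gen_ideal_subset_freeF: "X \<subseteq> freeF lab BB \<Longrightarrow> x \<in> gen_ideal (freeF lab BB) X \<Longrightarrow> x \<in> freeF lab BB"
proof -
  assume X: "X \<subseteq> freeF lab BB"
  assume "x \<in> gen_ideal (freeF lab BB) X"
  then show ?thesis by induction (use X in auto)
qed

text \<open>A restricted factor is a scalar plus an element of \<open>freeF\<close>, and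
  \<open>gen_ideal\<close> is closed under multiplication by both.\<close>

lemma two_sided_restr:
  fixes X :: "(('v, 'a) gen list \<Rightarrow> 'r::comm_ring_1) set"
  assumes "X \<subseteq> freeF lab BB"
  shows "two_sided {f. fin_supp f \<and> restr lab BB f \<in> gen_ideal (freeF lab BB) X}"
  unfolding two_sided_def
proof (intro conjI ballI allI impI CollectI; (elim CollectE conjE)?)
  fix f g :: "('v, 'a) gen list \<Rightarrow> 'r"
  assume f: "fin_supp f" and g: "fin_supp g" "restr lab BB g \<in> gen_ideal (freeF lab BB) X"
  obtain f0 where f0: "f0 \<in> freeF lab BB" "restr lab BB f = fadd (fsmul (f []) (fmono [])) f0"
    using restr_split[OF f] .
  show "restr lab BB (fmul f g) \<in> gen_ideal (freeF lab BB) X"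
    using g f0(1) by (simp add: restr_fmul f0(2) fmul_add_left fmul_smul_left gen_ideal.intros)
  show "restr lab BB (fmul g f) \<in> gen_ideal (freeF lab BB) X"
    using g f0(1) by (simp add: restr_fmul f0(2) fmul_add_right fmul_smul_right gen_ideal.intros)
qed (auto simp: restr_fadd gen_ideal.zero gen_ideal.add)

locale lpa_space = normal_space rg sg lab BB
  for rg sg :: "'e \<Rightarrow> 'v" and lab :: "'e \<Rightarrow> 'a" and BB :: "'v set set" +
  fixes coeff :: "'r::comm_ring_1 itself"
begin

abbreviation rel_ideal :: "(('v, 'a) gen list \<Rightarrow> 'r) set" where "rel_ideal \<equiv> lpa_ideal rg sg lab BB"

text \<open>The quotient by this ideal is the algebra with a unit adjoined; invalid generators
  become 0, and \<open>emb\<close> restricted to \<open>freeF\<close> has kernel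
  \<open>rel_ideal\<close>.\<close>

definition null_ideal :: "(('v, 'a) gen list \<Rightarrow> 'r) set" where
  "null_ideal = {f. fin_supp f \<and> restr lab BB f \<in> rel_ideal}"

definition emb :: "(('v, 'a) gen list \<Rightarrow> 'r) \<Rightarrow> ('v, 'a, 'r) all_quots" where
  "emb f = qemb null_ideal f"

lemma out_labels_range: "out_labels rg sg lab A \<subseteq> range lab"
proof
  fix a assume "a \<in> out_labels rg sg lab A"
  then show "a \<in> range lab" using rset_not_range[of a lab rg sg A] by (auto simp: out_labels_def)
qed

lemma rels_freeF: "(lpa_rels rg sg lab BB :: (('v, 'a) gen list \<Rightarrow> 'r) set) \<subseteq> freeF lab BB"
proof
  fix f :: "('v, 'a) gen list \<Rightarrow> 'r" assume "f \<in> lpa_rels rg sg lab BB"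
  then show "f \<in> freeF lab BB"
    unfolding lpa_rels_def fmono_append[symmetric]
  proof (elim UnE)
    assume "f \<in> {fsub (pA A) (fsum (\<lambda>a. fmono ([S a] @ [P (rr A [a])] @ [Sst a])) (out_labels rg sg lab A)) |
      A. A \<in> Breg rg sg lab BB}"
    then obtain A where A: "A \<in> Breg rg sg lab BB" and
      f: "f = fsub (pA A) (fsum (\<lambda>a. fmono ([S a] @ [P (rr A [a])] @ [Sst a])) (out_labels rg sg lab A))" by blast
    have "finite (out_labels rg sg lab A)" "A \<in> BB"
      using A by (auto simp: Breg_def regular_set_def out_labels_def)
    then show ?thesis unfolding f using out_labels_range[of A]
      by (intro freeF_fsub freeF_fsum) auto
  qed auto
qed

lemma rel_ideal_freeF: "f \<in> rel_ideal \<Longrightarrow> f \<in> freeF lab BB"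
  unfolding lpa_ideal_def by (rule gen_ideal_subset_freeF[OF rels_freeF])

lemma two_sided_null_ideal: "two_sided null_ideal"
  unfolding null_ideal_def lpa_ideal_def by (rule two_sided_restr[OF rels_freeF])

lemma emb_eq_0: "fin_supp f \<Longrightarrow> emb f = 0 \<longleftrightarrow> restr lab BB f \<in> rel_ideal"
  by (simp add: emb_def qemb_eq_0[OF two_sided_null_ideal]) (simp add: null_ideal_def)

lemma emb_eq_0_freeF: "f \<in> freeF lab BB \<Longrightarrow> emb f = 0 \<longleftrightarrow> f \<in> rel_ideal"
  using emb_eq_0[of f] by (simp add: freeF_fin_supp restr_freeF)

lemma emb_add: "fin_supp f \<Longrightarrow> fin_supp g \<Longrightarrow> emb (fadd f g) = emb f + emb g"
  and emb_sub: "fin_supp f \<Longrightarrow> fin_supp g \<Longrightarrow> emb (fsub f g) = emb f - emb g"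
  and emb_mul: "fin_supp f \<Longrightarrow> fin_supp g \<Longrightarrow> emb (fmul f g) = emb f * emb g"
  and emb_smul: "fin_supp f \<Longrightarrow> emb (fsmul c f) = qscal c * emb f"
  by (simp_all add: emb_def qemb_add qemb_sub qemb_mul qemb_smul)

lemma emb_fzero: "emb fzero = 0"
  by (simp add: emb_eq_0_freeF) (simp add: lpa_ideal_def gen_ideal.zero)

lemma emb_rel: "fsub f g \<in> lpa_rels rg sg lab BB \<Longrightarrow> fin_supp f \<Longrightarrow> fin_supp g \<Longrightarrow> emb f = emb g"
proof -
  assume r: "fsub f g \<in> lpa_rels rg sg lab BB" and f: "fin_supp f" "fin_supp g"
  have "fsub f g \<in> rel_ideal" unfolding lpa_ideal_def by (rule gen_ideal.base[OF r])
  then show ?thesis using emb_eq_0_freeF[OF rel_ideal_freeF] emb_sub[OF f] by simp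
qed

lemma emb_rel0: "f \<in> lpa_rels rg sg lab BB \<Longrightarrow> emb f = 0"
  using emb_eq_0_freeF[OF rel_ideal_freeF] gen_ideal.base[of f _ "freeF lab BB"] unfolding lpa_ideal_def by blast

lemma emb_sa_invalid: "a \<notin> range lab \<Longrightarrow> emb (sa a) = 0"
  and emb_sas_invalid: "a \<notin> range lab \<Longrightarrow> emb (sas a) = 0"
proof -
  assume a: "a \<notin> range lab"
  have "restr lab BB (sa a :: ('v, 'a) gen list \<Rightarrow> 'r) = fzero" "restr lab BB (sas a :: ('v, 'a) gen list \<Rightarrow> 'r) = fzero"
    using a by (auto simp: restr_def fmono_def fzero_def)
  then show "emb (sa a) = 0" "emb (sas a) = 0"
    by (simp_all add: emb_eq_0) (simp_all add: lpa_ideal_def gen_ideal.zero)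
qed

lemma rw_invalid: "a \<notin> range lab \<Longrightarrow> rw [a] = {}"
  by (simp add: rword_def rset_not_range)

sublocale labelled_rep rg sg lab BB "qscal :: 'r \<Rightarrow> _" "\<lambda>A. emb (pA A)" "\<lambda>a. emb (sa a)" "\<lambda>a. emb (sas a)"
proof
  show e: "emb (pA {}) = 0" by (rule emb_rel0) (simp add: lpa_rels_def)
  fix A B and a b :: 'a and c d :: 'r
  show "qscal (1::'r) = 1" "qscal (c + d) = qscal c + qscal d" "qscal (c * d) = qscal c * qscal d"
    by (rule qscal_1 qscal_add qscal_mult)+
  show "x * qscal c = qscal c * x" for x by (rule qscal_comm)
  { assume AB: "A \<in> BB" "B \<in> BB"
    have "emb (pA (A \<inter> B)) = emb (fmul (pA A) (pA B))"
      by (rule emb_rel) (use AB in \<open>auto simp: lpa_rels_def\<close>)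
    then show "emb (pA A) * emb (pA B) = emb (pA (A \<inter> B))" by (simp add: emb_mul)
    have "emb (pA (A \<union> B)) = emb (fsub (fadd (pA A) (pA B)) (pA (A \<inter> B)))"
      by (rule emb_rel) (use AB in \<open>auto simp: lpa_rels_def\<close>)
    then show "emb (pA (A \<union> B)) = emb (pA A) + emb (pA B) - emb (pA (A \<inter> B))" by (simp add: emb_sub emb_add) }
  { assume A: "A \<in> BB"
    show "emb (pA A) * emb (sa a) = emb (sa a) * emb (pA (rr A [a]))"
    proof (cases "a \<in> range lab")
      case True
      have "emb (fmul (pA A) (sa a)) = emb (fmul (sa a) (pA (rr A [a])))"
        by (rule emb_rel) (use A True in \<open>auto simp: lpa_rels_def\<close>)
      then show ?thesis by (simp add: emb_mul)
    qed (simp add: emb_sa_invalid)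
    show "emb (sas a) * emb (pA A) = emb (pA (rr A [a])) * emb (sas a)"
    proof (cases "a \<in> range lab")
      case True
      have "emb (fmul (sas a) (pA A)) = emb (fmul (pA (rr A [a])) (sas a))"
        by (rule emb_rel) (use A True in \<open>auto simp: lpa_rels_def\<close>)
      then show ?thesis by (simp add: emb_mul)
    qed (simp add: emb_sas_invalid) }
  show "emb (sas a) * emb (sa a) = emb (pA (rw [a]))"
  proof (cases "a \<in> range lab")
    case True
    have "emb (fmul (sas a) (sa a)) = emb (pA (rw [a]))"
      by (rule emb_rel) (use True in \<open>auto simp: lpa_rels_def\<close>)
    then show ?thesis by (simp add: emb_mul)
  qed (simp add: emb_sa_invalid rw_invalid e)
  show "emb (sas b) * emb (sa a) = 0" if "a \<noteq> b"
  proof (cases "a \<in> range lab \<and> b \<in> range lab")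
    case True
    have "emb (fmul (sas b) (sa a)) = 0"
    proof (rule emb_rel0)
      show "fmul (sas b) (sa a) \<in> (lpa_rels rg sg lab BB :: (('v, 'a) gen list \<Rightarrow> 'r) set)"
        unfolding lpa_rels_def
        by (rule UnI1, rule UnI2, rule CollectI, rule exI[of _ a], rule exI[of _ b]) (use True that in simp)
    qed
    then show ?thesis by (simp add: emb_mul)
  qed (auto simp: emb_sa_invalid emb_sas_invalid)
  show "emb (sa a) * (emb (sas a) * emb (sa a)) = emb (sa a)"
  proof (cases "a \<in> range lab")
    case True
    have "emb (fmul (sa a) (fmul (sas a) (sa a))) = emb (sa a)"
      by (rule emb_rel) (use True in \<open>auto simp: lpa_rels_def\<close>)
    then show ?thesis by (simp add: emb_mul)
  qed (simp add: emb_sa_invalid)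
  show "emb (sas a) * (emb (sa a) * emb (sas a)) = emb (sas a)"
  proof (cases "a \<in> range lab")
    case True
    have "emb (fmul (sas a) (fmul (sa a) (sas a))) = emb (sas a)"
      by (rule emb_rel) (use True in \<open>auto simp: lpa_rels_def\<close>)
    then show ?thesis by (simp add: emb_mul)
  qed (simp add: emb_sas_invalid)
qed

lemma emb_fmono_append: "emb (fmono (u @ v)) = emb (fmono u) * emb (fmono v)"
  by (simp add: fmono_append emb_mul)

lemma emb_sw: "emb (fmono (map S \<alpha> @ w)) = sw \<alpha> * emb (fmono w)"
proof (induction \<alpha>)
  case (Cons a \<alpha>)
  have "fmono (map S (a # \<alpha>) @ w) = (fmul (sa a) (fmono (map S \<alpha> @ w)) :: _ \<Rightarrow> 'r)"
    using fmono_append[of "[S a]" "map S \<alpha> @ w"] by simp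
  then show ?case using Cons by (simp add: emb_mul sw_Cons mult.assoc)
qed simp

lemma emb_tw: "emb (fmono (w @ rev (map Sst \<alpha>))) = emb (fmono w) * tw \<alpha>"
proof (induction \<alpha> arbitrary: w)
  case (Cons a \<alpha>)
  have "w @ rev (map Sst (a # \<alpha>)) = (w @ rev (map Sst \<alpha>)) @ [Sst a]" by simp
  then show ?case using Cons[of w] by (simp only: emb_fmono_append tw_Cons mult.assoc)
qed simp

lemma wdeg_map: "wdeg (map S \<alpha>) = int (length \<alpha>)" "wdeg (rev (map Sst \<alpha>)) = - int (length \<alpha>)"
  by (induction \<alpha>) auto

text \<open>Lifts membership in a graded span to a representative whose words have the right
  degrees, so that components can be compared in the free algebra.\<close>

lemma hspan_homogeneous:
  assumes "y \<in> hspan D"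
  shows "\<exists>f. fin_supp f \<and> y = emb f \<and> (\<forall>w. f w \<noteq> 0 \<longrightarrow> wdeg w \<in> D)"
  using assms unfolding hspan_def
proof (induction rule: kspan.induct)
  case zero
  show ?case by (rule exI[of _ fzero]) (simp add: emb_fzero, simp add: fzero_def)
next
  case (step x y c)
  then obtain f where f: "fin_supp f" "y = emb f" "\<And>w. f w \<noteq> 0 \<Longrightarrow> wdeg w \<in> D" by blast
  obtain \<alpha> A \<beta> where x: "x = sw \<alpha> * (emb (pA A) * tw \<beta>)" "int (length \<alpha>) - int (length \<beta>) \<in> D"
    using step by blast
  let ?w = "map S \<alpha> @ [P A] @ rev (map Sst \<beta>)"
  have "x = emb (fmono ?w)" by (simp only: x emb_sw emb_tw)
  then have eq: "qscal c * x + y = emb (fadd (fsmul c (fmono ?w)) f)" using f by (simp add: emb_add emb_smul)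
  have "wdeg ?w \<in> D" using x(2) by (simp add: wdeg_map)
  then have "fadd (fsmul c (fmono ?w)) f v \<noteq> 0 \<Longrightarrow> wdeg v \<in> D" for v
    using f(3) by (auto simp: fadd_def fsmul_def fmono_def split: if_splits)
  then show ?case using f(1) eq by (intro exI[of _ "fadd (fsmul c (fmono ?w)) f"]) simp
qed

lemma rel_ideal_hcomp: "f \<in> rel_ideal \<Longrightarrow> hcomp n f \<in> rel_ideal"
  unfolding lpa_ideal_def using gen_ideal_hcomp lpa_rels_homog by blast

sublocale labelled_graded_rep rg sg lab BB "qscal :: 'r \<Rightarrow> _" "\<lambda>A. emb (pA A)" "\<lambda>a. emb (sa a)" "\<lambda>a. emb (sas a)"
proof
  fix A and c :: 'r
  assume A: "A \<in> BB" and z: "qscal c * emb (pA A) = 0"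
  have "emb (fsmul c (pA A)) = 0" using z by (simp add: emb_smul)
  then have "fsmul c (pA A) \<in> rel_ideal" using A by (subst (asm) emb_eq_0_freeF) auto
  then show "c = 0 \<or> A = {}" using scalar_projection_faithful[OF A] by blast
next
  fix x y assume xy: "x \<in> hspan {0}" "y \<in> hspan (- {0})" "x + y = 0"
  obtain f where f: "fin_supp f" "x = emb f" "\<And>w. f w \<noteq> 0 \<Longrightarrow> wdeg w = 0" using hspan_homogeneous[OF xy(1)] by blast
  obtain h where h: "fin_supp h" "y = emb h" "\<And>w. h w \<noteq> 0 \<Longrightarrow> wdeg w \<noteq> 0" using hspan_homogeneous[OF xy(2)] by blast
  have "restr lab BB (fadd f h) \<in> rel_ideal" using xy(3) f(1,2) h(1,2) emb_eq_0[of "fadd f h"] by (simp add: emb_add)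
  then have "hcomp 0 (restr lab BB (fadd f h)) \<in> rel_ideal" by (rule rel_ideal_hcomp)
  \<comment> \<open>The two representatives have disjoint degrees, so the degree 0 component of
    their sum is the first one, and it lies in the graded ideal.\<close>
  moreover have "hcomp 0 (restr lab BB (fadd f h)) w = restr lab BB f w" for w
    using f(3)[of w] h(3)[of w] by (auto simp: hcomp_def restr_def fadd_def)
  then have "hcomp 0 (restr lab BB (fadd f h)) = restr lab BB f" by (rule ext)
  ultimately show "x = 0" using f(1,2) emb_eq_0 by simp
qed

text \<open>Single letters have spanning form because \<open>s a = s a * p (rw [a])\<close>, and
  dually; longer words are built up by left multiplication.\<close>

lemma emb_word_hspan: "w \<noteq> [] \<Longrightarrow> \<forall>x\<in>set w. valid_gen lab BB x \<Longrightarrow> emb (fmono w) \<in> hspan UNIV"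
proof (induction w)
  case (Cons x w)
  have one: "emb (fmono [x]) \<in> hspan UNIV"
  proof (cases x)
    case (P A)
    then show ?thesis using Cons.prems hspan_base[of A "[]" "[]" UNIV] by simp
  next
    case (S a)
    then show ?thesis using hspan_base[of "rw [a]" "[a]" "[]" UNIV] by (simp add: sw_Cons s_rw)
  next
    case (Sst a)
    then show ?thesis using hspan_base[of "rw [a]" "[]" "[a]" UNIV] by (simp add: tw_Cons rw_t)
  qed
  show ?case
  proof (cases "w = []")
    case False
    then have y: "emb (fmono w) \<in> hspan UNIV" using Cons by simp
    have "emb (fmono (x # w)) = emb (fmono [x]) * emb (fmono w)" using emb_fmono_append[of "[x]" w] by simp
    moreover have "emb (fmono [x]) * emb (fmono w) \<in> hspan UNIV"
    proof (cases x)
      case (P A)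
      then show ?thesis using hspan_p[OF y, of A] Cons.prems by simp
    next
      case (S a)
      then show ?thesis using hspan_s[OF y, of a] hspan_mono[of _ UNIV] by blast
    next
      case (Sst a)
      then show ?thesis using hspan_t[OF y, of a] hspan_mono[of _ UNIV] by blast
    qed
    ultimately show ?thesis by simp
  qed (use one in simp)
qed simp

lemma emb_hspan: "f \<in> freeF lab BB \<Longrightarrow> emb f \<in> hspan UNIV"
proof (induction rule: freeF_induct)
  case zero
  show ?case by (simp add: emb_fzero hspan_zero)
next
  case (step c w h)
  then show ?case using emb_word_hspan[of w] unfolding hspan_def
    by (simp add: emb_add emb_smul freeF_fin_supp kspan_add kspan_scale)
qed

lemma gen_subalg_freeF: "m \<in> gen_subalg (core_gens rg sg lab BB) \<Longrightarrow> (m :: _ \<Rightarrow> 'r) \<in> freeF lab BB"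
proof (induction rule: gen_subalg.induct)
  case (base x)
  have "a \<in> range lab" if "\<alpha> \<in> words rg sg lab" "a \<in> set \<alpha>" for \<alpha> a
    using that by (auto simp: words_def)
  with base show ?case unfolding core_gens_def is_cycle_def by auto
qed auto

lemma core_alg_emb: "x \<in> core_alg \<Longrightarrow> \<exists>m\<in>gen_subalg (core_gens rg sg lab BB). x = emb m"
proof (induction rule: core_alg.induct)
  case (diag \<alpha> A)
  let ?w = "map S \<alpha> @ [P A] @ rev (map Sst \<alpha>)"
  have "fmono ?w \<in> gen_subalg (core_gens rg sg lab BB)"
    using diag by (intro gen_subalg.base) (auto simp: core_gens_def)
  moreover have "sw \<alpha> * (emb (pA A) * tw \<alpha>) = emb (fmono ?w)" by (simp only: emb_sw emb_tw)
  ultimately show ?case by blast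
next
  case (cyc_tw \<alpha> \<gamma> C)
  let ?w = "map S \<alpha> @ [P C] @ rev (map Sst \<gamma>) @ rev (map Sst \<alpha>)"
  have "fmono ?w \<in> gen_subalg (core_gens rg sg lab BB)"
    using cyc_tw by (intro gen_subalg.base) (auto simp: core_gens_def)
  moreover have "sw \<alpha> * (emb (pA C) * (tw \<gamma> * tw \<alpha>)) = emb (fmono ?w)"
    using emb_tw[of "[P C] @ rev (map Sst \<gamma>)" \<alpha>] by (simp only: emb_sw emb_tw append_assoc mult.assoc)
  ultimately show ?case by blast
next
  case (cyc_sw \<alpha> \<gamma> C)
  let ?w = "map S \<alpha> @ map S \<gamma> @ [P C] @ rev (map Sst \<alpha>)"
  have "fmono ?w \<in> gen_subalg (core_gens rg sg lab BB)"
    using cyc_sw by (intro gen_subalg.base) (auto simp: core_gens_def)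
  moreover have "sw \<alpha> * (sw \<gamma> * (emb (pA C) * tw \<alpha>)) = emb (fmono ?w)" by (simp only: emb_sw emb_tw)
  ultimately show ?case by blast
next
  case zero
  then show ?case using gen_subalg.zero emb_fzero by metis
next
  case (add x y)
  then obtain m m' where "m \<in> gen_subalg (core_gens rg sg lab BB)" "m' \<in> gen_subalg (core_gens rg sg lab BB)"
    "x = emb m" "y = emb m'" by blast
  then show ?case
    by (intro bexI[of _ "fadd m m'"]) (simp_all add: emb_add freeF_fin_supp[OF gen_subalg_freeF] gen_subalg.add)
next
  case (scale x c)
  then obtain m where "m \<in> gen_subalg (core_gens rg sg lab BB)" "x = emb m" by blast
  then show ?case
    by (intro bexI[of _ "fsmul c m"]) (simp_all add: emb_smul freeF_fin_supp[OF gen_subalg_freeF] gen_subalg.smul)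
next
  case (mult x y)
  then obtain m m' where "m \<in> gen_subalg (core_gens rg sg lab BB)" "m' \<in> gen_subalg (core_gens rg sg lab BB)"
    "x = emb m" "y = emb m'" by blast
  then show ?case
    by (intro bexI[of _ "fmul m m'"]) (simp_all add: emb_mul freeF_fin_supp[OF gen_subalg_freeF] gen_subalg.mul)
qed

text \<open>Passes between equality in the ring and equality of classes in \<open>LPA\<close>, so
  that a homomorphism defined on classes can be tested on ring elements.\<close>

lemma emb_eq_cls:
  assumes "f \<in> freeF lab BB" "h \<in> freeF lab BB"
  shows "emb f = emb h \<longleftrightarrow> lpa_cls rg sg lab BB f = lpa_cls rg sg lab BB h"
proof -
  have rel: "(f, h) \<in> lpa_rel rg sg lab BB \<longleftrightarrow> f \<in> freeF lab BB \<and> h \<in> freeF lab BB \<and> emb f = emb h"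
    for f h :: "('v, 'a) gen list \<Rightarrow> 'r"
    using emb_eq_0_freeF[of "fsub f h"] by (auto simp: lpa_rel_def emb_sub freeF_fin_supp)
  have "lpa_cls rg sg lab BB f = {k \<in> freeF lab BB. emb f = emb k}"
    "lpa_cls rg sg lab BB h = {k \<in> freeF lab BB. emb h = emb k}"
    using assms by (auto simp: lpa_cls_def rel)
  then show ?thesis using assms by auto
qed

end

section \<open>From kernels of homomorphisms to ideals of the ring\<close>

theorem theorem8p14:
  fixes rg sg :: "'e \<Rightarrow> 'v" and lab :: "'e \<Rightarrow> 'a" and BB :: "'v set set"
    and smul :: "'r::comm_ring_1 \<Rightarrow> 'b::ring \<Rightarrow> 'b"
    and \<phi> :: "(('v, 'a) gen list \<Rightarrow> 'r) set \<Rightarrow> 'b"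
  assumes "normal_labelled_space rg sg lab BB"
    and "r_algebra smul"
    and "lpa_hom rg sg lab BB smul \<phi>"
  shows "inj_on \<phi> (LPA rg sg lab BB) \<longleftrightarrow> inj_on \<phi> (abelian_core rg sg lab BB)"
proof -
  interpret lpa_space rg sg lab BB "TYPE('r)"
    by unfold_locales (rule assms(1))
  let ?cls = "lpa_cls rg sg lab BB :: (('v, 'a) gen list \<Rightarrow> 'r) \<Rightarrow> _"
  let ?F = "freeF lab BB :: (('v, 'a) gen list \<Rightarrow> 'r) set"
  have LPA: "LPA rg sg lab BB = ?cls ` ?F"
    by (auto simp: LPA_def quotient_def lpa_cls_def)
  have core: "abelian_core rg sg lab BB \<subseteq> ?cls ` ?F"
    unfolding abelian_core_def using gen_subalg_freeF by blast
  have hom_add: "\<phi> (?cls (fadd f g)) = \<phi> (?cls f) + \<phi> (?cls g)"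
    and hom_mul: "\<phi> (?cls (fmul f g)) = \<phi> (?cls f) * \<phi> (?cls g)" if "f \<in> ?F" "g \<in> ?F" for f g
    using assms(3) that unfolding lpa_hom_def by blast+
  have hom_zero: "\<phi> (?cls fzero) = 0"
    using hom_add[of fzero fzero] by simp
  have hom_sub: "\<phi> (?cls (fsub f g)) = \<phi> (?cls f) - \<phi> (?cls g)" if "f \<in> ?F" "g \<in> ?F" for f g
  proof -
    have "fadd (fsub f g) g = f" by (simp add: fadd_def fsub_def)
    then show ?thesis using hom_add[of "fsub f g" g] that by simp
  qed
  show ?thesis
  proof
    assume "inj_on \<phi> (LPA rg sg lab BB)"
    then show "inj_on \<phi> (abelian_core rg sg lab BB)" using core LPA inj_on_subset by metis
  next
    assume inj: "inj_on \<phi> (abelian_core rg sg lab BB)"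
    \<comment> \<open>The kernel of \<phi>, transported into the ring where the ideal argument
      applies.\<close>
    define J where "J = emb ` {f \<in> ?F. \<phi> (?cls f) = 0}"
    have J_emb_mul: "emb h * x \<in> J \<and> x * emb h \<in> J" if hx: "h \<in> ?F" "x \<in> J" for h x
    proof -
      obtain f where f: "f \<in> ?F" "\<phi> (?cls f) = 0" "x = emb f" using hx(2) by (auto simp: J_def)
      have "emb (fmul h f) \<in> J" "emb (fmul f h) \<in> J"
        unfolding J_def using hx(1) f by (auto intro!: imageI simp: hom_mul)
      then show ?thesis using hx(1) f by (simp add: emb_mul freeF_fin_supp)
    qed
    have J_gen: "emb (fmono [u]) * x \<in> J \<and> x * emb (fmono [u]) \<in> J" if "valid_gen lab BB u" "x \<in> J" for u x
      by (rule J_emb_mul) (use that in auto)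
    have zJ: "0 \<in> J" unfolding J_def using emb_fzero hom_zero by (auto intro!: image_eqI[of _ _ fzero])
    interpret labelled_ideal rg sg lab BB "qscal :: 'r \<Rightarrow> _" "\<lambda>A. emb (pA A)" "\<lambda>a. emb (sa a)" "\<lambda>a. emb (sas a)" J
    proof
      fix x y assume "x \<in> J" "y \<in> J"
      then obtain f g where fg: "f \<in> ?F" "\<phi> (?cls f) = 0" "x = emb f" "g \<in> ?F" "\<phi> (?cls g) = 0" "y = emb g"
        by (auto simp: J_def)
      then have "emb (fsub f g) \<in> J" unfolding J_def by (intro imageI) (simp add: hom_sub)
      then show "x - y \<in> J" using fg by (simp add: emb_sub freeF_fin_supp)
    next
      fix x a assume x: "x \<in> J"
      show "emb (sa a) * x \<in> J" "x * emb (sa a) \<in> J"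
        using J_gen[of "S a", OF _ x] zJ by (cases "a \<in> range lab"; simp add: emb_sa_invalid)+
      show "emb (sas a) * x \<in> J" "x * emb (sas a) \<in> J"
        using J_gen[of "Sst a", OF _ x] zJ by (cases "a \<in> range lab"; simp add: emb_sas_invalid)+
    next
      fix A x assume "A \<in> BB" "x \<in> J"
      then show "emb (pA A) * x \<in> J" "x * emb (pA A) \<in> J" using J_gen[of "P A"] by simp_all
    qed
    show "inj_on \<phi> (LPA rg sg lab BB)"
      unfolding LPA
    proof (rule inj_onI, elim imageE)
      fix X X' f g
      assume fg: "\<phi> X = \<phi> X'" "X = ?cls f" "f \<in> ?F" "X' = ?cls g" "g \<in> ?F"
      have d: "fsub f g \<in> ?F" using fg by simp
      have "emb (fsub f g) = 0"
      proof (rule ccontr)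
        assume nz: "emb (fsub f g) \<noteq> 0"
        have "emb (fsub f g) \<in> J" unfolding J_def using fg d by (intro imageI) (simp add: hom_sub)
        then obtain y where y: "y \<in> J" "y \<in> core_alg" "y \<noteq> 0" using core_meets_ideal emb_hspan[OF d] nz by blast
        obtain h where h: "h \<in> ?F" "\<phi> (?cls h) = 0" "y = emb h" using y(1) by (auto simp: J_def)
        obtain m where m: "m \<in> gen_subalg (core_gens rg sg lab BB)" "y = emb m" using core_alg_emb[OF y(2)] by blast
        \<comment> \<open>The same ring element has a representative killed by \<phi> and one in the
          core; injectivity on the core makes it 0.\<close>
        have "?cls h = ?cls m" using emb_eq_cls[OF h(1) gen_subalg_freeF[OF m(1)]] h(3) m(2) by simp
        then have "\<phi> (?cls m) = \<phi> (?cls fzero)" using h(2) hom_zero by simp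
        then have "?cls m = ?cls fzero"
          using inj m(1) gen_subalg.zero unfolding abelian_core_def by (blast dest: inj_onD)
        then have "emb m = emb fzero" using emb_eq_cls[OF gen_subalg_freeF[OF m(1)], of fzero] by simp
        then show False using m(2) y(3) emb_fzero by simp
      qed
      then have "emb f = emb g" using fg by (simp add: emb_sub freeF_fin_supp)
      then show "X = X'" using fg emb_eq_cls by simp
    qed
  qed
qed

end
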